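(* Let $\Gamma\subset\mathbb{C}$ be a lattice. A Dirac torus with the conformal class of $\mathbb{C}/\Gamma$ exists if and only if there exists a rectangular sublattice of the dual lattice $\Gamma^*$ spanned by two vectors $\omega_1,\omega_2$ with $|\omega_1|^2=b\,|\omega_2|^2$ and $b\in\mathbb{Q}$.
   Context: A Dirac torus with the conformal class of $\mathbb{C}/\Gamma$ is a conformal immersion $f:\mathbb{C}/\Gamma\to\mathbb{R}^3$ such that $H^2f^*g_{\mathbb{R}^3}$ is a flat (Riemannian) metric, where $H$ is the mean curvature of $f$ and $f^*g_{\mathbb{R}^3}$ its first fundamental form. The dual lattice of $\Gamma$ is $\Gamma^*=\{\omega\in\mathbb{C}:\langle\omega,\gamma\rangle\in2\pi\mathbb{Z}\text{ for all }\gamma\in\Gamma\}$, where $\langle w,z\rangle=\operatorname{Re}(w\bar z)$ is the standard Euclidean inner product on $\mathbb{C}\cong\mathbb{R}^2$. A rectangular sublattice is a rank-two sublattice spanned over $\mathbb{Z}$ by two nonzero vectors $\omega_1,\omega_2$ that are orthogonal with respect to $\langle\cdot,\cdot\rangle$. *)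

theory Defs
  imports "HOL-Analysis.Analysis"
begin

definition int_span :: "complex \<Rightarrow> complex \<Rightarrow> complex set" where
  "int_span a b = {of_int m * a + of_int n * b | m n :: int. True}"

definition complex_lattice :: "complex set \<Rightarrow> bool" where
  "complex_lattice \<Gamma> \<longleftrightarrow> (\<exists>a b. a \<noteq> b \<and> independent {a, b} \<and> \<Gamma> = int_span a b)"

text \<open>The library's inner product on \<^typ>\<open>complex\<close> is
  \<open>Re (w * cnj z)\<close>.\<close>

definition dual_lattice :: "complex set \<Rightarrow> complex set" where
  "dual_lattice \<Gamma> = {\<omega>. \<forall>\<gamma>\<in>\<Gamma>. \<exists>k::int. \<omega> \<bullet> \<gamma> = 2 * pi * of_int k}"

text \<open>Nonzero orthogonal vectors are linearly independent, so the span below automatically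
  has rank two.\<close>

definition spans_rectangular_sublattice :: "complex set \<Rightarrow> complex \<Rightarrow> complex \<Rightarrow> bool" where
  "spans_rectangular_sublattice L \<omega>1 \<omega>2 \<longleftrightarrow>
     \<omega>1 \<noteq> 0 \<and> \<omega>2 \<noteq> 0 \<and> \<omega>1 \<bullet> \<omega>2 = 0 \<and> int_span \<omega>1 \<omega>2 \<subseteq> L"


definition dir_deriv ::
    "complex \<Rightarrow> (complex \<Rightarrow> 'a::real_normed_vector) \<Rightarrow> complex \<Rightarrow> 'a" where
  "dir_deriv v h z = frechet_derivative h (at z) v"

fun Ck :: "nat \<Rightarrow> (complex \<Rightarrow> 'a::real_normed_vector) \<Rightarrow> bool" where
  "Ck 0 h \<longleftrightarrow> continuous_on UNIV h"
| "Ck (Suc k) h \<longleftrightarrow> (\<forall>z. h differentiable (at z)) \<and> (\<forall>v. Ck k (dir_deriv v h))"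

definition smooth :: "(complex \<Rightarrow> 'a::real_normed_vector) \<Rightarrow> bool" where
  "smooth h \<longleftrightarrow> (\<forall>k. Ck k h)"


text \<open>A field of bilinear forms has type \<^typ>\<open>complex \<Rightarrow> complex \<Rightarrow> complex \<Rightarrow> real\<close>: the first
  argument is the base point, the other two are tangent vectors. Tensors on the torus
  \<open>\<complex> / \<Gamma>\<close> are represented by their lifts to the universal cover. Indices range over
  the two-element type \<^typ>\<open>2\<close> and refer to the real coordinates \<open>x\<close>, \<open>y\<close> of \<open>z = x + \<i> y\<close>.\<close>

definition coord_vec :: "2 \<Rightarrow> complex" where
  "coord_vec i = (if i = 1 then 1 else \<i>)"

definition coeff_matrix :: "(complex \<Rightarrow> complex \<Rightarrow> complex \<Rightarrow> real) \<Rightarrow> complex \<Rightarrow> real^2^2" where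
  "coeff_matrix g z = (\<chi> i j. g z (coord_vec i) (coord_vec j))"

definition riemannian_metric :: "(complex \<Rightarrow> complex \<Rightarrow> complex \<Rightarrow> real) \<Rightarrow> bool" where
  "riemannian_metric g \<longleftrightarrow>
     (\<forall>z. bilinear (g z) \<and> (\<forall>v w. g z v w = g z w v) \<and> (\<forall>v. v \<noteq> 0 \<longrightarrow> 0 < g z v v)) \<and>
     (\<forall>v w. smooth (\<lambda>z. g z v w))"

text \<open>\<open>christoffel g k i j\<close> is the Christoffel symbol of the second kind with upper index \<open>k\<close>.\<close>

definition christoffel ::
    "(complex \<Rightarrow> complex \<Rightarrow> complex \<Rightarrow> real) \<Rightarrow> 2 \<Rightarrow> 2 \<Rightarrow> 2 \<Rightarrow> complex \<Rightarrow> real" where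
  "christoffel g k i j z =
     (\<Sum>l\<in>UNIV. matrix_inv (coeff_matrix g z) $ k $ l *
        (dir_deriv (coord_vec i) (\<lambda>w. coeff_matrix g w $ j $ l) z
         + dir_deriv (coord_vec j) (\<lambda>w. coeff_matrix g w $ i $ l) z
         - dir_deriv (coord_vec l) (\<lambda>w. coeff_matrix g w $ i $ j) z)) / 2"

text \<open>\<open>riemann_tensor g l k i j\<close> is the \<open>l\<close>-th component of \<open>R(\<partial>\<^sub>i, \<partial>\<^sub>j) \<partial>\<^sub>k\<close> for the Levi-Civita
  connection.\<close>

definition riemann_tensor ::
    "(complex \<Rightarrow> complex \<Rightarrow> complex \<Rightarrow> real) \<Rightarrow> 2 \<Rightarrow> 2 \<Rightarrow> 2 \<Rightarrow> 2 \<Rightarrow> complex \<Rightarrow> real" where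
  "riemann_tensor g l k i j z =
     dir_deriv (coord_vec i) (christoffel g l j k) z
     - dir_deriv (coord_vec j) (christoffel g l i k) z
     + (\<Sum>m\<in>UNIV. christoffel g l i m z * christoffel g m j k z
                 - christoffel g l j m z * christoffel g m i k z)"

definition flat_metric :: "(complex \<Rightarrow> complex \<Rightarrow> complex \<Rightarrow> real) \<Rightarrow> bool" where
  "flat_metric g \<longleftrightarrow> riemannian_metric g \<and> (\<forall>l k i j z. riemann_tensor g l k i j z = 0)"


definition first_ff :: "(complex \<Rightarrow> real^3) \<Rightarrow> complex \<Rightarrow> complex \<Rightarrow> complex \<Rightarrow> real" where
  "first_ff f z v w = dir_deriv v f z \<bullet> dir_deriv w f z"

definition unit_normal :: "(complex \<Rightarrow> real^3) \<Rightarrow> complex \<Rightarrow> real^3" where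
  "unit_normal f z = sgn (cross3 (dir_deriv 1 f z) (dir_deriv \<i> f z))"

definition second_ff :: "(complex \<Rightarrow> real^3) \<Rightarrow> complex \<Rightarrow> complex \<Rightarrow> complex \<Rightarrow> real" where
  "second_ff f z v w = dir_deriv v (dir_deriv w f) z \<bullet> unit_normal f z"

definition mean_curvature :: "(complex \<Rightarrow> real^3) \<Rightarrow> complex \<Rightarrow> real" where
  "mean_curvature f z =
     trace (matrix_inv (coeff_matrix (first_ff f) z) ** coeff_matrix (second_ff f) z) / 2"

text \<open>A conformal immersion of the torus \<open>\<complex> / \<Gamma>\<close> is given by its \<open>\<Gamma>\<close>-periodic lift to \<open>\<complex>\<close>.
  Positivity of the conformal factor makes the differential injective.\<close>

definition conformal_immersion :: "complex set \<Rightarrow> (complex \<Rightarrow> real^3) \<Rightarrow> bool" where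
  "conformal_immersion \<Gamma> f \<longleftrightarrow>
     smooth f \<and>
     (\<forall>z. \<forall>\<gamma>\<in>\<Gamma>. f (z + \<gamma>) = f z) \<and>
     (\<forall>z. \<exists>\<rho>>0. \<forall>v w. first_ff f z v w = \<rho> * (v \<bullet> w))"

definition dirac_torus :: "complex set \<Rightarrow> (complex \<Rightarrow> real^3) \<Rightarrow> bool" where
  "dirac_torus \<Gamma> f \<longleftrightarrow>
     conformal_immersion \<Gamma> f \<and>
     flat_metric (\<lambda>z v w. (mean_curvature f z)\<^sup>2 * first_ff f z v w)"

end

theory Submission
  imports Defs "HOL-Complex_Analysis.Complex_Analysis"
begin

text \<open>If \<open>f\<close> is a Dirac torus, then flatness of \<open>H\<^sup>2 f\<^sup>* g\<close> makes the logarithm of its conformal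
  factor harmonic and periodic, so the factor is constant. The derivative of \<open>f\<close> is isotropic, hence
  quadratic in a spinor \<open>(p, q)\<close> that is determined up to sign, and the equation
  \<open>\<Delta>f = 2 H f\<^sub>x \<times> f\<^sub>y\<close> becomes the linear Dirac equation
  \<open>(\<partial>\<^sub>x + \<i> \<partial>\<^sub>y) p = - 2 \<kappa> q\<close>, \<open>(\<partial>\<^sub>x - \<i> \<partial>\<^sub>y) q = 2 \<kappa> p\<close> with a constant \<open>\<kappa>\<close>. The spinor is periodic for twice
  the lattice, so it is a finite trigonometric sum whose frequencies lie on the circle of radius
  \<open>2 \<bar>\<kappa>\<bar>\<close>. Sums and differences of two frequencies are orthogonal, and a third pair of frequencies
  forces the ratio of their squared lengths to be rational. If there are at most two pairs
  \<open>\<plusminus>\<omega>\<close>, the vanishing of the periods of \<open>p\<^sup>2\<close>, \<open>q\<^sup>2\<close>, \<open>p * cnj q\<close> forces \<open>p = q = 0\<close>.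

  Conversely, a rational rectangle contains isosceles triangles inscribed in circles about the origin.
  Taking their vertices as the frequencies, with weights that make the origin the barycentre, gives
  a spinor with vanishing periods; it has no zeros unless the triangle is equilateral.\<close>

subsection \<open>Calculus on the plane\<close>

text \<open>Flatness acts through one consequence: \<open>H * m\<close> is constant, where
  \<open>m\<^sup>2\<close> is the conformal factor, and this constant is
  \<open>2 * \<kappa>\<close>. Composing the two operators of the Dirac equation then gives
  \<open>\<Delta>p = - 4 \<kappa>\<^sup>2 p\<close>, which is why all frequencies have the same
  length. Two vectors of equal length span a rhombus, whose diagonals are orthogonal; so the
  rectangle comes for free and only its rationality needs a third pair.

  The obstacle is the sign of the spinor. The pair \<open>(p, q)\<close> arises by lifting through
  the double covering of the cone of isotropic vectors, so a lattice translation may reverse it. The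
  frequencies of the doubled lattice are halves of vectors of the dual lattice; multiplying by 2 at
  the end leaves the ratio of lengths unchanged.

  The spinor is expanded into waves only where the circle carries at most four frequencies, so
  uniqueness of Fourier coefficients takes the place of a convergence theorem.\<close>

lemma dir_deriv_eq: "(h has_derivative h') (at z) \<Longrightarrow> dir_deriv v h z = h' v"
  unfolding dir_deriv_def using frechet_derivative_at by metis

lemma smooth_has_derivative:
  assumes "smooth h"
  shows "(h has_derivative (\<lambda>v. dir_deriv v h z)) (at z)"
proof -
  have "Ck (Suc 0) h" using assms smooth_def by blast
  then have "h differentiable (at z)" by simp
  then show ?thesis unfolding dir_deriv_def by (simp add: frechet_derivative_works)
qed

lemma smooth_dir_deriv: "smooth h \<Longrightarrow> smooth (dir_deriv v h)"
  unfolding smooth_def using Ck.simps(2) by blast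

lemma smooth_continuous: "smooth h \<Longrightarrow> continuous_on A h"
  unfolding smooth_def by (meson Ck.simps(1) continuous_on_subset subset_UNIV)

lemma dir_deriv_const: "dir_deriv v (\<lambda>z. c) = (\<lambda>z. 0)"
  by (rule ext, rule dir_deriv_eq[where h'="\<lambda>v. 0"]) (rule has_derivative_const)

lemma smooth_const: "smooth (\<lambda>z. c)"
proof -
  have "Ck k (\<lambda>z::complex. c)" for k and c :: 'a
    by (induction k arbitrary: c) (simp_all add: dir_deriv_const)
  then show ?thesis by (simp add: smooth_def)
qed

lemma dir_deriv_cartesian:
  assumes "(h has_derivative h') (at z)"
  shows "dir_deriv v h z = Re v *\<^sub>R dir_deriv 1 h z + Im v *\<^sub>R dir_deriv \<i> h z"
proof -
  have l: "linear h'" using assms has_derivative_linear by blast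
  have "h' v = h' (Re v *\<^sub>R 1 + Im v *\<^sub>R \<i>)"
    by (rule arg_cong[where f=h']) (simp add: complex_eq_iff)
  also have "\<dots> = Re v *\<^sub>R h' 1 + Im v *\<^sub>R h' \<i>"
    by (simp add: linear_add[OF l] linear_scale[OF l])
  finally show ?thesis by (simp add: dir_deriv_eq[OF assms])
qed

text \<open>Integrate \<open>\<partial>\<^sub>w (\<partial>\<^sub>v g)\<close> along \<open>v\<close>: the Leibniz rule and the fundamental theorem give
  \<open>\<partial>\<^sub>w g\<close> back, so only one of the two mixed derivatives has to be continuous.\<close>

lemma dir_deriv_commute:
  fixes g :: "complex \<Rightarrow> 'a::euclidean_space"
  assumes "smooth g"
  shows "dir_deriv w (dir_deriv v g) z = dir_deriv v (dir_deriv w g) z"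
proof -
  have along: "((\<lambda>t. h (p + t *\<^sub>R u)) has_vector_derivative dir_deriv u h (p + t *\<^sub>R u)) (at t within S)"
    if "smooth h" for h :: "complex \<Rightarrow> 'a" and p u t S
  proof -
    have "((\<lambda>t. h (p + t *\<^sub>R u)) has_derivative (\<lambda>s. dir_deriv (s *\<^sub>R u) h (p + t *\<^sub>R u))) (at t within S)"
      by (rule has_derivative_compose[where g=h and f="\<lambda>t. p + t *\<^sub>R u", 
          OF _ smooth_has_derivative[OF that]]) (auto intro!: derivative_eq_intros)
    moreover have "dir_deriv (s *\<^sub>R u) h q = s *\<^sub>R dir_deriv u h q" for s q
      using has_derivative_linear[OF smooth_has_derivative[OF that]] linear_scale by blast
    ultimately show ?thesis by (simp add: has_vector_derivative_def)
  qed
  define k where "k = (\<lambda>s t. dir_deriv w (dir_deriv v g) (z + t *\<^sub>R v + s *\<^sub>R w))"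
  have sv: "smooth (dir_deriv v g)" and sw: "smooth (dir_deriv w g)" and swv: "smooth (dir_deriv w (dir_deriv v g))"
    using assms smooth_dir_deriv by blast+
  have int_eq: "integral {0..x} (k 0) = dir_deriv w g (z + x *\<^sub>R v) - dir_deriv w g z" if "x \<in> {0..1}" for x
  proof -
    have "((\<lambda>s. integral (cbox 0 x) (\<lambda>t. dir_deriv v g (z + t *\<^sub>R v + s *\<^sub>R w))) has_vector_derivative integral (cbox 0 x) (k 0)) (at 0 within UNIV)"
    proof (rule leibniz_rule_vector_derivative)
      show "((\<lambda>s. dir_deriv v g (z + t *\<^sub>R v + s *\<^sub>R w)) has_vector_derivative k s t) (at s within UNIV)" for s t
        unfolding k_def by (rule along[OF sv])
      show "(\<lambda>t. dir_deriv v g (z + t *\<^sub>R v + s *\<^sub>R w)) integrable_on cbox 0 x" for s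
        by (intro integrable_continuous continuous_on_compose2[OF smooth_continuous[OF sv, of UNIV]] continuous_intros) auto
      show "continuous_on (UNIV \<times> cbox 0 x) (\<lambda>(s,t). k s t)"
        unfolding k_def split_beta
        by (intro continuous_on_compose2[OF smooth_continuous[OF swv, of UNIV]] continuous_intros) auto
    qed auto
    moreover have "integral (cbox 0 x) (\<lambda>t. dir_deriv v g (z + t *\<^sub>R v + s *\<^sub>R w)) = g (z + x *\<^sub>R v + s *\<^sub>R w) - g (z + s *\<^sub>R w)" for s
    proof -
      have "((\<lambda>t. dir_deriv v g ((z + s *\<^sub>R w) + t *\<^sub>R v)) has_integral g ((z + s *\<^sub>R w) + x *\<^sub>R v) - g ((z + s *\<^sub>R w) + 0 *\<^sub>R v)) {0..x}"
        by (rule fundamental_theorem_of_calculus) (use that along[OF assms] in auto)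
      then show ?thesis by (simp add: integral_unique add_ac)
    qed
    ultimately have "((\<lambda>s. g (z + x *\<^sub>R v + s *\<^sub>R w) - g (z + s *\<^sub>R w)) has_vector_derivative integral {0..x} (k 0)) (at 0)"
      by simp
    moreover have "((\<lambda>s. g (z + x *\<^sub>R v + s *\<^sub>R w) - g (z + s *\<^sub>R w)) has_vector_derivative 
        dir_deriv w g (z + x *\<^sub>R v + 0 *\<^sub>R w) - dir_deriv w g (z + 0 *\<^sub>R w)) (at 0)"
      by (intro has_vector_derivative_diff along assms)
    ultimately show ?thesis using vector_derivative_unique_at by fastforce
  qed
  have c0: "continuous_on {0..1} (k 0)"
    unfolding k_def by (intro continuous_on_compose2[OF smooth_continuous[OF swv, of UNIV]] continuous_intros) auto
  \<comment> \<open>Facts \<open>1\<close> and \<open>2\<close> below compute the one-sided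
    derivative at 0 of the same function, once through the integral and once directly.\<close>
  have "((\<lambda>x. integral {0..x} (k 0)) has_vector_derivative k 0 0) (at 0 within {0..1})"
    by (rule integral_has_vector_derivative[OF c0]) auto
  then have 1: "((\<lambda>x. dir_deriv w g (z + x *\<^sub>R v) - dir_deriv w g z) has_vector_derivative k 0 0) (at 0 within {0..1})"
    by (rule has_vector_derivative_transform[rotated 2]) (auto simp: int_eq)
  have 2: "((\<lambda>x. dir_deriv w g (z + x *\<^sub>R v) - dir_deriv w g z) has_vector_derivative dir_deriv v (dir_deriv w g) (z + 0 *\<^sub>R v) - 0) (at 0 within {0..1})"
    by (intro has_vector_derivative_diff along sw has_vector_derivative_const)
  have "k 0 0 = dir_deriv v (dir_deriv w g) (z + 0 *\<^sub>R v) - 0"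
    by (rule vector_derivative_unique_within[OF _ 1 2]) (simp add: trivial_limit_within islimpt_Icc)
  then show ?thesis by (simp add: k_def)
qed

section \<open>Conformal metrics and their mean curvature\<close>

lemma coeff_matrix_conformal:
  assumes "\<And>v w. g z v w = \<rho> * (v \<bullet> w)"
  shows "coeff_matrix g z = mat \<rho>"
  by (auto simp: coeff_matrix_def coord_vec_def assms mat_def vec_eq_iff forall_2)

text \<open>\<open>matrix_inv\<close> is defined by choice, so an inverse is exhibited first and the
  chosen one is then solved for.\<close>

lemma matrix_inv_mat:
  fixes c :: real
  assumes "c \<noteq> 0" 
  shows "matrix_inv (mat c :: real^'n^'n) = mat (1 / c)"
proof -
  have eq: "mat c ** A = c *\<^sub>R A" for A :: "real^'n^'n"
    by (simp add: matrix_matrix_mult_def mat_def vec_eq_iff if_distrib[where f="\<lambda>x. x * _"] cong: if_cong)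
  have "mat c ** mat (1 / c) = (mat 1 :: real^'n^'n)" "mat (1 / c) ** mat c = (mat 1 :: real^'n^'n)"
    using assms by (auto simp: eq simp del: mat_0) (auto simp: matrix_matrix_mult_def mat_def vec_eq_iff if_distrib[where f="\<lambda>x. x * _"] cong: if_cong)
  then have "\<exists>A'. mat c ** A' = (mat 1 :: real^'n^'n) \<and> A' ** mat c = mat 1" by blast
  then have "mat c ** matrix_inv (mat c) = (mat 1 :: real^'n^'n)"
    unfolding matrix_inv_def by (rule someI2_ex) blast
  then have "c *\<^sub>R matrix_inv (mat c) = (mat 1 :: real^'n^'n)" by (simp add: eq)
  then have "matrix_inv (mat c) = (1 / c) *\<^sub>R (mat 1 :: real^'n^'n)"
    using assms by (metis scaleR_one scaleR_scaleR nonzero_divide_eq_eq)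
  then show ?thesis by (simp add: mat_def vec_eq_iff)
qed

definition laplace :: "(complex \<Rightarrow> 'a::real_normed_vector) \<Rightarrow> complex \<Rightarrow> 'a" where
  "laplace f z = dir_deriv 1 (dir_deriv 1 f) z + dir_deriv \<i> (dir_deriv \<i> f) z"

text \<open>The inverse of a conformal first fundamental form is a scalar, so the trace adds up the
  diagonal of the second one, which is the normal component of the Laplacian.\<close>

lemma mean_curvature_conformal:
  assumes "\<And>v w. first_ff f z v w = \<rho> * (v \<bullet> w)" "\<rho> > 0"
  shows "mean_curvature f z = (laplace f z \<bullet> unit_normal f z) / (2 * \<rho>)"
proof -
  have "matrix_inv (coeff_matrix (first_ff f) z) = mat (1 / \<rho>)"
    using coeff_matrix_conformal[of "first_ff f" z, OF assms(1)] assms(2) by (simp add: matrix_inv_mat)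
  then show ?thesis
    unfolding mean_curvature_def using assms(2)
    by (simp add: trace_def matrix_matrix_mult_def mat_def UNIV_2 coeff_matrix_def coord_vec_def
        second_ff_def laplace_def inner_add_left field_simps)
qed

lemma flat_metric_const:
  assumes "\<mu> > 0"
  shows "flat_metric (\<lambda>z v w. \<mu> * (v \<bullet> w))"
proof -
  let ?g = "\<lambda>(z::complex) v w. \<mu> * (v \<bullet> (w::complex))"
  have "bilinear (?g z)" for z
    unfolding bilinear_def by (auto intro!: linearI simp: inner_add algebra_simps)
  then have "riemannian_metric ?g"
    unfolding riemannian_metric_def using assms by (auto simp: inner_commute smooth_const)
  moreover have "christoffel ?g k i j = (\<lambda>z. 0)" for k i j
    by (rule ext) (simp add: christoffel_def coeff_matrix_def dir_deriv_const)
  then have "riemann_tensor ?g l k i j z = 0" for l k i j z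
    by (simp add: riemann_tensor_def dir_deriv_const)
  ultimately show ?thesis by (simp add: flat_metric_def)
qed

subsection \<open>The Weierstrass representation\<close>

text \<open>Space is split into a complex horizontal part and a real height, the form in which
  Weierstrass data are natural.\<close>

definition vec3 :: "complex \<Rightarrow> real \<Rightarrow> real^3" where
  "vec3 c t = vector [Re c, Im c, t]"

lemma vec3_nth [simp]: "vec3 c t $ 1 = Re c" "vec3 c t $ 2 = Im c" "vec3 c t $ 3 = t"
  by (simp_all add: vec3_def)

lemma vec3_inner: "vec3 c s \<bullet> vec3 d t = c \<bullet> d + s * t"
  by (simp add: inner_vec_def sum_3 inner_complex_def)

lemma vec3_add: "vec3 c s + vec3 d t = vec3 (c + d) (s + t)"
  by (simp add: vec_eq_iff forall_3)

lemma vec3_scaleR: "r *\<^sub>R vec3 c t = vec3 (r *\<^sub>R c) (r * t)"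
  by (simp add: vec_eq_iff forall_3)

lemma vec3_sum: "(\<Sum>i\<in>I. vec3 (c i) (t i)) = vec3 (\<Sum>i\<in>I. c i) (\<Sum>i\<in>I. t i)"
  by (simp add: vec_eq_iff forall_3 Re_sum Im_sum)

lemma has_derivative_vec3:
  assumes "(F has_derivative F') (at z)" "(g has_derivative g') (at z)"
  shows "((\<lambda>z. vec3 (F z) (g z)) has_derivative (\<lambda>v. vec3 (F' v) (g' v))) (at z)"
proof -
  have eq: "vec3 c t = Re c *\<^sub>R axis 1 1 + Im c *\<^sub>R axis 2 1 + t *\<^sub>R axis 3 1" for c t
    by (simp add: vec_eq_iff forall_3 axis_def)
  show ?thesis
    unfolding eq by (intro derivative_intros assms)
qed

text \<open>The Weierstrass representation: \<open>p\<close>, \<open>q\<close> are the components of the spinor, and \<open>X\<close>, \<open>Y\<close>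
  the coordinate tangent vectors.\<close>

lemma spinor_frame:
  fixes p q :: complex
  defines "X \<equiv> vec3 (p\<^sup>2 - q\<^sup>2) (2 * Re (p * cnj q))"
    and "Y \<equiv> vec3 (\<i> * (p\<^sup>2 + q\<^sup>2)) (- 2 * Im (p * cnj q))"
    and "n \<equiv> vec3 (- 2 * p * q) ((norm p)\<^sup>2 - (norm q)\<^sup>2)"
    and "m \<equiv> (norm p)\<^sup>2 + (norm q)\<^sup>2"
  shows "X \<bullet> X = m\<^sup>2" "Y \<bullet> Y = m\<^sup>2" "X \<bullet> Y = 0" "cross3 X Y = m *\<^sub>R n" "norm n = m"
proof -
  obtain a b c d where pq: "p = Complex a b" "q = Complex c d" by (metis complex.exhaust_sel)
  show "X \<bullet> X = m\<^sup>2" "Y \<bullet> Y = m\<^sup>2" "X \<bullet> Y = 0"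
    unfolding X_def Y_def m_def pq vec3_inner inner_complex_def cmod_power2
    by (simp_all add: power2_eq_square) (simp_all add: algebra_simps)
  show "cross3 X Y = m *\<^sub>R n"
    unfolding X_def Y_def m_def n_def pq cross3_def cmod_power2
    by (simp_all add: power2_eq_square vec_eq_iff forall_3) (simp_all add: algebra_simps)
  have "n \<bullet> n = m\<^sup>2"
    unfolding n_def m_def pq vec3_inner inner_complex_def cmod_power2
    by (simp_all add: power2_eq_square) (simp_all add: algebra_simps)
  moreover have "m \<ge> 0" by (simp add: m_def)
  ultimately show "norm n = m"
    by (metis norm_eq_square)
qed

text \<open>The conformal factor is \<open>m\<^sup>2\<close>, and the Dirac equation makes the
  Laplacian equal to \<open>2 * R\<close> times the normal \<open>n\<close> of length
  \<open>m\<close>. Hence \<open>H = R / m\<close>, and \<open>m\<close> cancels in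
  \<open>H\<^sup>2 * m\<^sup>2\<close>, leaving a constant metric.\<close>

lemma dirac_torus_of_spinor:
  fixes p q :: "complex \<Rightarrow> complex" and R :: real
  assumes smooth: "smooth f" and periodic: "\<And>z \<gamma>. \<gamma> \<in> \<Gamma> \<Longrightarrow> f (z + \<gamma>) = f z"
    and f': "\<And>z. (f has_derivative (\<lambda>v. vec3 ((p z)\<^sup>2 * v - (q z)\<^sup>2 * cnj v) (2 * Re (p z * cnj (q z) * v)))) (at z)"
    and p': "\<And>z. (p has_derivative p' z) (at z)"
    and q': "\<And>z. (q has_derivative q' z) (at z)"
    and dirac_p: "\<And>z. p' z 1 + \<i> * p' z \<i> = - R * q z"
    and dirac_q: "\<And>z. q' z 1 - \<i> * q' z \<i> = R * p z"
    and nz: "\<And>z. p z \<noteq> 0 \<or> q z \<noteq> 0" and R: "R \<noteq> 0"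
  shows "dirac_torus \<Gamma> f"
proof -
  define m where "m z = (norm (p z))\<^sup>2 + (norm (q z))\<^sup>2" for z
  define n where "n z = vec3 (- 2 * p z * q z) ((norm (p z))\<^sup>2 - (norm (q z))\<^sup>2)" for z
  have m_pos: "m z > 0" for z
    using nz[of z] by (auto simp: m_def add_pos_nonneg add_nonneg_pos)
  have df: "dir_deriv v f = (\<lambda>z. vec3 ((p z)\<^sup>2 * v - (q z)\<^sup>2 * cnj v) (2 * Re (p z * cnj (q z) * v)))" for v
    by (rule ext) (rule dir_deriv_eq[OF f'])
  have fx: "dir_deriv 1 f z = vec3 ((p z)\<^sup>2 - (q z)\<^sup>2) (2 * Re (p z * cnj (q z)))" for z
    by (simp add: df)
  have fy: "dir_deriv \<i> f z = vec3 (\<i> * ((p z)\<^sup>2 + (q z)\<^sup>2)) (- 2 * Im (p z * cnj (q z)))" for z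
    by (simp add: df vec3_def algebra_simps)
  note frame = spinor_frame[of "p z" "q z" for z, folded fx fy m_def n_def]
  have ff: "first_ff f z v w = (m z)\<^sup>2 * (v \<bullet> w)" for z v w
    unfolding first_ff_def dir_deriv_cartesian[OF f', of v] dir_deriv_cartesian[OF f', of w]
    by (simp add: inner_add inner_commute[of "dir_deriv \<i> f z" "dir_deriv 1 f z"] frame inner_complex_def algebra_simps)
  \<comment> \<open>In the sum of the two second derivatives, \<open>p'\<close> and
    \<open>q'\<close> occur only in the combinations that the Dirac equation prescribes.\<close>
  have lap: "laplace f z = (2 * R) *\<^sub>R n z" for z
  proof -
    have dfv: "dir_deriv v (dir_deriv v f) z = vec3 (2 * p z * p' z v * v - 2 * q z * q' z v * cnj v)
        (2 * Re ((p z * cnj (q' z v) + p' z v * cnj (q z)) * v))" for v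
      unfolding df[of v]
      by (rule dir_deriv_eq[where v=v], rule has_derivative_vec3)
         (auto intro!: derivative_eq_intros p' q' simp: algebra_simps)
    have 1: "2 * p z * p' z 1 * 1 - 2 * q z * q' z 1 * cnj 1 + (2 * p z * p' z \<i> * \<i> - 2 * q z * q' z \<i> * cnj \<i>)
       = 2 * p z * (p' z 1 + \<i> * p' z \<i>) - 2 * q z * (q' z 1 - \<i> * q' z \<i>)"
      by (simp add: algebra_simps)
    have "(p z * cnj (q' z 1) + p' z 1 * cnj (q z)) * 1 + (p z * cnj (q' z \<i>) + p' z \<i> * cnj (q z)) * \<i>
       = p z * cnj (q' z 1 - \<i> * q' z \<i>) + (p' z 1 + \<i> * p' z \<i>) * cnj (q z)"
      by (simp add: algebra_simps)
    also have "\<dots> = R * (p z * cnj (p z) - q z * cnj (q z))"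
      unfolding dirac_p dirac_q by (simp add: algebra_simps)
    also have "\<dots> = R * ((norm (p z))\<^sup>2 - (norm (q z))\<^sup>2)"
      by (simp add: complex_norm_square[symmetric])
    finally have 2: "2 * Re ((p z * cnj (q' z 1) + p' z 1 * cnj (q z)) * 1) + 2 * Re ((p z * cnj (q' z \<i>) + p' z \<i> * cnj (q z)) * \<i>)
       = 2 * Re (R * ((norm (p z))\<^sup>2 - (norm (q z))\<^sup>2))"
      by (metis distrib_left plus_complex.sel(1))
    show ?thesis
      unfolding laplace_def dfv vec3_add 1 2 dirac_p dirac_q n_def vec3_scaleR
      by (simp add: vec3_def scaleR_conv_of_real algebra_simps)
  qed
  have normal: "unit_normal f z = (1 / m z) *\<^sub>R n z" for z
    using m_pos[of z] by (simp add: unit_normal_def frame sgn_scaleR) (simp add: sgn_div_norm frame divide_inverse)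
  have "n z \<bullet> n z = (m z)\<^sup>2" for z
    by (metis frame(5) power2_norm_eq_inner)
  then have H: "mean_curvature f z = R / m z" for z
    using mean_curvature_conformal[of f z "(m z)\<^sup>2", OF ff] m_pos[of z]
    by (simp add: lap normal power2_eq_square field_simps)
  have "(\<lambda>z v w. (mean_curvature f z)\<^sup>2 * first_ff f z v w) = (\<lambda>z v w. R\<^sup>2 * (v \<bullet> w))"
    using m_pos by (intro ext) (simp add: H ff power_divide less_imp_neq[symmetric])
  then have "flat_metric (\<lambda>z v w. (mean_curvature f z)\<^sup>2 * first_ff f z v w)"
    using flat_metric_const[of "R\<^sup>2"] R by simp
  moreover have "conformal_immersion \<Gamma> f"
    unfolding conformal_immersion_def using smooth periodic ff m_pos
    by (metis zero_less_power)
  ultimately show ?thesis by (simp add: dirac_torus_def)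
qed

section \<open>Tori from finite trigonometric sums\<close>

lemma smooth_add:
  assumes "smooth f" "smooth g"
  shows "smooth (\<lambda>z. f z + g z)"
proof -
  have "Ck k f \<Longrightarrow> Ck k g \<Longrightarrow> Ck k (\<lambda>z. f z + g z)" for k and f g :: "complex \<Rightarrow> 'a"
  proof (induction k arbitrary: f g)
    case 0
    then show ?case by (auto intro: continuous_intros)
  next
    case (Suc k)
    have "dir_deriv v (\<lambda>z. f z + g z) = (\<lambda>z. dir_deriv v f z + dir_deriv v g z)" for v
      by (rule ext, rule dir_deriv_eq, unfold dir_deriv_def, rule has_derivative_add)
         (use Suc.prems in \<open>auto simp: frechet_derivative_works\<close>)
    then show ?case using Suc by (auto intro: differentiable_add)
  qed
  then show ?thesis using assms by (auto simp: smooth_def)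
qed

lemma smooth_sum: "(\<And>i. i \<in> I \<Longrightarrow> smooth (f i)) \<Longrightarrow> smooth (\<lambda>z. \<Sum>i\<in>I. f i z)"
  by (induction I rule: infinite_finite_induct) (auto intro: smooth_const smooth_add)

text \<open>Differentiation exchanges the two functions, hence the simultaneous induction; the
  arbitrary vector \<open>c\<close> absorbs the factor \<open>\<nu> \<bullet> v\<close>.\<close>

lemma smooth_trig:
  fixes c :: "'a::real_normed_vector"
  shows "smooth (\<lambda>z. cos (\<nu> \<bullet> z) *\<^sub>R c)" "smooth (\<lambda>z. sin (\<nu> \<bullet> z) *\<^sub>R c)"
proof -
  have dc: "((\<lambda>z. cos (\<nu> \<bullet> z) *\<^sub>R c) has_derivative (\<lambda>v. sin (\<nu> \<bullet> z) *\<^sub>R (- (\<nu> \<bullet> v)) *\<^sub>R c)) (at z)"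
   and ds: "((\<lambda>z. sin (\<nu> \<bullet> z) *\<^sub>R c) has_derivative (\<lambda>v. cos (\<nu> \<bullet> z) *\<^sub>R (\<nu> \<bullet> v) *\<^sub>R c)) (at z)"
    for c :: 'a and z
    by (auto intro!: derivative_eq_intros simp: algebra_simps)
  have "Ck k (\<lambda>z. cos (\<nu> \<bullet> z) *\<^sub>R c) \<and> Ck k (\<lambda>z. sin (\<nu> \<bullet> z) *\<^sub>R c)" for k and c :: 'a
  proof (induction k arbitrary: c)
    case 0
    then show ?case by (auto intro!: continuous_intros)
  next
    case (Suc k)
    have "dir_deriv v (\<lambda>z. cos (\<nu> \<bullet> z) *\<^sub>R c) = (\<lambda>z. sin (\<nu> \<bullet> z) *\<^sub>R (- (\<nu> \<bullet> v)) *\<^sub>R c)"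
      "dir_deriv v (\<lambda>z. sin (\<nu> \<bullet> z) *\<^sub>R c) = (\<lambda>z. cos (\<nu> \<bullet> z) *\<^sub>R (\<nu> \<bullet> v) *\<^sub>R c)" for v
      by (rule ext, rule dir_deriv_eq[OF dc], rule ext, rule dir_deriv_eq[OF ds])
    moreover have "(\<lambda>z. cos (\<nu> \<bullet> z) *\<^sub>R c) differentiable at z" "(\<lambda>z. sin (\<nu> \<bullet> z) *\<^sub>R c) differentiable at z" for z
      using dc ds unfolding differentiable_def by blast+
    ultimately show ?case using Suc by (simp only: Ck.simps) blast
  qed
  then show "smooth (\<lambda>z. cos (\<nu> \<bullet> z) *\<^sub>R c)" "smooth (\<lambda>z. sin (\<nu> \<bullet> z) *\<^sub>R c)"
    by (auto simp: smooth_def)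
qed

text \<open>The unitary character of the plane with frequency \<open>\<nu>\<close>.\<close>

definition wave :: "complex \<Rightarrow> complex \<Rightarrow> complex" where
  "wave \<nu> z = cis (\<nu> \<bullet> z)"

lemma wave_add_arg: "wave \<nu> (z + w) = wave \<nu> z * wave \<nu> w"
  by (simp add: wave_def inner_add_right cis_mult)

lemma wave_add_freq: "wave (\<nu> + \<mu>) z = wave \<nu> z * wave \<mu> z"
  by (simp add: wave_def inner_add_left cis_mult)

lemma wave_diff_freq: "wave (\<nu> - \<mu>) z = wave \<nu> z * cnj (wave \<mu> z)"
  by (simp add: wave_def inner_diff_left cis_cnj cis_mult)

lemma norm_wave [simp]: "norm (wave \<nu> z) = 1" by (simp add: wave_def)

lemma wave_dual: "\<nu> \<in> dual_lattice \<Gamma> \<Longrightarrow> \<gamma> \<in> \<Gamma> \<Longrightarrow> wave \<nu> \<gamma> = 1"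
  unfolding dual_lattice_def wave_def by (force intro: cis_multiple_2pi)

lemma has_derivative_wave:
  "(wave \<nu> has_derivative (\<lambda>v. \<i> * of_real (\<nu> \<bullet> v) * wave \<nu> z)) (at z)"
proof -
  have "((\<lambda>z. \<i> * complex_of_real (\<nu> \<bullet> z)) has_derivative (\<lambda>v. \<i> * of_real (\<nu> \<bullet> v))) (at z)"
    by (auto intro!: derivative_eq_intros)
  from has_derivative_compose[OF this DERIV_exp[unfolded has_field_derivative_def]] show ?thesis
    unfolding wave_def cis_conv_exp by (simp add: mult_ac)
qed

lemma of_real_inner_complex: "complex_of_real (\<nu> \<bullet> v) = (cnj \<nu> * v + \<nu> * cnj v) / 2"
  by (simp add: complex_eq_iff inner_complex_def)

lemma smooth_vec3_wave: "smooth (\<lambda>z. vec3 (c * wave \<nu> z) (Re (d * wave \<mu> z)))"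
proof -
  have "vec3 (c * wave \<nu> z) (Re (d * wave \<mu> z)) =
     (cos (\<nu> \<bullet> z) *\<^sub>R vec3 c 0 + sin (\<nu> \<bullet> z) *\<^sub>R vec3 (\<i> * c) 0) +
     (cos (\<mu> \<bullet> z) *\<^sub>R vec3 0 (Re d) + sin (\<mu> \<bullet> z) *\<^sub>R vec3 0 (- Im d))" for z
    by (simp add: vec_eq_iff forall_3 wave_def algebra_simps)
  then show ?thesis by (simp add: smooth_add smooth_trig)
qed

text \<open>An explicit primitive of the Weierstrass data. In the double sum for the third component the
  diagonal terms vanish because division by zero gives zero; the hypothesis \<open>balanced\<close> says
  that the corresponding constant terms of the derivative cancel.\<close>

lemma dirac_torus_of_frequencies:
  fixes \<Omega> :: "complex set" and a :: "complex \<Rightarrow> real"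
  assumes fin: "finite \<Omega>" and dual: "\<And>j k. j \<in> \<Omega> \<Longrightarrow> k \<in> \<Omega> \<Longrightarrow> j + k \<in> dual_lattice \<Gamma>"
     "\<And>j k. j \<in> \<Omega> \<Longrightarrow> k \<in> \<Omega> \<Longrightarrow> j - k \<in> dual_lattice \<Gamma>"
    and circle: "\<And>j. j \<in> \<Omega> \<Longrightarrow> norm j = R" and R: "R > 0"
    and not_antipodal: "\<And>j k. j \<in> \<Omega> \<Longrightarrow> k \<in> \<Omega> \<Longrightarrow> j + k \<noteq> 0"
    and balanced: "(\<Sum>j\<in>\<Omega>. cnj j * (a j)\<^sup>2) = 0"
    and nz: "\<And>z. (\<Sum>j\<in>\<Omega>. cnj j * a j * wave j z) \<noteq> 0 \<or> (\<Sum>j\<in>\<Omega>. a j * wave j z) \<noteq> 0"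
  shows "\<exists>f. dirac_torus \<Gamma> f"
proof -
  define q where "q z = (\<Sum>j\<in>\<Omega>. a j * wave j z)" for z
  \<comment> \<open>\<open>\<partial>\<^sub>x - \<i> \<partial>\<^sub>y\<close> multiplies the wave
    of frequency \<open>j\<close> by \<open>\<i> * cnj j\<close>, so one half of the Dirac equation
    dictates \<open>p\<close>. The other half then holds because
    \<open>j * cnj j = R\<^sup>2\<close>.\<close>
  define p where "p z = \<i> / R * (\<Sum>j\<in>\<Omega>. cnj j * a j * wave j z)" for z
  \<comment> \<open>The coefficients result from integrating the products of waves in
    \<open>p\<^sup>2 dz - q\<^sup>2 d(cnj z)\<close> and in \<open>2 * Re (p * cnj q dz)\<close>
    term by term.\<close>
  define c where "c j k = 2 * \<i> / (j + k) * a j * a k" for j k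
  define d where "d j k = 2 / R * cnj j / (cnj j - cnj k) * a j * a k" for j k
  define f where "f z = (\<Sum>j\<in>\<Omega>. \<Sum>k\<in>\<Omega>. vec3 (c j k * wave (j + k) z) (Re (d j k * wave (j - k) z)))" for z
  have f_eq: "f z = vec3 (\<Sum>j\<in>\<Omega>. \<Sum>k\<in>\<Omega>. c j k * wave (j + k) z) (Re (\<Sum>j\<in>\<Omega>. \<Sum>k\<in>\<Omega>. d j k * wave (j - k) z))" for z
    by (simp add: f_def vec3_sum Re_sum)
  have sq: "j * cnj j = R\<^sup>2" if "j \<in> \<Omega>" for j
    using circle[OF that] by (metis complex_norm_square of_real_power)
  have "dirac_torus \<Gamma> f"
  proof (rule dirac_torus_of_spinor)
    show "smooth f" unfolding f_def by (intro smooth_sum smooth_vec3_wave)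
    \<comment> \<open>The surface is quadratic in the spinor, so its frequencies are sums and
      differences of elements of \<open>\<Omega>\<close>.\<close>
    show "f (z + \<gamma>) = f z" if "\<gamma> \<in> \<Gamma>" for z \<gamma>
      unfolding f_def by (intro sum.cong refl) (simp add: wave_add_arg wave_dual[OF dual(1) that] wave_dual[OF dual(2) that])
    define q' where "q' z v = (\<Sum>j\<in>\<Omega>. a j * (\<i> * of_real (j \<bullet> v) * wave j z))" for z v
    define p' where "p' z v = \<i> / R * (\<Sum>j\<in>\<Omega>. cnj j * a j * (\<i> * of_real (j \<bullet> v) * wave j z))" for z v
    show "(p has_derivative p' z) (at z)" for z unfolding p_def p'_def
      by (intro has_derivative_mult_right has_derivative_sum has_derivative_wave)
    show "(q has_derivative q' z) (at z)" for z unfolding q_def q'_def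
      by (intro has_derivative_mult_right has_derivative_sum has_derivative_wave)
    show "p' z 1 + \<i> * p' z \<i> = - R * q z" for z
    proof -
      have "p' z 1 + \<i> * p' z \<i> = (\<Sum>j\<in>\<Omega>. - (j * cnj j / R * (a j * wave j z)))"
        unfolding p'_def sum_distrib_left sum.distrib[symmetric]
      proof (intro sum.cong refl)
        fix j
        have j: "j = complex_of_real (j \<bullet> 1) + \<i> * complex_of_real (j \<bullet> \<i>)"
          by (simp add: complex_eq_iff)
        show "\<i> / R * (cnj j * a j * (\<i> * complex_of_real (j \<bullet> 1) * wave j z)) + \<i> * (\<i> / R * (cnj j * a j * (\<i> * complex_of_real (j \<bullet> \<i>) * wave j z)))
            = - (j * cnj j / R * (a j * wave j z))"
          by (subst (6) j) (simp add: algebra_simps add_divide_distrib)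
      qed
      also have "\<dots> = - R * q z"
        unfolding q_def sum_distrib_left using R
        by (intro sum.cong refl) (simp add: sq power2_eq_square)
      finally show ?thesis .
    qed
    show "q' z 1 - \<i> * q' z \<i> = R * p z" for z
      unfolding q'_def p_def sum_distrib_left sum_subtractf[symmetric]
    proof (intro sum.cong refl)
      fix j
      have j: "cnj j = complex_of_real (j \<bullet> 1) - \<i> * complex_of_real (j \<bullet> \<i>)"
        by (simp add: complex_eq_iff)
      show "a j * (\<i> * complex_of_real (j \<bullet> 1) * wave j z) - \<i> * (a j * (\<i> * complex_of_real (j \<bullet> \<i>) * wave j z))
          = R * (\<i> / R * (cnj j * a j * wave j z))"
        unfolding j using R by (simp add: algebra_simps)
    qed
    show "p z \<noteq> 0 \<or> q z \<noteq> 0" for z using nz[of z] R by (simp add: p_def q_def)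
    show "R \<noteq> 0" using R by simp
    show "(f has_derivative (\<lambda>v. vec3 ((p z)\<^sup>2 * v - (q z)\<^sup>2 * cnj v) (2 * Re (p z * cnj (q z) * v)))) (at z)" for z
    proof -
      have F': "(\<Sum>j\<in>\<Omega>. \<Sum>k\<in>\<Omega>. c j k * (\<i> * of_real ((j + k) \<bullet> v) * wave (j + k) z))
          = (p z)\<^sup>2 * v - (q z)\<^sup>2 * cnj v" for v
      proof -
        have "c j k * (\<i> * of_real ((j + k) \<bullet> v) * wave (j + k) z) =
            (\<i> / R * (cnj j * a j * wave j z)) * (\<i> / R * (cnj k * a k * wave k z)) * v - (a j * wave j z) * (a k * wave k z) * cnj v"
          if jk: "j \<in> \<Omega>" "k \<in> \<Omega>" for j k :: complex
        proof -
          have nz: "j + k \<noteq> 0" using not_antipodal jk by blast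
          \<comment> \<open>The ratio of the two partial derivatives of a wave with frequency
            \<open>j + k\<close> must match the ratio of the terms from \<open>p\<^sup>2\<close> and
            \<open>q\<^sup>2\<close>. It does because both frequencies lie on the circle of radius
            \<open>R\<close>.\<close>
          have "R\<^sup>2 * (cnj j + cnj k) = (j + k) * (cnj j * cnj k)"
            using sq[OF jk(1)] sq[OF jk(2)] by (simp add: algebra_simps)
          then have quot: "cnj (j + k) / (j + k) = cnj j * cnj k / R\<^sup>2"
            using nz R by (simp add: field_simps)
          have "2 * \<i> / s * x * y * (\<i> * ((s' * v + s * v') / 2) * w) = - (s' / s * v + v') * (x * y * w)"
            if "s \<noteq> 0" for s s' v' x y w :: complex
            using that by (simp add: field_simps)
          from this[where s' = "cnj (j + k)" and v' = "cnj v", OF nz] have eq: "c j k * (\<i> * of_real ((j + k) \<bullet> v) * wave (j + k) z) = - (cnj j * cnj k / R\<^sup>2 * v + cnj v) * (a j * a k * wave (j + k) z)"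
            unfolding c_def of_real_inner_complex quot of_real_mult .
          show ?thesis
            unfolding eq by (simp add: wave_add_freq power2_eq_square algebra_simps)
        qed
        then show ?thesis
          unfolding p_def q_def power2_eq_square sum_product sum_distrib_left sum_distrib_right sum_subtractf[symmetric]
          by (intro sum.cong refl) (simp add: mult_ac)
      qed
      have G': "(\<Sum>j\<in>\<Omega>. \<Sum>k\<in>\<Omega>. d j k * (\<i> * of_real ((j - k) \<bullet> v) * wave (j - k) z))
          = p z * cnj (q z) * v + cnj (p z * cnj (q z) * v)" for v
      proof -
        \<comment> \<open>For \<open>j = k\<close> the unimodular waves cancel and leave a constant,
          which has no periodic primitive. It is subtracted here and sums to zero in
          \<open>diag\<close>.\<close>
        have *: "d j k * (\<i> * of_real ((j - k) \<bullet> v) * wave (j - k) z) =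
            (\<i> / R * (cnj j * a j * wave j z)) * cnj (a k * wave k z) * v
             + cnj (\<i> / R * (cnj k * a k * wave k z)) * (a j * wave j z) * cnj v
             - (if j = k then \<i> / R * (cnj j * (a j)\<^sup>2 * v - j * (a j)\<^sup>2 * cnj v) else 0)"
          if jk: "j \<in> \<Omega>" "k \<in> \<Omega>" for j k :: complex
        proof (cases "j = k")
          case True
          have 1: "wave k z * cnj (wave k z) = 1" 
            using complex_norm_square[of "wave k z"] by simp
          have "\<i> / R * (cnj k * a k * wave k z) * cnj (a k * wave k z) * v
             + cnj (\<i> / R * (cnj k * a k * wave k z)) * (a k * wave k z) * cnj v
             = \<i> / R * (cnj k * (a k)\<^sup>2 * v - k * (a k)\<^sup>2 * cnj v) * (wave k z * cnj (wave k z))"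
            by (simp add: power2_eq_square algebra_simps diff_divide_distrib)
          then show ?thesis using True by (simp add: 1 d_def)
        next
          case False
          then have nz: "cnj j - cnj k \<noteq> 0" by simp
          have "(j - k) * cnj j = - k * (cnj j - cnj k)"
            using sq[OF jk(1)] sq[OF jk(2)] by (simp add: algebra_simps)
          then have "(j - k) * cnj j / (cnj j - cnj k) = - k"
            using nz by (simp add: field_simps)
          then have "d j k * (\<i> * of_real ((j - k) \<bullet> v) * wave (j - k) z) =
            \<i> / R * (cnj j * v - k * cnj v) * (a j * a k * wave (j - k) z)"
            using nz R by (simp add: d_def of_real_inner_complex field_simps)
          then show ?thesis using False
            by (simp add: wave_diff_freq algebra_simps)
        qed
        have "(\<Sum>j\<in>\<Omega>. \<Sum>k\<in>\<Omega>. (if j = k then \<i> / R * (cnj j * (a j)\<^sup>2 * v - j * (a j)\<^sup>2 * cnj v) else 0))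
            = (\<Sum>j\<in>\<Omega>. \<i> / R * (cnj j * (a j)\<^sup>2 * v - j * (a j)\<^sup>2 * cnj v))"
          using fin by simp
        also have "\<dots> = \<i> / R * ((\<Sum>j\<in>\<Omega>. cnj j * (a j)\<^sup>2) * v - cnj (\<Sum>j\<in>\<Omega>. cnj j * (a j)\<^sup>2) * cnj v)"
          by (simp add: sum_distrib_left sum_distrib_right sum_subtractf right_diff_distrib)
        also have "\<dots> = 0" unfolding balanced by simp
        finally have diag: "(\<Sum>j\<in>\<Omega>. \<Sum>k\<in>\<Omega>. (if j = k then \<i> / R * (cnj j * (a j)\<^sup>2 * v - j * (a j)\<^sup>2 * cnj v) else 0)) = 0" .
        have "(\<Sum>j\<in>\<Omega>. \<Sum>k\<in>\<Omega>. d j k * (\<i> * of_real ((j - k) \<bullet> v) * wave (j - k) z)) =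
          (\<Sum>j\<in>\<Omega>. \<Sum>k\<in>\<Omega>. (\<i> / R * (cnj j * a j * wave j z)) * cnj (a k * wave k z) * v)
             + (\<Sum>j\<in>\<Omega>. \<Sum>k\<in>\<Omega>. cnj (\<i> / R * (cnj k * a k * wave k z)) * (a j * wave j z) * cnj v)"
          using diag by (simp only: * sum.distrib sum_subtractf cong: sum.cong) simp
        also have "(\<Sum>j\<in>\<Omega>. \<Sum>k\<in>\<Omega>. (\<i> / R * (cnj j * a j * wave j z)) * cnj (a k * wave k z) * v) = p z * cnj (q z) * v"
          unfolding p_def q_def cnj_sum sum_distrib_left sum_product sum_distrib_right by (subst sum.swap) (simp add: mult_ac)
        also have "(\<Sum>j\<in>\<Omega>. \<Sum>k\<in>\<Omega>. cnj (\<i> / R * (cnj k * a k * wave k z)) * (a j * wave j z) * cnj v) = cnj (p z * cnj (q z) * v)"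
          unfolding p_def q_def cnj_sum complex_cnj_mult complex_cnj_cnj sum_distrib_left sum_product sum_distrib_right
          by (simp add: mult_ac)
        finally show ?thesis .
      qed
      have "((\<lambda>z. \<Sum>j\<in>\<Omega>. \<Sum>k\<in>\<Omega>. c j k * wave (j + k) z) has_derivative (\<lambda>v. (p z)\<^sup>2 * v - (q z)\<^sup>2 * cnj v)) (at z)"
        unfolding F'[symmetric] by (intro has_derivative_mult_right has_derivative_sum has_derivative_wave)
      moreover have "((\<lambda>z. Re (\<Sum>j\<in>\<Omega>. \<Sum>k\<in>\<Omega>. d j k * wave (j - k) z)) has_derivative 
            (\<lambda>v. Re (p z * cnj (q z) * v + cnj (p z * cnj (q z) * v)))) (at z)"
        unfolding G'[symmetric] by (intro has_derivative_Re has_derivative_mult_right has_derivative_sum has_derivative_wave)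
      ultimately show ?thesis
        unfolding f_eq complex_add_cnj Re_complex_of_real by (rule has_derivative_vec3)
    qed
  qed
  then show ?thesis by blast
qed

subsection \<open>Construction from a rational rectangle\<close>

lemma int_span_memI: "of_int m * a + of_int n * b \<in> int_span a b"
  unfolding int_span_def by blast

lemma int_span_closed:
  assumes "x \<in> int_span a b" "y \<in> int_span a b"
  shows "x + y \<in> int_span a b" "x - y \<in> int_span a b"
proof -
  obtain m n m' n' :: int where "x = of_int m * a + of_int n * b" "y = of_int m' * a + of_int n' * b"
    using assms unfolding int_span_def by blast
  then have "x + y = of_int (m + m') * a + of_int (n + n') * b" "x - y = of_int (m - m') * a + of_int (n - n') * b"
    by (simp_all add: algebra_simps)
  then show "x + y \<in> int_span a b" "x - y \<in> int_span a b"
    by (metis int_span_memI)+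
qed

text \<open>The points \<open>k * \<omega>2\<close> and
  \<open>- l * \<omega>2 \<plusminus> m * \<omega>1\<close> lie on a circle about the origin as soon
  as \<open>k\<^sup>2 = l\<^sup>2 + b * m\<^sup>2\<close>, an equation with integer solutions
  because \<open>b\<close> is rational. For \<open>l > 0\<close> the origin is interior to their
  triangle, which allows positive weights; \<open>2 * l = k\<close> would be the equilateral
  case.\<close>

lemma dirac_torus_if_rational_rectangle:
  assumes span: "spans_rectangular_sublattice (dual_lattice \<Gamma>) \<omega>1 \<omega>2"
    and b: "b \<in> \<rat>" "(norm \<omega>1)\<^sup>2 = b * (norm \<omega>2)\<^sup>2"
  shows "\<exists>f. dirac_torus \<Gamma> f"
proof -
  have nz: "\<omega>1 \<noteq> 0" "\<omega>2 \<noteq> 0" and orth: "\<omega>1 \<bullet> \<omega>2 = 0" and sub: "int_span \<omega>1 \<omega>2 \<subseteq> dual_lattice \<Gamma>"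
    using span by (auto simp: spans_rectangular_sublattice_def)
  have "b > 0" using b(2) nz by (metis zero_less_mult_pos2 zero_less_norm_iff zero_less_power)
  then obtain p q :: int where pq: "b = of_int p / of_int q" "p > 0" "q > 0"
  proof -
    obtain p q :: int where "q > 0" "b = of_int p / of_int q"
      using b(1) by (rule Rats_cases')
    then show thesis using that[of p q] \<open>b > 0\<close> by (simp add: zero_less_divide_iff)
  qed
  \<comment> \<open>The summand 1 gives \<open>t0 > 1\<close>, hence
    \<open>t0\<^sup>2 > 3 * b\<close>. The factor 3 is what turns into \<open>2 * l > k\<close>, the
    exclusion of the equilateral triangle.\<close>
  obtain t0 :: nat where t0: "real t0 > 3 * b + 1" using reals_Archimedean2 by blast
  define t where "t = int t0"
  have t: "t > 0" and t2: "q * t\<^sup>2 > 3 * p"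
  proof -
    have "real t0 > 1" using t0 \<open>b > 0\<close> by linarith
    then show "t > 0" by (simp add: t_def)
    have "real t0 * 1 \<le> real t0 * real t0" using \<open>real t0 > 1\<close> by (intro mult_left_mono) auto
    then have "(real t0)\<^sup>2 > 3 * b" using t0 by (simp add: power2_eq_square)
    then have "of_int q * (real t0)\<^sup>2 > 3 * of_int p"
      using pq by (simp add: field_simps)
    then have "real_of_int (q * t\<^sup>2) > real_of_int (3 * p)" by (simp add: t_def)
    then show "q * t\<^sup>2 > 3 * p" by linarith
  qed
  \<comment> \<open>The classical parametrization: the difference
    \<open>k\<^sup>2 - l\<^sup>2\<close> is \<open>4 * p * q * t\<^sup>2\<close>, which is
    \<open>p / q\<close> times the square of \<open>2 * q * t\<close>.\<close>
  define k l m where "k = q * t\<^sup>2 + p" and "l = q * t\<^sup>2 - p" and "m = 2 * q * t"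
  have klm: "real_of_int (k\<^sup>2) = real_of_int (l\<^sup>2) + b * real_of_int (m\<^sup>2)"
    unfolding k_def l_def m_def pq(1) using pq(3) by (simp add: field_simps power2_eq_square)
  have pos: "k > 0" "l > 0" "m > 0" and kl: "2 * l > k"
    using pq t t2 by (auto simp: k_def l_def m_def) 
  \<comment> \<open>Orthogonality makes \<open>\<omega>1\<close> a real multiple of
    \<open>\<i> * \<omega>2\<close>. Dividing by \<open>\<omega>2\<close> leaves a rectangle with
    sides 1 and \<open>\<bar>s\<bar>\<close>, where \<open>s\<^sup>2 = b\<close>.\<close>
  define s where "s = Im (\<omega>1 / \<omega>2)"
  have s1: "\<omega>1 = \<i> * s * \<omega>2"
  proof -
    have "Re (\<omega>1 / \<omega>2) = 0"
      using orth nz by (simp add: Re_divide inner_complex_def)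
    then have "\<omega>1 / \<omega>2 = \<i> * s" by (simp add: s_def complex_eq_iff)
    then show ?thesis using nz by (simp add: field_simps)
  qed
  have s2: "s\<^sup>2 = b"
    using b(2) nz unfolding s1 by (simp add: norm_mult power_mult_distrib)
  define n where "n = m * s"
  have n2: "n\<^sup>2 = (real_of_int k)\<^sup>2 - (real_of_int l)\<^sup>2"
    using klm by (simp add: n_def power_mult_distrib s2)
  have "s \<noteq> 0" using s2 \<open>b > 0\<close> by auto
  then have "n \<noteq> 0" using pos by (simp add: n_def)
  define w0 w1 w2 where "w0 = complex_of_real k" and "w1 = Complex (- l) n" and "w2 = Complex (- l) (- n)"
  define \<Omega> where "\<Omega> = {w0 * \<omega>2, w1 * \<omega>2, w2 * \<omega>2}"
  have distinct: "w0 * \<omega>2 \<noteq> w1 * \<omega>2" "w0 * \<omega>2 \<noteq> w2 * \<omega>2" "w1 * \<omega>2 \<noteq> w2 * \<omega>2"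
  proof -
    have "w0 \<noteq> w1" "w0 \<noteq> w2" "w1 \<noteq> w2"
      using pos \<open>n \<noteq> 0\<close> by (auto simp: w0_def w1_def w2_def complex_eq_iff)
    then show "w0 * \<omega>2 \<noteq> w1 * \<omega>2" "w0 * \<omega>2 \<noteq> w2 * \<omega>2" "w1 * \<omega>2 \<noteq> w2 * \<omega>2"
      using nz by simp_all
  qed
  have mem: "\<Omega> \<subseteq> int_span \<omega>1 \<omega>2"
  proof -
    have "w0 * \<omega>2 = of_int 0 * \<omega>1 + of_int k * \<omega>2" "w1 * \<omega>2 = of_int m * \<omega>1 + of_int (- l) * \<omega>2"
      "w2 * \<omega>2 = of_int (- m) * \<omega>1 + of_int (- l) * \<omega>2"
      unfolding s1 by (simp_all add: w0_def w1_def w2_def n_def complex_eq_iff algebra_simps)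
    then show ?thesis unfolding \<Omega>_def by (metis empty_subsetI insert_subset int_span_memI)
  qed
  have \<Omega>_image: "\<Omega> = (\<lambda>w. w * \<omega>2) ` {w0, w1, w2}" by (simp add: \<Omega>_def)
  \<comment> \<open>The weights in \<open>balanced\<close> are the squares of \<open>a\<close>; the
    values \<open>2 * l / k\<close>, 1, 1 put the barycentre at the origin.\<close>
  define a where "a j = (if j = w0 * \<omega>2 then sqrt (2 * l / k) else 1)" for j
  have a0: "(sqrt (2 * l / k))\<^sup>2 = 2 * l / k"
    using pos by simp
  show ?thesis
  proof (rule dirac_torus_of_frequencies)
    show "finite \<Omega>" by (simp add: \<Omega>_def)
    show "j + k \<in> dual_lattice \<Gamma>" "j - k \<in> dual_lattice \<Gamma>" if "j \<in> \<Omega>" "k \<in> \<Omega>" for j k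
      using that mem sub int_span_closed[of j \<omega>1 \<omega>2 k] by auto
    have "norm w1 = k" "norm w2 = k" 
      using n2 pos by (simp_all add: w1_def w2_def cmod_def)
    then show "norm j = k * norm \<omega>2" if "j \<in> \<Omega>" for j
      using that pos by (auto simp: \<Omega>_def w0_def norm_mult)
    show "k * norm \<omega>2 > 0" using nz pos by simp
    show "i + j \<noteq> 0" if "i \<in> \<Omega>" "j \<in> \<Omega>" for i j
    proof -
      obtain u where u: "u \<in> {w0, w1, w2}" "i = u * \<omega>2"
        using \<open>i \<in> \<Omega>\<close> unfolding \<Omega>_image by (rule imageE)
      obtain v where v: "v \<in> {w0, w1, w2}" "j = v * \<omega>2"
        using \<open>j \<in> \<Omega>\<close> unfolding \<Omega>_image by (rule imageE)
      have "k > l" using pq(2) by (simp add: k_def l_def)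
      then have "Re u + Re v \<noteq> 0"
        using u(1) v(1) pos by (auto simp: w0_def w1_def w2_def)
      then have "u + v \<noteq> 0" by (metis plus_complex.sel(1) zero_complex.sel(1))
      then show ?thesis using nz u v by (simp add: distrib_right[symmetric])
    qed
    have sum3: "(\<Sum>j\<in>\<Omega>. h j) = h (w0 * \<omega>2) + h (w1 * \<omega>2) + h (w2 * \<omega>2)" for h :: "complex \<Rightarrow> complex"
      unfolding \<Omega>_def using distinct by (simp add: add_ac)
    have a: "a (w0 * \<omega>2) = sqrt (2 * l / k)" "a (w1 * \<omega>2) = 1" "a (w2 * \<omega>2) = 1"
      using distinct by (auto simp: a_def)
    have "cnj w0 * complex_of_real (2 * l / k) + cnj w1 + cnj w2 = 0"
      using pos by (simp add: w0_def w1_def w2_def complex_eq_iff)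
    then have "cnj \<omega>2 * (cnj w0 * complex_of_real (2 * l / k) + cnj w1 + cnj w2) = 0" by simp
    then show "(\<Sum>j\<in>\<Omega>. cnj j * (a j)\<^sup>2) = 0"
      unfolding sum3 a of_real_power[symmetric] a0 by (simp add: algebra_simps)
    show "(\<Sum>j\<in>\<Omega>. cnj j * a j * wave j z) \<noteq> 0 \<or> (\<Sum>j\<in>\<Omega>. a j * wave j z) \<noteq> 0" for z
    proof (rule ccontr)
      define E0 E1 E2 where "E0 = wave (w0 * \<omega>2) z" and "E1 = wave (w1 * \<omega>2) z" and "E2 = wave (w2 * \<omega>2) z"
      define r where "r = sqrt (2 * l / k)"
      assume "\<not> ?thesis"
      then have e1: "cnj \<omega>2 * (cnj w0 * (r * E0) + cnj w1 * E1 + cnj w2 * E2) = 0" and e2: "r * E0 + E1 + E2 = 0"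
        unfolding sum3 a E0_def[symmetric] E1_def[symmetric] E2_def[symmetric] r_def[symmetric] by (simp_all add: algebra_simps)
      from e1 nz have e1': "cnj w0 * (r * E0) + cnj w1 * E1 + cnj w2 * E2 = 0" by simp
      \<comment> \<open>Eliminating \<open>E2\<close> leaves two unimodular unknowns. Comparing
        absolute values removes them, and the remaining equation factors with
        \<open>2 * l - k\<close>, the equilateral case.\<close>
      have "Complex (k + l) (- n) * (r * E0) = 2 * \<i> * n * E1"
      proof -
        have rE0: "r * E0 = - E1 - E2" using e2 by (simp add: algebra_simps eq_neg_iff_add_eq_0)
        have "k * (- E1 - E2) + Complex (- l) (- n) * E1 + Complex (- l) n * E2 = 0"
          using e1' unfolding \<open>r * E0 = - E1 - E2\<close> by (simp add: w0_def w1_def w2_def complex_cnj)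
        then show ?thesis
          unfolding rE0 by (simp add: complex_eq_iff algebra_simps)
      qed
      then have "(norm (Complex (k + l) (- n)) * (\<bar>r\<bar> * norm E0))\<^sup>2 = (norm (2 * \<i> * n * E1))\<^sup>2"
        by (metis norm_mult norm_of_real)
      then have "((k + l)\<^sup>2 + n\<^sup>2) * (2 * l / k) = 4 * n\<^sup>2"
        unfolding a0[folded r_def, symmetric]
        by (simp add: power_mult_distrib norm_mult E0_def E1_def cmod_power2)
      then have "((real_of_int k + l)\<^sup>2 + n\<^sup>2) * (2 * l) = 4 * n\<^sup>2 * k"
        using pos by (simp add: field_simps)
      then have "4 * (real_of_int k + l) * k * (2 * l - k) = 0"
        unfolding n2 by (simp add: power2_eq_square algebra_simps)
      then have "k + l = 0 \<or> k = 0 \<or> 2 * l - k = 0"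
        by (simp flip: of_int_add of_int_mult of_int_diff)
      then show False using pos kl by auto
    qed
  qed
qed

subsection \<open>Flat periodic conformal metrics\<close>

lemma independent_pair_coords:
  fixes a b z :: complex
  assumes "independent {a, b}" "a \<noteq> b"
  obtains s t :: real where "z = s *\<^sub>R a + t *\<^sub>R b"
proof -
  have "UNIV \<subseteq> span {a, b}"
    by (rule card_ge_dim_independent) (use assms in auto)
  then have "z \<in> span {a, b}" by blast
  then obtain s t where "z - s *\<^sub>R a = t *\<^sub>R b"
    by (auto simp: span_breakdown_eq span_singleton)
  then show thesis using that[of s t] by (simp add: algebra_simps)
qed

lemma generator_in_int_span: "a \<in> int_span a b" "b \<in> int_span a b"
  unfolding int_span_def by (force intro: exI[of _ 1] exI[of _ 0])+

text \<open>All values are taken on a closed fundamental parallelogram, which is compact.\<close>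

lemma bounded_range_periodic:
  fixes h :: "complex \<Rightarrow> 'a::metric_space"
  assumes ind: "independent {a, b}" "a \<noteq> b" and cont: "continuous_on UNIV h"
    and per: "\<And>z \<gamma>. \<gamma> \<in> int_span a b \<Longrightarrow> h (z + \<gamma>) = h z"
  shows "bounded (range h)"
proof -
  define K where "K = (\<lambda>(s, t). s *\<^sub>R a + t *\<^sub>R b) ` ({0..1} \<times> {0..1::real})"
  have "compact K"
    unfolding K_def case_prod_beta
    by (intro compact_continuous_image continuous_intros compact_Times compact_Icc)
  then have "compact (h ` K)"
    using cont by (intro compact_continuous_image) (auto intro: continuous_on_subset)
  moreover have "range h \<subseteq> h ` K"
  proof clarify
    fix z
    obtain s t where z: "z = s *\<^sub>R a + t *\<^sub>R b" using independent_pair_coords[OF ind] .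
    have "z = (frac s *\<^sub>R a + frac t *\<^sub>R b) + (of_int \<lfloor>s\<rfloor> * a + of_int \<lfloor>t\<rfloor> * b)"
      unfolding z frac_def by (simp add: scaleR_conv_of_real algebra_simps)
    moreover have "of_int \<lfloor>s\<rfloor> * a + of_int \<lfloor>t\<rfloor> * b \<in> int_span a b"
      unfolding int_span_def by blast
    ultimately have "h z = h (frac s *\<^sub>R a + frac t *\<^sub>R b)"
      using per by metis
    moreover have "frac s *\<^sub>R a + frac t *\<^sub>R b \<in> K"
      unfolding K_def using frac_lt_1[of s] frac_lt_1[of t] by (force intro!: image_eqI[where x="(frac s, frac t)"])
    ultimately show "h z \<in> h ` K" by blast
  qed
  ultimately show ?thesis using bounded_subset compact_imp_bounded by blast
qed

text \<open>Flatness says that the logarithm of the conformal factor is harmonic: its complex gradient is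
  an entire function, bounded by periodicity.\<close>

lemma flat_conformal_metric_const:
  assumes ind: "independent {a, b}" "a \<noteq> b"
    and flat: "flat_metric (\<lambda>z v w. \<mu> z * (v \<bullet> w))"
    and per: "\<And>z \<gamma>. \<gamma> \<in> int_span a b \<Longrightarrow> \<mu> (z + \<gamma>) = \<mu> z"
  obtains c where "c > 0" "\<And>z. \<mu> z = c"
proof -
  let ?g = "\<lambda>z v w. \<mu> z * (v \<bullet> (w::complex))"
  have riem: "riemannian_metric ?g" and curv: "\<And>l k i j z. riemann_tensor ?g l k i j z = 0"
    using flat by (auto simp: flat_metric_def)
  have pos: "\<mu> z > 0" for z
  proof -
    have "0 < ?g z 1 1" using riem unfolding riemannian_metric_def by (metis zero_neq_one)
    then show ?thesis by simp
  qed
  have smooth: "smooth \<mu>"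
  proof -
    have "smooth (\<lambda>z. ?g z 1 1)" using riem unfolding riemannian_metric_def by blast
    then show ?thesis by simp
  qed
  \<comment> \<open>\<open>(p, q)\<close> is half the gradient of \<open>ln \<mu>\<close>; up to
    sign these two functions are all the Christoffel symbols.\<close>
  define p where "p z = dir_deriv 1 \<mu> z / (2 * \<mu> z)" for z
  define q where "q z = dir_deriv \<i> \<mu> z / (2 * \<mu> z)" for z
  have coeff: "coeff_matrix ?g z = mat (\<mu> z)" for z by (rule coeff_matrix_conformal) simp
  have dcoeff: "dir_deriv v (\<lambda>w. mat (\<mu> w) $ j $ l) z = (if j = l then dir_deriv v \<mu> z else 0)" for v z and j l :: 2
    by (simp add: mat_def dir_deriv_const)
  have chr: "christoffel ?g k i j z =
      ((if j = k then dir_deriv (coord_vec i) \<mu> z else 0) + (if i = k then dir_deriv (coord_vec j) \<mu> z else 0)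
       - (if i = j then dir_deriv (coord_vec k) \<mu> z else 0)) / (2 * \<mu> z)" for k i j z
  proof -
    have "matrix_inv (mat (\<mu> z) :: real^2^2) = mat (1 / \<mu> z)"
      using pos[of z] by (simp add: matrix_inv_mat)
    then show ?thesis
      unfolding christoffel_def coeff dcoeff using pos[of z] exhaust_2[of i] exhaust_2[of j] exhaust_2[of k]
      by (elim disjE) (simp_all add: sum_2 mat_def field_simps)
  qed
  have chr':
    "christoffel ?g 1 1 1 = p" "christoffel ?g 1 1 2 = q" "christoffel ?g 1 2 1 = q" "christoffel ?g 1 2 2 = (\<lambda>z. - p z)"
    "christoffel ?g 2 1 1 = (\<lambda>z. - q z)" "christoffel ?g 2 1 2 = p" "christoffel ?g 2 2 1 = p" "christoffel ?g 2 2 2 = q"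
    by (auto simp: fun_eq_iff chr p_def q_def coord_vec_def)
  have d\<mu>: "(\<mu> has_derivative (\<lambda>v. dir_deriv v \<mu> z)) (at z)"
    and d\<mu>v: "(dir_deriv w \<mu> has_derivative (\<lambda>v. dir_deriv v (dir_deriv w \<mu>) z)) (at z)" for w z
    using smooth by (auto intro: smooth_has_derivative smooth_dir_deriv)
  have "p differentiable (at z)" "q differentiable (at z)" for z
    unfolding p_def q_def using pos[of z]
    by (auto intro!: differentiable_divide differentiable_mult differentiable_const differentiableI[OF d\<mu>] differentiableI[OF d\<mu>v])
  then have dp: "(p has_derivative (\<lambda>v. dir_deriv v p z)) (at z)" and dq: "(q has_derivative (\<lambda>v. dir_deriv v q z)) (at z)" for z
    unfolding dir_deriv_def by (simp_all add: frechet_derivative_works)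
  have neg: "dir_deriv v (\<lambda>z. - p z) z = - dir_deriv v p z" "dir_deriv v (\<lambda>z. - q z) z = - dir_deriv v q z" for v z
    by (rule dir_deriv_eq, intro derivative_intros dp dq)+
  \<comment> \<open>The products of Christoffel symbols cancel in dimension two, so this curvature
    component is just the Laplacian of \<open>ln \<mu>\<close> up to a factor.\<close>
  have div: "dir_deriv 1 p z = - dir_deriv \<i> q z" for z
    using curv[of 1 2 1 2 z] by (simp add: riemann_tensor_def chr' sum_2 coord_vec_def neg algebra_simps)
  \<comment> \<open>A second curvature component supplies the symmetry of the mixed derivatives of
    \<open>ln \<mu>\<close>.\<close>
  have curl: "dir_deriv \<i> p z = dir_deriv 1 q z" for z
    using curv[of 1 1 1 2 z] by (simp add: riemann_tensor_def chr' sum_2 coord_vec_def neg algebra_simps)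
  \<comment> \<open>\<open>div\<close> and \<open>curl\<close> are the Cauchy-Riemann equations of
    this function.\<close>
  define G where "G z = complex_of_real (p z) - \<i> * complex_of_real (q z)" for z
  have "(G has_field_derivative (complex_of_real (dir_deriv 1 p z) - \<i> * complex_of_real (dir_deriv 1 q z))) (at z)" for z
  proof -
    have "(G has_derivative (\<lambda>v. complex_of_real (dir_deriv v p z) - \<i> * complex_of_real (dir_deriv v q z))) (at z)"
      unfolding G_def by (auto intro!: derivative_eq_intros dp dq)
    also have "(\<lambda>v. complex_of_real (dir_deriv v p z) - \<i> * complex_of_real (dir_deriv v q z))
        = (*) (complex_of_real (dir_deriv 1 p z) - \<i> * complex_of_real (dir_deriv 1 q z))"
    proof
      fix v
      show "complex_of_real (dir_deriv v p z) - \<i> * complex_of_real (dir_deriv v q z)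
        = (complex_of_real (dir_deriv 1 p z) - \<i> * complex_of_real (dir_deriv 1 q z)) * v"
        unfolding dir_deriv_cartesian[OF dp, of v] dir_deriv_cartesian[OF dq, of v]
        by (simp add: complex_eq_iff div curl)
    qed
    finally show ?thesis unfolding has_field_derivative_def .
  qed
  then have hol: "G holomorphic_on UNIV"
    by (auto simp: holomorphic_on_def field_differentiable_def)
  have shift: "dir_deriv v \<mu> (z + \<gamma>) = dir_deriv v \<mu> z" if "\<gamma> \<in> int_span a b" for v z \<gamma>
  proof -
    have "((\<lambda>w. \<mu> (w + \<gamma>)) has_derivative (\<lambda>v. dir_deriv v \<mu> (z + \<gamma>))) (at z)"
      by (rule has_derivative_compose[OF _ d\<mu>]) (auto intro!: derivative_eq_intros)
    then show ?thesis using dir_deriv_eq per[OF that] by fastforce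
  qed
  have "bounded (range G)"
  proof (rule bounded_range_periodic[OF ind])
    show "continuous_on UNIV G" using hol holomorphic_on_imp_continuous_on by blast
    show "G (z + \<gamma>) = G z" if "\<gamma> \<in> int_span a b" for z \<gamma>
      by (simp add: G_def p_def q_def shift[OF that] per[OF that])
  qed
  with hol obtain G0 where "\<And>z. G z = G0"
    using Liouville_theorem unfolding constant_on_def by blast
  then have G0: "p z = Re G0" "q z = - Im G0" for z
    unfolding G_def by (auto simp: complex_eq_iff minus_equation_iff)
  \<comment> \<open>With a constant gradient, \<open>ln \<mu>\<close> is affine with linear part
    \<open>2 * L\<close>. Periodicity makes \<open>L\<close> vanish on the two generators, hence
    everywhere.\<close>
  define L where "L v = Re G0 * Re v - Im G0 * Im v" for v
  have d\<mu>L: "dir_deriv v \<mu> z = 2 * \<mu> z * L v" for v z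
  proof -
    have "dir_deriv 1 \<mu> z = 2 * \<mu> z * Re G0" "dir_deriv \<i> \<mu> z = 2 * \<mu> z * (- Im G0)"
      using G0[of z] pos[of z] by (simp_all add: p_def q_def field_simps)
    then show ?thesis
      unfolding dir_deriv_cartesian[OF d\<mu>, of v] by (simp add: L_def algebra_simps)
  qed
  have "((\<lambda>z. ln (\<mu> z) - 2 * L z) has_derivative (\<lambda>v. 0)) (at z within UNIV)" for z
    unfolding L_def using pos[of z]
    by (auto intro!: derivative_eq_intros d\<mu> simp: d\<mu>L L_def field_simps)
  then obtain C where C: "\<And>z. ln (\<mu> z) - 2 * L z = C"
    using has_derivative_zero_unique[of UNIV "\<lambda>z. ln (\<mu> z) - 2 * L z"] by (metis UNIV_I convex_UNIV)
  have "L \<gamma> = 0" if "\<gamma> \<in> int_span a b" for \<gamma>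
  proof -
    have "L (0 + \<gamma>) = L 0" using C[of "0 + \<gamma>"] C[of 0] unfolding per[OF that] by linarith
    then show ?thesis by (simp add: L_def)
  qed
  then have "L a = 0" "L b = 0" using generator_in_int_span by blast+
  have "L z = 0" for z
  proof -
    obtain s t where z: "z = s *\<^sub>R a + t *\<^sub>R b" using independent_pair_coords[OF ind] .
    have "L z = s * L a + t * L b" unfolding z by (simp add: L_def algebra_simps)
    then show ?thesis using \<open>L a = 0\<close> \<open>L b = 0\<close> by simp
  qed
  then have "\<mu> z = exp C" for z using C[of z] pos[of z] by (metis diff_zero exp_ln mult_zero_right)
  then show thesis using that[of "exp C"] by simp
qed

subsection \<open>Lifting isotropic vectors to spinors\<close>

lemma power2_in_nonpos_Reals_iff: "z\<^sup>2 \<in> \<real>\<^sub>\<le>\<^sub>0 \<longleftrightarrow> Re z = 0" for z :: complex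
  by (auto simp: complex_nonpos_Reals_iff Re_power2 Im_power2)

text \<open>A preimage of a point with \<open>X s \<noteq> 0\<close> is a square root
  \<open>a\<close> of \<open>X s\<close> together with \<open>W s / a\<close>. The abstract
  coordinates \<open>f\<close>, \<open>g\<close>, \<open>X\<close>, \<open>W\<close>,
  \<open>mk\<close> let one argument serve both charts of the cone, which differ by swapping the
  factors.\<close>

lemma squares_evenly_covered:
  fixes p :: "'a::topological_space \<Rightarrow> 'b::t2_space"
    and f g :: "'a \<Rightarrow> complex" and X W :: "'b \<Rightarrow> complex" and mk :: "complex \<times> complex \<Rightarrow> 'a"
  assumes cont: "continuous_on UNIV p" "continuous_on UNIV f" "continuous_on UNIV X" "continuous_on UNIV W"
      "continuous_on UNIV mk"
    and im: "p ` C = S" and C: "C = {u. f u \<noteq> 0 \<or> g u \<noteq> 0}"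
    and coords: "\<And>u. X (p u) = (f u)\<^sup>2" "\<And>u. W (p u) = f u * g u"
      "\<And>u. mk (f u, g u) = u" "\<And>v. f (mk v) = fst v" "\<And>v. g (mk v) = snd v"
    and inv: "\<And>s a. s \<in> S \<Longrightarrow> a\<^sup>2 = X s \<Longrightarrow> a \<noteq> 0 \<Longrightarrow> p (mk (a, W s / a)) = s"
    and s: "s \<in> S" "X s \<noteq> 0"
  shows "\<exists>T. s \<in> T \<and> openin (top_of_set S) T \<and>
           (\<exists>v. \<Union>v = C \<inter> p -` T \<and> (\<forall>u \<in> v. openin (top_of_set C) u) \<and>
              pairwise disjnt v \<and> (\<forall>u \<in> v. \<exists>q. homeomorphism u T p q))"
proof -
  define r where "r = csqrt (X s)"
  have r: "r\<^sup>2 = X s" "r \<noteq> 0" using s(2) by (auto simp: r_def)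
  \<comment> \<open>On \<open>T\<close> the quotient avoids the branch cut, so each root of
    \<open>X s\<close> extends continuously. The sheet \<open>U \<rho>\<close> consists of the
    points whose first coordinate is nearer to \<open>\<rho>\<close> than to
    \<open>- \<rho>\<close>.\<close>
  define T where "T = S \<inter> {t. X t / X s \<notin> \<real>\<^sub>\<le>\<^sub>0}"
  define U where "U \<rho> = {u. Re (f u / \<rho>) > 0}" for \<rho>
  have rho: "\<exists>q. homeomorphism (U \<rho>) T p q" if \<rho>: "\<rho>\<^sup>2 = X s" for \<rho>
  proof
    have "\<rho> \<noteq> 0" using \<rho> s(2) by auto
    define h where "h t = \<rho> * csqrt (X t / X s)" for t
    define q where "q t = mk (h t, W t / h t)" for t
    have h2: "(h t)\<^sup>2 = X t" for t
      unfolding h_def power_mult_distrib \<rho> power2_csqrt using s(2) by simp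
    have hnz: "h t \<noteq> 0" if "t \<in> T" for t
      using that \<open>\<rho> \<noteq> 0\<close> by (auto simp: h_def T_def)
    show "homeomorphism (U \<rho>) T p q"
    proof
      show "continuous_on (U \<rho>) p" using cont(1) continuous_on_subset by blast
      have "continuous_on T h" unfolding h_def
        by (intro continuous_intros continuous_on_compose2[OF continuous_on_csqrt] continuous_on_subset[OF cont(3)])
           (use s(2) in \<open>auto simp: T_def\<close>)
      then show "continuous_on T q" unfolding q_def
        by (intro continuous_on_compose2[OF cont(5)] continuous_intros continuous_on_subset[OF cont(4)]) (auto simp: hnz)
      show "p ` U \<rho> \<subseteq> T"
      proof clarify
        fix u assume u: "u \<in> U \<rho>"
        then have "f u \<noteq> 0" by (auto simp: U_def)
        then have "p u \<in> S" using im C by auto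
        moreover have "X (p u) / X s = (f u / \<rho>)\<^sup>2" by (simp add: coords \<rho> power_divide)
        then have "X (p u) / X s \<notin> \<real>\<^sub>\<le>\<^sub>0"
          using u by (simp add: power2_in_nonpos_Reals_iff U_def)
        ultimately show "p u \<in> T" by (simp add: T_def)
      qed
      show "q ` T \<subseteq> U \<rho>"
      proof clarify
        fix t assume t: "t \<in> T"
        then have "csqrt (X t / X s) \<noteq> 0" "X t / X s \<notin> \<real>\<^sub>\<le>\<^sub>0" by (auto simp: T_def)
        then have "Re (csqrt (X t / X s)) \<noteq> 0"
          using power2_in_nonpos_Reals_iff[of "csqrt (X t / X s)"] by simp
        then have "Re (csqrt (X t / X s)) > 0"
          using csqrt_principal[of "X t / X s"] by auto
        then show "q t \<in> U \<rho>" using \<open>\<rho> \<noteq> 0\<close> by (simp add: U_def q_def coords h_def)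
      qed
      show "q (p u) = u" if "u \<in> U \<rho>" for u
      proof -
        have "csqrt ((f u / \<rho>)\<^sup>2) = f u / \<rho>"
          using that by (intro csqrt_square) (auto simp: U_def)
        then have "h (p u) = f u" using \<open>\<rho> \<noteq> 0\<close> by (simp add: h_def coords \<rho>[symmetric] power_divide)
        moreover have "f u \<noteq> 0" using that by (auto simp: U_def)
        ultimately show ?thesis by (simp add: q_def coords)
      qed
      show "p (q t) = t" if "t \<in> T" for t
        unfolding q_def using that inv[of t "h t"] h2 hnz by (auto simp: T_def)
    qed
  qed
  show ?thesis
  proof (intro exI[of _ T] exI[of _ "{U r, U (- r)}"] conjI)
    show "s \<in> T" using s by (simp add: T_def)
    have "closed {t. X t / X s \<in> \<real>\<^sub>\<le>\<^sub>0}"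
      using continuous_closed_vimage[of "\<real>\<^sub>\<le>\<^sub>0" "\<lambda>t. X t / X s"] cont(3) s(2)
      by (auto simp: vimage_def continuous_on_eq_continuous_at intro!: continuous_intros)
    then have "open {t. X t / X s \<notin> \<real>\<^sub>\<le>\<^sub>0}" by (simp add: open_closed Collect_neg_eq)
    then show "openin (top_of_set S) T" unfolding T_def by (rule openin_open_Int)
    have "u \<in> C \<inter> p -` T \<longleftrightarrow> u \<in> U r \<union> U (- r)" for u
    proof -
      have 1: "X (p u) / X s = (f u / r)\<^sup>2" by (simp add: coords r(1) power_divide)
      have "p u \<in> S" if "u \<in> C" using im that by blast
      then have "u \<in> C \<inter> p -` T \<longleftrightarrow> u \<in> C \<and> Re (f u / r) \<noteq> 0"
        by (auto simp: T_def 1 power2_in_nonpos_Reals_iff)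
      also have "\<dots> \<longleftrightarrow> u \<in> U r \<union> U (- r)"
        using r(2) by (auto simp: U_def C)
      finally show ?thesis .
    qed
    then show "\<Union> {U r, U (- r)} = C \<inter> p -` T" by auto
    have "open (U \<rho>)" if "\<rho> \<noteq> 0" for \<rho>
      unfolding U_def by (intro open_Collect_less continuous_intros cont(2)) (use that in auto)
    moreover have "U \<rho> \<subseteq> C" for \<rho> by (auto simp: U_def C)
    ultimately show "\<forall>u\<in>{U r, U (- r)}. openin (top_of_set C) u"
      using r(2) by (auto intro!: open_openin_trans open_subset)
    show "pairwise disjnt {U r, U (- r)}"
      by (auto simp: pairwise_def disjnt_def U_def)
    show "\<forall>u\<in>{U r, U (- r)}. \<exists>q. homeomorphism u T p q"
      using rho[of r] rho[of "- r"] r(1) by auto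
  qed
qed

text \<open>In suitable linear coordinates \<open>w\<^sup>2 = x * y\<close> is the cone of isotropic vectors of \<open>\<complex>\<^sup>3\<close>.\<close>

lemma covering_space_squares:
  "covering_space (- {0}) (\<lambda>(a, b). (a\<^sup>2, a * b, b\<^sup>2)) ({(x, w, y). w\<^sup>2 = x * y} - {(0, 0, 0) :: complex \<times> complex \<times> complex})"
    (is "covering_space ?C ?p ?S")
proof
  have cp: "continuous_on A ?p" for A
    unfolding case_prod_beta by (intro continuous_intros)
  then show "continuous_on ?C ?p" .
  show im: "?p ` ?C = ?S"
  proof (intro equalityI subsetI)
    fix s assume "s \<in> ?S"
    moreover obtain x w y where "s = (x, w, y)" by (cases s)
    ultimately have s: "s = (x, w, y)" "w\<^sup>2 = x * y" "x \<noteq> 0 \<or> y \<noteq> 0" by auto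
    show "s \<in> ?p ` ?C"
    proof (cases "x = 0")
      case True
      then show ?thesis using s by (intro image_eqI[of _ _ "(0, csqrt y)"]) (auto simp: zero_prod_def)
    next
      case False
      then have "csqrt x \<noteq> 0" by simp
      then have "s = ?p (csqrt x, w / csqrt x)" using s False by (simp add: power_divide)
      moreover have "(csqrt x, w / csqrt x) \<in> ?C" using \<open>csqrt x \<noteq> 0\<close> by (simp add: zero_prod_def)
      ultimately show ?thesis by (rule image_eqI)
    qed
  qed (auto simp: zero_prod_def power_mult_distrib)
  fix s assume s: "s \<in> ?S"
  have C: "?C = {u. fst u \<noteq> 0 \<or> snd u \<noteq> 0}" "?C = {u. snd u \<noteq> 0 \<or> fst u \<noteq> 0}"
    by (auto simp: zero_prod_def)
  obtain x w y where "s = (x, w, y)" by (cases s)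
  with s have xyz: "s = (x, w, y)" "w\<^sup>2 = x * y" "x \<noteq> 0 \<or> y \<noteq> 0" by auto
  show "\<exists>T. s \<in> T \<and> openin (top_of_set ?S) T \<and>
           (\<exists>v. \<Union>v = ?C \<inter> ?p -` T \<and> (\<forall>u \<in> v. openin (top_of_set ?C) u) \<and>
              pairwise disjnt v \<and> (\<forall>u \<in> v. \<exists>q. homeomorphism u T ?p q))"
  proof (cases "x = 0")
    case False
    show ?thesis
      by (rule squares_evenly_covered[where f = fst and g = snd and X = fst and W = "\<lambda>s. fst (snd s)" and mk = "\<lambda>v. v",
            OF cp _ _ _ _ im C(1) _ _ _ _ _ _ s])
         (use False xyz in \<open>auto intro!: continuous_intros simp: power_divide field_simps\<close>)
  next
    case True
    show ?thesis
      by (rule squares_evenly_covered[where f = snd and g = fst and X = "\<lambda>s. snd (snd s)" and W = "\<lambda>s. fst (snd s)" and mk = prod.swap,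
            OF cp _ _ _ _ im C(2) _ _ _ _ _ _ s])
         (use True xyz in \<open>auto intro!: continuous_intros simp: power_divide field_simps prod.swap_def\<close>)
  qed
qed

text \<open>The plane is simply connected, so a continuous map into the punctured cone lifts through
  the double covering, even where one of \<open>A\<close>, \<open>B\<close> vanishes and has no
  evident root.\<close>

lemma isotropic_lift:
  fixes A B C :: "complex \<Rightarrow> complex"
  assumes "continuous_on UNIV A" "continuous_on UNIV B" "continuous_on UNIV C"
    and "\<And>z. (C z)\<^sup>2 = A z * B z" "\<And>z. A z \<noteq> 0 \<or> B z \<noteq> 0"
  obtains p h where "continuous_on UNIV p" "continuous_on UNIV h"
    "\<And>z. (p z)\<^sup>2 = A z" "\<And>z. (h z)\<^sup>2 = B z" "\<And>z. p z * h z = C z"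
proof -
  have "continuous_on UNIV (\<lambda>z. (A z, C z, B z))" by (intro continuous_intros assms)
  moreover have "(\<lambda>z. (A z, C z, B z)) \<in> UNIV \<rightarrow> ({(x, w, y). w\<^sup>2 = x * y} - {(0, 0, 0)})"
    using assms(4,5) by auto
  ultimately obtain g where g: "continuous_on UNIV g" "\<And>z. (case g z of (a, b) \<Rightarrow> (a\<^sup>2, a * b, b\<^sup>2)) = (A z, C z, B z)"
    by (rule covering_space_lift[OF covering_space_squares, rotated 2])
       (auto intro: convex_imp_simply_connected convex_imp_locally_path_connected)
  show thesis
    by (rule that[of "\<lambda>z. fst (g z)" "\<lambda>z. snd (g z)"])
       (use g in \<open>auto intro!: continuous_intros simp: case_prod_beta\<close>)
qed

text \<open>Dividing by the value at \<open>z\<close> moves the argument of the root to 1, away from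
  the branch cut. Near \<open>z\<close> the quotient \<open>p w / p z\<close> has positive real part
  and is therefore the principal root.\<close>

lemma has_derivative_continuous_sqrt:
  fixes p A :: "complex \<Rightarrow> complex"
  assumes cont: "continuous (at z) p" and sq: "\<And>w. (p w)\<^sup>2 = A w" and nz: "p z \<noteq> 0"
    and A: "(A has_derivative A') (at z)"
  shows "(p has_derivative (\<lambda>v. A' v / (2 * p z))) (at z)"
proof -
  have Anz: "A z \<noteq> 0" using nz sq[of z] by auto
  have "((\<lambda>w. A w / A z) has_derivative (\<lambda>v. A' v / A z)) (at z)"
    unfolding divide_inverse by (rule has_derivative_mult_left[OF A])
  moreover have "(csqrt has_derivative (*) (inverse (2 * csqrt 1))) (at (A z / A z))"
    using has_field_derivative_csqrt[of 1] Anz by (simp add: has_field_derivative_def)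
  ultimately have "((\<lambda>w. csqrt (A w / A z)) has_derivative (\<lambda>v. inverse (2 * csqrt 1) * (A' v / A z))) (at z)"
    by (rule has_derivative_compose)
  then have "((\<lambda>w. p z * csqrt (A w / A z)) has_derivative (\<lambda>v. p z * (inverse (2 * csqrt 1) * (A' v / A z)))) (at z)"
    by (rule has_derivative_mult_right)
  also have "(\<lambda>v. p z * (inverse (2 * csqrt 1) * (A' v / A z))) = (\<lambda>v. A' v / (2 * p z))"
    using nz by (simp add: sq[symmetric] power2_eq_square field_simps)
  finally have d: "((\<lambda>w. p z * csqrt (A w / A z)) has_derivative (\<lambda>v. A' v / (2 * p z))) (at z)" .
  have eq: "p z * csqrt (A w / A z) = p w" if "Re (p w / p z) > 0" for w
  proof -
    have "csqrt ((p w / p z)\<^sup>2) = p w / p z" using that by (intro csqrt_square) auto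
    then show ?thesis using nz by (simp add: sq[symmetric] power_divide)
  qed
  have "((\<lambda>w. Re (p w / p z)) \<longlongrightarrow> Re (p z / p z)) (at z)"
    using cont nz by (intro tendsto_intros) (simp_all add: continuous_at)
  then have "\<forall>\<^sub>F w in at z. Re (p w / p z) > 0" using nz by (intro order_tendstoD(1)) auto
  then have "\<forall>\<^sub>F w in at z. p z * csqrt (A w / A z) = p w" by (rule eventually_mono) (rule eq)
  then show ?thesis
    by (rule has_derivative_transform_eventually[OF d _ _ UNIV_I]) (use eq[of z] nz in simp)
qed

text \<open>Near a zero of \<open>p\<close> the spinor \<open>p\<close> is the quotient \<open>C / h\<close>; the formula for \<open>p'\<close> combines
  the two local expressions into one that is visibly continuous.\<close>

lemma isotropic_lift_derivative:
  fixes p h A B C :: "complex \<Rightarrow> complex"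
  assumes cont: "continuous_on UNIV p" "continuous_on UNIV h"
    and sq: "\<And>z. (p z)\<^sup>2 = A z" "\<And>z. (h z)\<^sup>2 = B z" "\<And>z. p z * h z = C z"
    and nz: "\<And>z. p z \<noteq> 0 \<or> h z \<noteq> 0"
    and der: "\<And>z. (A has_derivative A' z) (at z)" "\<And>z. (B has_derivative B' z) (at z)" "\<And>z. (C has_derivative C' z) (at z)"
    and cont': "\<And>v. continuous_on UNIV (\<lambda>z. A' z v)" "\<And>v. continuous_on UNIV (\<lambda>z. B' z v)" "\<And>v. continuous_on UNIV (\<lambda>z. C' z v)"
  obtains p' where "\<And>z. (p has_derivative p' z) (at z)" "\<And>v. continuous_on UNIV (\<lambda>z. p' z v)"
proof -
  \<comment> \<open>The product rule gives \<open>p\<^sup>2 p' = p A' / 2\<close> and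
    \<open>h\<^sup>2 p' = h C' - p B' / 2\<close>. Multiplying by \<open>(cnj p)\<^sup>2\<close> and
    \<open>(cnj h)\<^sup>2\<close> and adding makes the coefficient of \<open>p'\<close> real and
    positive.\<close>
  define p' where "p' z v = ((cnj (p z))\<^sup>2 * p z * A' z v / 2 + (cnj (h z))\<^sup>2 * (h z * C' z v - p z * B' z v / 2))
     / ((p z * cnj (p z))\<^sup>2 + (h z * cnj (h z))\<^sup>2)" for z v
  have den: "(p z * cnj (p z))\<^sup>2 + (h z * cnj (h z))\<^sup>2 \<noteq> 0" for z
  proof -
    have "(p z * cnj (p z))\<^sup>2 + (h z * cnj (h z))\<^sup>2 = of_real ((norm (p z))^4 + (norm (h z))^4)"
      by (simp add: complex_norm_square[symmetric])
    moreover have "(norm (p z))^4 + (norm (h z))^4 > 0"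
      using nz[of z] by (auto intro: add_pos_nonneg add_nonneg_pos)
    ultimately show ?thesis by (metis less_irrefl of_real_eq_0_iff)
  qed
  have contA: "continuous (at z) p" "continuous (at z) h" for z
    using cont continuous_on_eq_continuous_at open_UNIV by blast+
  have formula: "D v = p' z v"
    if D: "2 * p z * D v = A' z v" "2 * h z * E v = B' z v" "p z * E v + h z * D v = C' z v" for z D E v
  proof -
    have "h z * C' z v - p z * B' z v / 2 = (h z)\<^sup>2 * D v"
      unfolding D(2)[symmetric] D(3)[symmetric] by (simp add: power2_eq_square algebra_simps)
    moreover have "(cnj (p z))\<^sup>2 * p z * A' z v / 2 = (p z * cnj (p z))\<^sup>2 * D v"
      unfolding D(1)[symmetric] by (simp add: power2_eq_square algebra_simps)
    ultimately have "p' z v = ((p z * cnj (p z))\<^sup>2 + (h z * cnj (h z))\<^sup>2) * D v / ((p z * cnj (p z))\<^sup>2 + (h z * cnj (h z))\<^sup>2)"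
      unfolding p'_def by (simp add: power_mult_distrib algebra_simps)
    then show ?thesis using den[of z] by simp
  qed
  have "\<exists>D E. (p has_derivative D) (at z) \<and> (h has_derivative E) (at z)" for z
  proof (cases "p z = 0")
    case False
    have p: "(p has_derivative (\<lambda>v. A' z v / (2 * p z))) (at z)"
      by (rule has_derivative_continuous_sqrt[OF contA(1) sq(1) False der(1)])
    have "((\<lambda>w. C w / p w) has_derivative (\<lambda>v. - C z * (inverse (p z) * (A' z v / (2 * p z)) * inverse (p z)) + C' z v / p z)) (at z)"
      by (rule has_derivative_divide[OF der(3) p False])
    moreover have "\<forall>\<^sub>F w in at z. p w \<noteq> 0"
      using contA(1)[of z] False by (simp add: continuous_at tendsto_imp_eventually_ne)
    then have "\<forall>\<^sub>F w in at z. C w / p w = h w"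
      by (rule eventually_mono) (simp add: sq(3)[symmetric])
    ultimately have "(h has_derivative (\<lambda>v. - C z * (inverse (p z) * (A' z v / (2 * p z)) * inverse (p z)) + C' z v / p z)) (at z)"
      by (rule has_derivative_transform_eventually) (use False in \<open>auto simp: sq(3)[symmetric]\<close>)
    with p show ?thesis by blast
  next
    case True
    then have False: "h z \<noteq> 0" using nz by blast
    have p: "(h has_derivative (\<lambda>v. B' z v / (2 * h z))) (at z)"
      by (rule has_derivative_continuous_sqrt[OF contA(2) sq(2) False der(2)])
    have "((\<lambda>w. C w / h w) has_derivative (\<lambda>v. - C z * (inverse (h z) * (B' z v / (2 * h z)) * inverse (h z)) + C' z v / h z)) (at z)"
      by (rule has_derivative_divide[OF der(3) p False])
    moreover have "\<forall>\<^sub>F w in at z. h w \<noteq> 0"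
      using contA(2)[of z] False by (simp add: continuous_at tendsto_imp_eventually_ne)
    then have "\<forall>\<^sub>F w in at z. C w / h w = p w"
      by (rule eventually_mono) (simp add: sq(3)[symmetric])
    ultimately have "(p has_derivative (\<lambda>v. - C z * (inverse (h z) * (B' z v / (2 * h z)) * inverse (h z)) + C' z v / h z)) (at z)"
      by (rule has_derivative_transform_eventually) (use False in \<open>auto simp: sq(3)[symmetric]\<close>)
    with p show ?thesis by blast
  qed
  then have "(p has_derivative p' z) (at z)" for z
  proof -
    obtain D E where D: "(p has_derivative D) (at z)" and E: "(h has_derivative E) (at z)"
      using \<open>\<exists>D E. (p has_derivative D) (at z) \<and> (h has_derivative E) (at z)\<close> by blast
    have "((\<lambda>w. (p w)\<^sup>2) has_derivative (\<lambda>v. 2 * p z * D v)) (at z)" "((\<lambda>w. (h w)\<^sup>2) has_derivative (\<lambda>v. 2 * h z * E v)) (at z)"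
      by (auto intro!: derivative_eq_intros D E)
    then have "(\<lambda>v. 2 * p z * D v) = A' z" "(\<lambda>v. 2 * h z * E v) = B' z"
      unfolding sq using der has_derivative_unique by blast+
    moreover have "((\<lambda>w. p w * h w) has_derivative (\<lambda>v. p z * E v + D v * h z)) (at z)"
      by (rule has_derivative_mult[OF D E])
    then have "(\<lambda>v. p z * E v + D v * h z) = C' z"
      unfolding sq using der has_derivative_unique by blast
    ultimately have "D v = p' z v" for v
      using formula[of z D v E] by (metis mult.commute)
    then have "D = p' z" by blast
    then show ?thesis using D by simp
  qed
  moreover have "continuous_on UNIV (\<lambda>z. p' z v)" for v
    unfolding p'_def by (intro continuous_intros cont cont') (use den in auto)
  ultimately show thesis by (rule that)
qed

subsection \<open>Fourier coefficients\<close>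

lemma periodic_of_int:
  fixes \<phi> :: "real \<Rightarrow> 'a"
  assumes "\<And>s. \<phi> (s + 1) = \<phi> s"
  shows "\<phi> (s + of_int n) = \<phi> s"
proof (induction n rule: int_induct[where k=0])
  case (step1 i)
  then show ?case using assms[of "s + of_int i"] by (simp add: add_ac)
next
  case (step2 i)
  then show ?case using assms[of "s + of_int (i - 1)"] by (simp add: add_ac)
qed simp

lemma integral_periodic_shift:
  fixes \<phi> :: "real \<Rightarrow> complex"
  assumes cont: "continuous_on UNIV \<phi>" and per: "\<And>s. \<phi> (s + 1) = \<phi> s"
  shows "integral {0..1} (\<lambda>s. \<phi> (s + t)) = integral {0..1} \<phi>"
proof -
  note per_int = periodic_of_int[of \<phi>, OF per]
  define r where "r = frac t"
  have r: "0 \<le> r" "r \<le> 1" using frac_lt_1[of t] by (auto simp: r_def)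
  have int: "\<phi> integrable_on {a..b}" for a b
    using cont continuous_on_subset integrable_continuous_real by blast
  have "\<phi> (s + t) = \<phi> (s + r)" for s
    using per_int[of "s + r" "\<lfloor>t\<rfloor>"] by (simp add: r_def frac_def)
  then have "integral {0..1} (\<lambda>s. \<phi> (s + t)) = integral {r..1 + r} \<phi>"
    using integral_shift_real_ivl[of r r "1 + r" \<phi>] by simp
  also have "\<dots> = integral {r..1} \<phi> + integral {1..1 + r} \<phi>"
    using r int by (intro Henstock_Kurzweil_Integration.integral_combine[symmetric]) auto
  also have "integral {1..1 + r} \<phi> = integral {0..r} (\<lambda>s. \<phi> (s + 1))"
    using integral_shift_real_ivl[of 1 1 "1 + r" \<phi>] by simp
  also have "\<dots> = integral {0..r} \<phi>" by (simp add: per)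
  also have "integral {r..1} \<phi> + integral {0..r} \<phi> = integral {0..1} \<phi>"
    using r int Henstock_Kurzweil_Integration.integral_combine[of 0 r 1 \<phi>] by (simp add: add_ac)
  finally show ?thesis .
qed

text \<open>Continuity is built in so that closure under sums and under multiplication by characters
  carries no separate integrability condition.\<close>

definition fourier_null :: "(real \<Rightarrow> complex) \<Rightarrow> bool" where
  "fourier_null \<phi> \<longleftrightarrow> continuous_on UNIV \<phi> \<and>
     (\<forall>k::int. integral {0..1} (\<lambda>s. \<phi> s * cis (2 * pi * of_int k * s)) = 0)"

lemma fourier_null_add:
  assumes "fourier_null \<phi>" "fourier_null \<psi>"
  shows "fourier_null (\<lambda>s. \<phi> s + \<psi> s)"
proof -
  have c: "continuous_on A \<phi>" "continuous_on A \<psi>" for A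
    using assms continuous_on_subset unfolding fourier_null_def by blast+
  have "integral {0..1} (\<lambda>s. (\<phi> s + \<psi> s) * cis (2 * pi * of_int k * s)) = 0" for k :: int
    unfolding distrib_right
    by (subst Henstock_Kurzweil_Integration.integral_add)
       (use assms in \<open>auto simp: fourier_null_def intro!: integrable_continuous_real continuous_intros c\<close>)
  then show ?thesis unfolding fourier_null_def by (auto intro!: continuous_intros c)
qed

lemma fourier_null_cmult: "fourier_null \<phi> \<Longrightarrow> fourier_null (\<lambda>s. c * \<phi> s)"
  unfolding fourier_null_def by (auto intro!: continuous_intros simp: mult.assoc)

lemma fourier_null_cis: "fourier_null \<phi> \<Longrightarrow> fourier_null (\<lambda>s. \<phi> s * cis (2 * pi * of_int m * s))"
proof -
  assume \<phi>: "fourier_null \<phi>"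
  have eq: "\<phi> s * cis (2 * pi * of_int m * s) * cis (2 * pi * of_int k * s) = \<phi> s * cis (2 * pi * of_int (m + k) * s)" for s k
    by (simp add: mult.assoc cis_mult algebra_simps)
  show ?thesis
    using \<phi> unfolding fourier_null_def eq by (auto intro!: continuous_intros simp del: of_int_add)
qed

text \<open>Polynomials restricted to the circle are trigonometric, and multiplication by a
  character only shifts the index \<open>k\<close>. The induction varies \<open>\<phi>\<close> so
  that a product can be absorbed one factor at a time.\<close>

lemma fourier_null_polynomial:
  assumes "real_polynomial_function r" "fourier_null \<phi>"
  shows "fourier_null (\<lambda>s. \<phi> s * of_real (r (cis (2 * pi * s))))"
  using assms
proof (induction arbitrary: \<phi>)
  case (linear f)
  \<comment> \<open>The Wirtinger derivative of the real-linear \<open>f\<close>: such an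
    \<open>f\<close> has the form \<open>c * w + cnj c * cnj w\<close>, and conjugation on the
    circle is inversion.\<close>
  define c where "c = (of_real (f 1) - \<i> * of_real (f \<i>)) / 2"
  have "of_real (f (cis x)) = c * cis x + cnj c * cis (- x)" for x
  proof -
    have "f (cis x) = f (cos x *\<^sub>R 1 + sin x *\<^sub>R \<i>)"
      by (rule arg_cong[where f=f]) (simp add: complex_eq_iff)
    also have "\<dots> = cos x * f 1 + sin x * f \<i>"
      using linear by (simp add: linear_simps bounded_linear.linear linear_add linear_scale)
    finally show ?thesis by (simp add: c_def complex_eq_iff field_simps)
  qed
  then have eq: "\<phi> s * of_real (f (cis (2 * pi * s))) = c * (\<phi> s * cis (2 * pi * of_int 1 * s)) + cnj c * (\<phi> s * cis (2 * pi * of_int (- 1) * s))" for s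
    by (simp add: algebra_simps)
  show ?case
    unfolding eq by (intro fourier_null_add fourier_null_cmult fourier_null_cis linear)
next
  case (const c)
  then show ?case using fourier_null_cmult[of \<phi> "of_real c"] by (simp add: mult.commute)
next
  case (add f g)
  then show ?case using fourier_null_add[OF add.IH(1) add.IH(2)] by (simp add: distrib_left)
next
  case (mult f g)
  then show ?case using mult.IH(2)[OF mult.IH(1)[OF mult.prems]] by (simp add: mult.assoc)
qed

text \<open>Weierstrass approximation by polynomials asks for a function on a compact set, here the
  circle of parameters modulo 1.\<close>

lemma continuous_on_circle_of_periodic:
  fixes \<phi> :: "real \<Rightarrow> complex"
  assumes cont: "continuous_on UNIV \<phi>" and per: "\<And>s. \<phi> (s + 1) = \<phi> s"
  obtains f where "continuous_on (sphere 0 1) f" "\<And>t. f (cis (2 * pi * t)) = \<phi> t"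
proof -
  note per_int = periodic_of_int[of \<phi>, OF per]
  define f where "f w = \<phi> (Arg w / (2 * pi))" for w
  have f: "f (cis (2 * pi * t)) = \<phi> t" for t
  proof -
    have "cis (Arg (cis (2 * pi * t))) = cis (2 * pi * t)"
      by (simp add: cis_Arg sgn_div_norm)
    then obtain n :: int where "Arg (cis (2 * pi * t)) = 2 * pi * t + 2 * pi * n"
      using sin_cos_eq_iff[of "Arg (cis (2 * pi * t))" "2 * pi * t"] by (auto simp: complex_eq_iff)
    then have "Arg (cis (2 * pi * t)) / (2 * pi) = t + of_int n"
      by (simp add: field_simps)
    then show ?thesis by (simp add: f_def per_int)
  qed
  have "continuous_on (sphere 0 1) f"
  proof (clarsimp simp: continuous_on_eq_continuous_within)
    fix w0 :: complex assume w0: "norm w0 = 1"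
    define t0 where "t0 = Arg w0 / (2 * pi)"
    have t0: "w0 = cis (2 * pi * t0)"
    proof -
      have "w0 \<noteq> 0" using w0 by auto
      then have "cis (Arg w0) = w0" using w0 by (simp add: cis_Arg sgn_div_norm)
      then show ?thesis by (simp add: t0_def)
    qed
    \<comment> \<open>\<open>Arg\<close> jumps at the negative axis. Rotating \<open>w0\<close> to 1
      gives a branch continuous near \<open>w0\<close>, and by periodicity both branches yield the
      same value of \<open>\<phi>\<close>.\<close>
    define h where "h w = \<phi> (t0 + Im (Ln (w / w0)) / (2 * pi))" for w
    have nz: "w0 \<noteq> 0" using w0 by auto
    have "continuous (at w0 within sphere 0 1) (\<lambda>w. t0 + Im (Ln (w / w0)) / (2 * pi))"
    proof -
      have "isCont (\<lambda>w. Ln (w / w0)) w0"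
        using nz by (intro isCont_Ln' isCont_divide continuous_ident continuous_const) auto
      then have "isCont (\<lambda>w. Im (Ln (w / w0))) w0"
        by (rule isCont_Im)
      then have "isCont (\<lambda>w. t0 + Im (Ln (w / w0)) / (2 * pi)) w0"
        by (rule isCont_add[OF continuous_const isCont_divide[OF _ continuous_const]]) simp
      then show ?thesis by (rule continuous_at_imp_continuous_within)
    qed
    then have h_cont: "continuous (at w0 within sphere 0 1) h"
      unfolding h_def by (rule continuous_within_compose3[rotated]) (use cont in \<open>simp add: continuous_on_eq_continuous_at\<close>)
    have fh: "f w = h w" if "norm w = 1" for w
    proof -
      have wnz: "w \<noteq> 0" "norm (w / w0) = 1" using that w0 by (auto simp: norm_divide)
      have "cis (Im (Ln (w / w0))) = w / w0"
        using exp_Ln[of "w / w0"] wnz nz Re_Ln[of "w / w0"] by (simp add: exp_eq_polar)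
      then have "w = cis (2 * pi * (t0 + Im (Ln (w / w0)) / (2 * pi)))"
        using nz by (simp add: t0 distrib_left cis_mult[symmetric])
      then show ?thesis unfolding h_def using f by metis
    qed
    show "continuous (at w0 within sphere 0 1) f"
      by (rule continuous_transform_within[OF h_cont, of 1]) (use w0 fh in auto)
  qed
  then show thesis using f that by blast
qed

text \<open>Such a \<open>\<phi>\<close> is orthogonal to all trigonometric polynomials, and these
  approximate \<open>\<phi>\<close> uniformly; so it is orthogonal to itself.\<close>

lemma fourier_null_imp_zero:
  assumes null: "fourier_null \<phi>" and per: "\<And>s. \<phi> (s + 1) = \<phi> s"
  shows "\<phi> t = 0"
proof -
  have cont: "continuous_on A \<phi>" for A
    using null continuous_on_subset unfolding fourier_null_def by blast
  have contc: "continuous_on A (\<lambda>s. cnj (\<phi> s))" for A by (intro continuous_intros cont)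
  obtain f where f: "continuous_on (sphere 0 1) f" "\<And>t. f (cis (2 * pi * t)) = \<phi> t"
    using continuous_on_circle_of_periodic[OF cont[of UNIV] per] by blast
  define I where "I = integral {0..1} (\<lambda>s. \<phi> s * cnj (\<phi> s))"
  obtain M where M: "\<And>s. s \<in> {0..1} \<Longrightarrow> norm (\<phi> s) \<le> M" "M > 0"
  proof -
    have "bounded (\<phi> ` {0..1})" by (intro compact_imp_bounded compact_continuous_image cont) auto
    then show thesis using that unfolding bounded_pos by (metis imageI)
  qed
  have "norm I \<le> e" if "e > 0" for e
  proof -
    have "e / M > 0" using that M by simp
    from Stone_Weierstrass_polynomial_function[OF compact_sphere f(1) this]
    obtain g where g: "polynomial_function g" "\<And>w. w \<in> sphere 0 1 \<Longrightarrow> norm (f w - g w) < e / M"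
      by auto
    define p where "p s = g (cis (2 * pi * s))" for s
    have contp: "continuous_on A p" for A
      unfolding p_def using continuous_on_polymonial_function[OF g(1), of UNIV]
      by (rule continuous_on_compose2) (auto intro!: continuous_intros)
    have "real_polynomial_function (Re \<circ> g)" "real_polynomial_function (Im \<circ> g)"
      using g(1) bounded_linear_Re bounded_linear_Im unfolding polynomial_function_def by blast+
    \<comment> \<open>The factor \<open>- \<i>\<close> assembles the conjugate of the approximating
      polynomial from its real and imaginary parts.\<close>
    then have n: "fourier_null (\<lambda>s. \<phi> s * of_real ((Re \<circ> g) (cis (2 * pi * s))) + (- \<i>) * (\<phi> s * of_real ((Im \<circ> g) (cis (2 * pi * s)))))"
      by (intro fourier_null_add fourier_null_cmult fourier_null_polynomial null)
    have "\<phi> s * of_real ((Re \<circ> g) (cis (2 * pi * s))) + (- \<i>) * (\<phi> s * of_real ((Im \<circ> g) (cis (2 * pi * s)))) = \<phi> s * cnj (p s)" for s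
      by (simp add: p_def complex_eq_iff)
    with n have "fourier_null (\<lambda>s. \<phi> s * cnj (p s))" by simp
    then have "integral {0..1} (\<lambda>s. \<phi> s * cnj (p s)) = 0"
      unfolding fourier_null_def by (auto dest: spec[of _ 0])
    then have "I = integral {0..1} (\<lambda>s. \<phi> s * cnj (\<phi> s)) - integral {0..1} (\<lambda>s. \<phi> s * cnj (p s))" by (simp add: I_def)
    also have "\<dots> = integral {0..1} (\<lambda>s. \<phi> s * cnj (\<phi> s) - \<phi> s * cnj (p s))"
      by (intro Henstock_Kurzweil_Integration.integral_diff[symmetric] integrable_continuous_real continuous_intros cont contp)
    also have "norm \<dots> \<le> e * (1 - 0)"
    proof (rule integral_bound)
      show "continuous_on {0..1} (\<lambda>s. \<phi> s * cnj (\<phi> s) - \<phi> s * cnj (p s))"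
        by (intro continuous_intros cont contp)
      fix s :: real assume s: "s \<in> {0..1}"
      have "\<phi> s * cnj (\<phi> s) - \<phi> s * cnj (p s) = \<phi> s * cnj (f (cis (2 * pi * s)) - g (cis (2 * pi * s)))"
        unfolding p_def f(2) by (simp add: right_diff_distrib)
      also have "norm \<dots> \<le> M * (e / M)"
        unfolding norm_mult complex_mod_cnj
        using mult_mono[OF M(1)[OF s] less_imp_le[OF g(2)[of "cis (2 * pi * s)"]]] M(2) by simp
      finally show "norm (\<phi> s * cnj (\<phi> s) - \<phi> s * cnj (p s)) \<le> e" using M by simp
    qed simp
    finally show ?thesis by simp
  qed
  then have "I = 0" by (metis dense not_le norm_le_zero_iff)
  have "I = integral {0..1} (\<lambda>s. complex_of_real ((norm (\<phi> s))\<^sup>2))"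
    unfolding I_def complex_norm_square ..
  also have "\<dots> = of_real (integral {0..1} (\<lambda>s. (norm (\<phi> s))\<^sup>2))"
    using integral_linear[of "\<lambda>s. (norm (\<phi> s))\<^sup>2" "{0..1}" complex_of_real]
    by (simp add: o_def continuous_intros cont integrable_continuous_real bounded_linear_of_real)
  finally have "integral {0..1} (\<lambda>s. (norm (\<phi> s))\<^sup>2) = 0" using \<open>I = 0\<close> by simp
  moreover have "continuous_on {0..1} (\<lambda>s. (norm (\<phi> s))\<^sup>2)"
    by (intro continuous_intros cont)
  ultimately have "\<forall>s\<in>{0..1}. (norm (\<phi> s))\<^sup>2 = 0"
    using integral_eq_0_iff[of 0 1 "\<lambda>s. (norm (\<phi> s))\<^sup>2"] by simp
  then have zero: "\<phi> s = 0" if "s \<in> {0..1}" for s using that by simp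
  have "\<phi> t = f (cis (2 * pi * t))" by (simp add: f)
  also have "cis (2 * pi * t) = cis (2 * pi * frac t)"
    by (simp add: frac_def right_diff_distrib cis_divide[symmetric] mult.commute[of _ "2 * pi"])
  also have "f \<dots> = \<phi> (frac t)" by (simp add: f)
  also have "\<dots> = 0" using frac_lt_1[of t] by (intro zero) (auto intro: less_imp_le)
  finally show ?thesis .
qed

section \<open>Fourier coefficients on the torus\<close>

lemma wave_scaleR: "wave \<omega> (s *\<^sub>R \<gamma>) = cis (s * (\<omega> \<bullet> \<gamma>))" and wave_0 [simp]: "wave \<omega> 0 = 1" "wave 0 z = 1"
  by (simp_all add: wave_def)

lemma cnj_wave: "cnj (wave \<omega> z) = wave (- \<omega>) z"
  by (simp add: wave_def cis_cnj)

lemma continuous_on_wave [continuous_intros]: "continuous_on A f \<Longrightarrow> continuous_on A (\<lambda>x. wave \<omega> (f x))"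
  unfolding wave_def by (intro continuous_intros)

lemma wave_line_derivative:
  "((\<lambda>t. wave \<omega> (t *\<^sub>R v)) has_vector_derivative \<i> * of_real (\<omega> \<bullet> v) * wave \<omega> (t *\<^sub>R v)) (at t)"
proof -
  have "((\<lambda>t. wave \<omega> (t *\<^sub>R v)) has_derivative (\<lambda>s. \<i> * of_real (\<omega> \<bullet> (s *\<^sub>R v)) * wave \<omega> (t *\<^sub>R v))) (at t)"
    by (rule has_derivative_compose[OF _ has_derivative_wave]) (auto intro!: derivative_eq_intros)
  moreover have "\<i> * complex_of_real (\<omega> \<bullet> (s *\<^sub>R v)) * c = s *\<^sub>R (\<i> * of_real (\<omega> \<bullet> v) * c)" for s c
    by (simp add: complex_eq_iff algebra_simps)
  ultimately show ?thesis by (simp add: has_vector_derivative_def)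
qed

text \<open>The Fourier coefficient along the direction \<open>\<gamma>\<close>, kept as a function
  of the base point. Iterating it over two generators replaces a double integral in skew
  coordinates.\<close>

definition line_mean :: "complex \<Rightarrow> complex \<Rightarrow> (complex \<Rightarrow> complex) \<Rightarrow> complex \<Rightarrow> complex" where
  "line_mean \<gamma> \<omega> g z = integral {0..1} (\<lambda>s. g (z + s *\<^sub>R \<gamma>) * cnj (wave \<omega> (s *\<^sub>R \<gamma>)))"

lemma continuous_line_mean_integrand:
  assumes "continuous_on UNIV g"
  shows "continuous_on A (\<lambda>s. g (z + s *\<^sub>R \<gamma>) * cnj (wave \<omega> (s *\<^sub>R \<gamma>)))"
  by (intro continuous_intros continuous_on_compose2[OF assms]) auto

lemma continuous_line_mean:
  assumes "continuous_on UNIV g"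
  shows "continuous_on UNIV (line_mean \<gamma> \<omega> g)"
  unfolding line_mean_def interval_cbox
  by (rule integral_continuous_on_param, unfold split_beta)
     (intro continuous_intros continuous_on_compose2[OF assms]; auto)

lemma line_mean_add:
  assumes "continuous_on UNIV g" "continuous_on UNIV h"
  shows "line_mean \<gamma> \<omega> (\<lambda>z. g z + h z) z = line_mean \<gamma> \<omega> g z + line_mean \<gamma> \<omega> h z"
  unfolding line_mean_def distrib_right
  by (intro Henstock_Kurzweil_Integration.integral_add integrable_continuous_real continuous_line_mean_integrand assms)

lemma line_mean_cmult: "line_mean \<gamma> \<omega> (\<lambda>z. c * g z) z = c * line_mean \<gamma> \<omega> g z"
  unfolding line_mean_def by (simp add: mult.assoc)

lemma line_mean_translate:
  assumes "\<And>z. g (z + \<delta>) = g z"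
  shows "line_mean \<gamma> \<omega> g (z + \<delta>) = line_mean \<gamma> \<omega> g z"
  unfolding line_mean_def using assms[of "z + s *\<^sub>R \<gamma>" for s] by (simp add: add_ac)

text \<open>Moving the base point along \<open>\<gamma>\<close> shifts the integration variable over
  a full period; only the character leaves a factor.\<close>

lemma line_mean_shift:
  assumes "continuous_on UNIV g" "\<And>z. g (z + \<gamma>) = g z" "wave \<omega> \<gamma> = 1"
  shows "line_mean \<gamma> \<omega> g (z + t *\<^sub>R \<gamma>) = wave \<omega> (t *\<^sub>R \<gamma>) * line_mean \<gamma> \<omega> g z"
proof -
  define \<phi> where "\<phi> s = g (z + s *\<^sub>R \<gamma>) * cnj (wave \<omega> (s *\<^sub>R \<gamma>))" for s
  have "\<phi> (s + 1) = \<phi> s" for s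
    using assms(2)[of "z + s *\<^sub>R \<gamma>"] assms(3) by (simp add: \<phi>_def scaleR_add_left wave_add_arg add_ac)
  then have "integral {0..1} (\<lambda>s. \<phi> (s + t)) = integral {0..1} \<phi>"
    by (intro integral_periodic_shift) (simp_all add: \<phi>_def[abs_def] continuous_line_mean_integrand assms(1))
  moreover have "g (z + t *\<^sub>R \<gamma> + s *\<^sub>R \<gamma>) * cnj (wave \<omega> (s *\<^sub>R \<gamma>)) = wave \<omega> (t *\<^sub>R \<gamma>) * \<phi> (s + t)" for s
  proof -
    have "wave \<omega> (t *\<^sub>R \<gamma>) * cnj (wave \<omega> (t *\<^sub>R \<gamma>)) = 1"
      using complex_norm_square[of "wave \<omega> (t *\<^sub>R \<gamma>)"] by simp
    moreover have "wave \<omega> (t *\<^sub>R \<gamma>) * \<phi> (s + t) = g (z + t *\<^sub>R \<gamma> + s *\<^sub>R \<gamma>) * cnj (wave \<omega> (s *\<^sub>R \<gamma>)) * (wave \<omega> (t *\<^sub>R \<gamma>) * cnj (wave \<omega> (t *\<^sub>R \<gamma>)))"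
      by (simp add: \<phi>_def scaleR_add_left wave_add_arg add_ac mult_ac)
    ultimately show ?thesis by simp
  qed
  ultimately show ?thesis
    unfolding line_mean_def \<phi>_def[abs_def, symmetric] by simp
qed

lemma line_mean_directional_derivative:
  assumes "continuous_on UNIV g" "continuous_on UNIV g'"
    and "\<And>z t. ((\<lambda>t. g (z + t *\<^sub>R v)) has_vector_derivative g' (z + t *\<^sub>R v)) (at t)"
  shows "((\<lambda>t. line_mean \<gamma> \<omega> g (z + t *\<^sub>R v)) has_vector_derivative line_mean \<gamma> \<omega> g' (z + t *\<^sub>R v)) (at t)"
proof -
  have "((\<lambda>t. integral (cbox 0 1) (\<lambda>s. g (z + t *\<^sub>R v + s *\<^sub>R \<gamma>) * cnj (wave \<omega> (s *\<^sub>R \<gamma>)))) has_vector_derivative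
      integral (cbox 0 1) ((\<lambda>t s. g' (z + t *\<^sub>R v + s *\<^sub>R \<gamma>) * cnj (wave \<omega> (s *\<^sub>R \<gamma>))) t)) (at t within UNIV)"
  proof (rule leibniz_rule_vector_derivative)
    fix t s :: real
    have "((\<lambda>t. g ((z + s *\<^sub>R \<gamma>) + t *\<^sub>R v)) has_vector_derivative g' ((z + s *\<^sub>R \<gamma>) + t *\<^sub>R v)) (at t)"
      by (rule assms)
    then show "((\<lambda>t. g (z + t *\<^sub>R v + s *\<^sub>R \<gamma>) * cnj (wave \<omega> (s *\<^sub>R \<gamma>))) has_vector_derivative
        g' (z + t *\<^sub>R v + s *\<^sub>R \<gamma>) * cnj (wave \<omega> (s *\<^sub>R \<gamma>))) (at t within UNIV)"
      by (intro has_vector_derivative_mult_left) (simp add: add_ac)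
  next
    show "(\<lambda>s. g (z + t *\<^sub>R v + s *\<^sub>R \<gamma>) * cnj (wave \<omega> (s *\<^sub>R \<gamma>))) integrable_on cbox 0 1" for t
      by (intro integrable_continuous continuous_line_mean_integrand assms(1))
    show "continuous_on (UNIV \<times> cbox 0 1) (\<lambda>(t, s). g' (z + t *\<^sub>R v + s *\<^sub>R \<gamma>) * cnj (wave \<omega> (s *\<^sub>R \<gamma>)))"
      unfolding split_beta by (intro continuous_intros continuous_on_compose2[OF assms(2)]) auto
  qed auto
  then show ?thesis unfolding line_mean_def by simp
qed

lemma line_mean_wave:
  assumes "wave \<nu> \<gamma> = 1" "wave \<omega> \<gamma> = 1"
  shows "line_mean \<gamma> \<omega> (wave \<nu>) z = (if \<nu> \<bullet> \<gamma> = \<omega> \<bullet> \<gamma> then wave \<nu> z else 0)"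
proof -
  define a where "a = (\<nu> - \<omega>) \<bullet> \<gamma>"
  have eq: "wave \<nu> (z + s *\<^sub>R \<gamma>) * cnj (wave \<omega> (s *\<^sub>R \<gamma>)) = wave \<nu> z * wave (\<nu> - \<omega>) (s *\<^sub>R \<gamma>)" for s
    by (simp add: wave_add_arg wave_diff_freq)
  have 1: "wave (\<nu> - \<omega>) \<gamma> = 1" using assms by (simp add: wave_diff_freq)
  have "integral {0..1} (\<lambda>s. wave (\<nu> - \<omega>) (s *\<^sub>R \<gamma>)) = (if a = 0 then 1 else 0)"
  proof (cases "a = 0")
    case True
    then show ?thesis by (simp add: wave_scaleR a_def)
  next
    case False
    have "((\<lambda>s. wave (\<nu> - \<omega>) (s *\<^sub>R \<gamma>)) has_integral
        (wave (\<nu> - \<omega>) (1 *\<^sub>R \<gamma>) / (\<i> * a) - wave (\<nu> - \<omega>) (0 *\<^sub>R \<gamma>) / (\<i> * a))) {0..1}"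
    proof (rule fundamental_theorem_of_calculus)
      fix s :: real
      have "((\<lambda>s. wave (\<nu> - \<omega>) (s *\<^sub>R \<gamma>) / (\<i> * a)) has_vector_derivative (\<i> * a * wave (\<nu> - \<omega>) (s *\<^sub>R \<gamma>)) / (\<i> * a)) (at s)"
        unfolding a_def by (intro has_vector_derivative_divide wave_line_derivative)
      then show "((\<lambda>s. wave (\<nu> - \<omega>) (s *\<^sub>R \<gamma>) / (\<i> * a)) has_vector_derivative wave (\<nu> - \<omega>) (s *\<^sub>R \<gamma>)) (at s within {0..1})"
        using False by (simp add: has_vector_derivative_at_within)
    qed simp
    then show ?thesis using False 1 by (simp add: integral_unique)
  qed
  then show ?thesis
    unfolding line_mean_def eq by (simp add: a_def inner_diff_left)
qed

text \<open>On the line through \<open>z\<close> in direction \<open>\<gamma>\<close> this is the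
  uniqueness theorem in one variable. The mean depends on \<open>\<omega>\<close> only through
  \<open>\<omega> \<bullet> \<gamma>\<close>, so one representative per integer is enough.\<close>

lemma line_mean_complete:
  assumes "continuous_on UNIV h" "\<And>z. h (z + \<gamma>) = h z"
    and "\<And>n::int. \<exists>\<omega>. \<omega> \<bullet> \<gamma> = 2 * pi * n \<and> line_mean \<gamma> \<omega> h z = 0"
  shows "h z = 0"
proof -
  define \<phi> where "\<phi> s = h (z + s *\<^sub>R \<gamma>)" for s :: real
  have "integral {0..1} (\<lambda>s. \<phi> s * cis (2 * pi * of_int k * s)) = 0" for k :: int
  proof -
    obtain \<omega> where "\<omega> \<bullet> \<gamma> = 2 * pi * (- k)" "line_mean \<gamma> \<omega> h z = 0" using assms(3)[of "- k"] by auto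
    then show ?thesis by (simp add: line_mean_def \<phi>_def wave_scaleR cis_cnj mult_ac)
  qed
  moreover have "continuous_on UNIV \<phi>"
    unfolding \<phi>_def by (intro continuous_intros continuous_on_compose2[OF assms(1)]) auto
  ultimately have "fourier_null \<phi>" by (simp add: fourier_null_def)
  moreover have "\<phi> (s + 1) = \<phi> s" for s
    using assms(2)[of "z + s *\<^sub>R \<gamma>"] by (simp add: \<phi>_def scaleR_add_left add_ac)
  ultimately have "\<phi> 0 = 0" by (rule fourier_null_imp_zero)
  then show ?thesis by (simp add: \<phi>_def)
qed

text \<open>The basis is a parameter because the theory is applied to the doubled lattice, for which
  the spinor is periodic.\<close>

locale torus =
  fixes \<gamma>1 \<gamma>2 :: complex
  assumes independent: "independent {\<gamma>1, \<gamma>2}" and distinct: "\<gamma>1 \<noteq> \<gamma>2"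
begin

definition freqs :: "complex set" where "freqs = dual_lattice (int_span \<gamma>1 \<gamma>2)"

definition torus_fun :: "(complex \<Rightarrow> complex) \<Rightarrow> bool" where
  "torus_fun g \<longleftrightarrow> continuous_on UNIV g \<and> (\<forall>z. g (z + \<gamma>1) = g z) \<and> (\<forall>z. g (z + \<gamma>2) = g z)"

definition fcoef :: "complex \<Rightarrow> (complex \<Rightarrow> complex) \<Rightarrow> complex" where
  "fcoef \<omega> g = line_mean \<gamma>2 \<omega> (line_mean \<gamma>1 \<omega> g) 0"

lemma mem_freqs_iff: "\<omega> \<in> freqs \<longleftrightarrow> (\<exists>k::int. \<exists>l::int. \<omega> \<bullet> \<gamma>1 = 2 * pi * k \<and> \<omega> \<bullet> \<gamma>2 = 2 * pi * l)"
proof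
  assume "\<omega> \<in> freqs"
  then show "\<exists>k::int. \<exists>l::int. \<omega> \<bullet> \<gamma>1 = 2 * pi * k \<and> \<omega> \<bullet> \<gamma>2 = 2 * pi * l"
    using generator_in_int_span[where a=\<gamma>1 and b=\<gamma>2] unfolding freqs_def dual_lattice_def by blast
next
  assume "\<exists>k::int. \<exists>l::int. \<omega> \<bullet> \<gamma>1 = 2 * pi * k \<and> \<omega> \<bullet> \<gamma>2 = 2 * pi * l"
  then obtain k l :: int where kl: "\<omega> \<bullet> \<gamma>1 = 2 * pi * k" "\<omega> \<bullet> \<gamma>2 = 2 * pi * l" by blast
  have "\<exists>j::int. \<omega> \<bullet> \<gamma> = 2 * pi * j" if "\<gamma> \<in> int_span \<gamma>1 \<gamma>2" for \<gamma>
  proof -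
    obtain m n :: int where "\<gamma> = of_int m * \<gamma>1 + of_int n * \<gamma>2" using \<open>\<gamma> \<in> _\<close> unfolding int_span_def by blast
    then have "\<gamma> = real_of_int m *\<^sub>R \<gamma>1 + real_of_int n *\<^sub>R \<gamma>2" by (simp add: scaleR_conv_of_real)
    then have "\<omega> \<bullet> \<gamma> = 2 * pi * of_int (m * k + n * l)"
      by (simp add: inner_add_right kl algebra_simps)
    then show ?thesis by blast
  qed
  then show "\<omega> \<in> freqs" unfolding freqs_def dual_lattice_def by blast
qed

lemma wave_period: "\<omega> \<in> freqs \<Longrightarrow> wave \<omega> \<gamma>1 = 1" "\<omega> \<in> freqs \<Longrightarrow> wave \<omega> \<gamma>2 = 1"
  unfolding freqs_def by (auto intro!: wave_dual generator_in_int_span)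

lemma zero_freq: "0 \<in> freqs"
  by (auto simp: mem_freqs_iff intro: exI[of _ 0])

lemma freqs_closed:
  assumes "\<omega> \<in> freqs" "\<nu> \<in> freqs"
  shows "\<omega> + \<nu> \<in> freqs" "- \<omega> \<in> freqs"
proof -
  obtain k l k' l' :: int where "\<omega> \<bullet> \<gamma>1 = 2 * pi * k" "\<omega> \<bullet> \<gamma>2 = 2 * pi * l" "\<nu> \<bullet> \<gamma>1 = 2 * pi * k'" "\<nu> \<bullet> \<gamma>2 = 2 * pi * l'"
    using assms unfolding mem_freqs_iff by blast
  then have "(\<omega> + \<nu>) \<bullet> \<gamma>1 = 2 * pi * of_int (k + k')" "(\<omega> + \<nu>) \<bullet> \<gamma>2 = 2 * pi * of_int (l + l')"
    "(- \<omega>) \<bullet> \<gamma>1 = 2 * pi * of_int (- k)" "(- \<omega>) \<bullet> \<gamma>2 = 2 * pi * of_int (- l)"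
    by (simp_all add: inner_add_left algebra_simps)
  then show "\<omega> + \<nu> \<in> freqs" "- \<omega> \<in> freqs" unfolding mem_freqs_iff by blast+
qed

lemma torus_fun_wave: "\<omega> \<in> freqs \<Longrightarrow> torus_fun (wave \<omega>)"
  unfolding torus_fun_def by (auto simp: wave_add_arg wave_period intro!: continuous_intros)

lemma torus_fun_add: "torus_fun g \<Longrightarrow> torus_fun h \<Longrightarrow> torus_fun (\<lambda>z. g z + h z)"
  and torus_fun_mult: "torus_fun g \<Longrightarrow> torus_fun h \<Longrightarrow> torus_fun (\<lambda>z. g z * h z)"
  and torus_fun_const: "torus_fun (\<lambda>z. c)"
  unfolding torus_fun_def by (auto intro!: continuous_intros)

lemma torus_fun_sum: "(\<And>i. i \<in> I \<Longrightarrow> torus_fun (g i)) \<Longrightarrow> torus_fun (\<lambda>z. \<Sum>i\<in>I. g i z)"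
  by (induction I rule: infinite_finite_induct) (auto intro: torus_fun_add torus_fun_const)

lemma inner_eq_imp_eq:
  assumes "\<nu> \<bullet> \<gamma>1 = \<omega> \<bullet> \<gamma>1" "\<nu> \<bullet> \<gamma>2 = \<omega> \<bullet> \<gamma>2"
  shows "\<nu> = \<omega>"
proof -
  obtain s t where st: "\<nu> - \<omega> = s *\<^sub>R \<gamma>1 + t *\<^sub>R \<gamma>2" using independent_pair_coords[OF independent distinct] .
  have "(\<nu> - \<omega>) \<bullet> (\<nu> - \<omega>) = s * ((\<nu> - \<omega>) \<bullet> \<gamma>1) + t * ((\<nu> - \<omega>) \<bullet> \<gamma>2)"
    by (subst (2) st) (simp add: inner_add_right)
  also have "\<dots> = 0" using assms by (simp add: inner_diff_left)
  finally show ?thesis by simp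
qed

lemma fcoef_add:
  assumes "torus_fun g" "torus_fun h"
  shows "fcoef \<omega> (\<lambda>z. g z + h z) = fcoef \<omega> g + fcoef \<omega> h"
proof -
  have c: "continuous_on UNIV g" "continuous_on UNIV h" using assms by (auto simp: torus_fun_def)
  have "line_mean \<gamma>1 \<omega> (\<lambda>z. g z + h z) = (\<lambda>z. line_mean \<gamma>1 \<omega> g z + line_mean \<gamma>1 \<omega> h z)"
    by (rule ext) (rule line_mean_add[OF c])
  then show ?thesis
    unfolding fcoef_def by (simp add: line_mean_add continuous_line_mean c)
qed

lemma fcoef_cmult: "fcoef \<omega> (\<lambda>z. c * g z) = c * fcoef \<omega> g"
proof -
  have "line_mean \<gamma>1 \<omega> (\<lambda>z. c * g z) = (\<lambda>z. c * line_mean \<gamma>1 \<omega> g z)"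
    by (rule ext) (rule line_mean_cmult)
  then show ?thesis unfolding fcoef_def by (simp add: line_mean_cmult)
qed

lemma fcoef_sum:
  "(\<And>i. i \<in> I \<Longrightarrow> torus_fun (g i)) \<Longrightarrow> fcoef \<omega> (\<lambda>z. \<Sum>i\<in>I. g i z) = (\<Sum>i\<in>I. fcoef \<omega> (g i))"
proof (induction I rule: infinite_finite_induct)
  case (insert i I)
  then show ?case by (simp add: fcoef_add torus_fun_sum)
qed (simp_all add: fcoef_def line_mean_def)

lemma fcoef_wave:
  assumes "\<nu> \<in> freqs" "\<omega> \<in> freqs"
  shows "fcoef \<omega> (wave \<nu>) = (if \<nu> = \<omega> then 1 else 0)"
proof -
  have "line_mean \<gamma>1 \<omega> (wave \<nu>) = (\<lambda>z. (if \<nu> \<bullet> \<gamma>1 = \<omega> \<bullet> \<gamma>1 then 1 else 0) * wave \<nu> z)"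
    by (auto simp: line_mean_wave wave_period assms)
  then show ?thesis
    unfolding fcoef_def
    by (auto simp: line_mean_cmult line_mean_wave wave_period assms dest: inner_eq_imp_eq)
qed

text \<open>The first mean transforms like the wave along \<open>\<gamma>1\<close> and the second
  along \<open>\<gamma>2\<close>. These directions span the plane, so the double mean is a multiple
  of the wave, fixed by its value at 0.\<close>

lemma line_mean_line_mean:
  assumes g: "torus_fun g" and \<omega>: "\<omega> \<in> freqs"
  shows "line_mean \<gamma>2 \<omega> (line_mean \<gamma>1 \<omega> g) z = fcoef \<omega> g * wave \<omega> z"
proof -
  define h where "h = line_mean \<gamma>1 \<omega> g"
  have cg: "continuous_on UNIV g" and per: "\<And>z. g (z + \<gamma>1) = g z" "\<And>z. g (z + \<gamma>2) = g z"
    using g by (auto simp: torus_fun_def)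
  have h: "continuous_on UNIV h" "\<And>z. h (z + \<gamma>2) = h z"
    "\<And>z t. h (z + t *\<^sub>R \<gamma>1) = wave \<omega> (t *\<^sub>R \<gamma>1) * h z"
    unfolding h_def by (auto intro!: continuous_line_mean line_mean_translate line_mean_shift cg per wave_period \<omega>)
  obtain s t where z: "z = s *\<^sub>R \<gamma>1 + t *\<^sub>R \<gamma>2" using independent_pair_coords[OF independent distinct] .
  have "line_mean \<gamma>2 \<omega> h (s *\<^sub>R \<gamma>1 + t *\<^sub>R \<gamma>2) = wave \<omega> (t *\<^sub>R \<gamma>2) * line_mean \<gamma>2 \<omega> h (s *\<^sub>R \<gamma>1)"
    by (rule line_mean_shift) (auto intro: h wave_period \<omega>)
  also have "line_mean \<gamma>2 \<omega> h (s *\<^sub>R \<gamma>1) = wave \<omega> (s *\<^sub>R \<gamma>1) * line_mean \<gamma>2 \<omega> h 0"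
  proof -
    have "h (s *\<^sub>R \<gamma>1 + r *\<^sub>R \<gamma>2) = wave \<omega> (s *\<^sub>R \<gamma>1) * h (0 + r *\<^sub>R \<gamma>2)" for r
      using h(3)[of "r *\<^sub>R \<gamma>2" s] by (simp add: add.commute)
    then show ?thesis unfolding line_mean_def by (simp add: mult.assoc)
  qed
  finally show ?thesis unfolding z h_def fcoef_def by (simp add: wave_add_arg mult_ac)
qed

text \<open>In place of integration by parts, the double mean is differentiated under the integral
  and compared with the derivative of the wave it is known to be.\<close>

lemma fcoef_directional_derivative:
  assumes g: "torus_fun g" and g': "torus_fun g'" and \<omega>: "\<omega> \<in> freqs"
    and der: "\<And>z t. ((\<lambda>t. g (z + t *\<^sub>R v)) has_vector_derivative g' (z + t *\<^sub>R v)) (at t)"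
  shows "fcoef \<omega> g' = \<i> * of_real (\<omega> \<bullet> v) * fcoef \<omega> g"
proof -
  have cg: "continuous_on UNIV g" "continuous_on UNIV g'" using g g' by (auto simp: torus_fun_def)
  have "((\<lambda>t. line_mean \<gamma>2 \<omega> (line_mean \<gamma>1 \<omega> g) (0 + t *\<^sub>R v)) has_vector_derivative
      line_mean \<gamma>2 \<omega> (line_mean \<gamma>1 \<omega> g') (0 + 0 *\<^sub>R v)) (at 0)"
    by (intro line_mean_directional_derivative continuous_line_mean cg der)
  then have 1: "((\<lambda>t. fcoef \<omega> g * wave \<omega> (t *\<^sub>R v)) has_vector_derivative fcoef \<omega> g') (at 0)"
    unfolding line_mean_line_mean[OF g \<omega>] line_mean_line_mean[OF g' \<omega>] by simp
  have "((\<lambda>t. fcoef \<omega> g * wave \<omega> (t *\<^sub>R v)) has_vector_derivative fcoef \<omega> g * (\<i> * of_real (\<omega> \<bullet> v) * wave \<omega> (0 *\<^sub>R v))) (at 0)"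
    by (intro has_vector_derivative_mult_right wave_line_derivative)
  from vector_derivative_unique_at[OF 1 this] show ?thesis
    by (simp add: mult_ac)
qed

text \<open>Multiplication by \<open>\<i>\<close> is a quarter turn, so
  \<open>\<i> * \<gamma>2\<close> is orthogonal to \<open>\<gamma>2\<close>, and likewise for
  \<open>\<gamma>1\<close>; \<open>D\<close> is the signed area that normalizes both.\<close>

lemma dual_basis:
  obtains d1 d2 where "d1 \<bullet> \<gamma>1 = 2 * pi" "d1 \<bullet> \<gamma>2 = 0" "d2 \<bullet> \<gamma>1 = 0" "d2 \<bullet> \<gamma>2 = 2 * pi"
proof -
  define D where "D = (\<i> * \<gamma>2) \<bullet> \<gamma>1"
  have "D \<noteq> 0"
  proof
    assume "D = 0"
    then have "(\<i> * \<gamma>2) \<bullet> \<gamma>1 = 0 \<bullet> \<gamma>1" "(\<i> * \<gamma>2) \<bullet> \<gamma>2 = 0 \<bullet> \<gamma>2"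
      by (simp_all add: D_def inner_complex_def)
    then have "\<i> * \<gamma>2 = 0" by (rule inner_eq_imp_eq)
    then show False using independent dependent_zero[of "{\<gamma>1, \<gamma>2}"] by auto
  qed
  moreover have "(\<i> * \<gamma>1) \<bullet> \<gamma>2 = - D" "(\<i> * \<gamma>1) \<bullet> \<gamma>1 = 0" "(\<i> * \<gamma>2) \<bullet> \<gamma>2 = 0"
    by (simp_all add: D_def inner_complex_def)
  ultimately show thesis
    by (intro that[of "(2 * pi / D) *\<^sub>R (\<i> * \<gamma>2)" "(- 2 * pi / D) *\<^sub>R (\<i> * \<gamma>1)"]) (simp_all flip: D_def)
qed

text \<open>The one-variable theorem is used twice: along \<open>\<gamma>2\<close> it kills every
  mean along \<open>\<gamma>1\<close>, and along \<open>\<gamma>1\<close> it then kills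
  \<open>g\<close>.\<close>

lemma fcoef_complete:
  assumes g: "torus_fun g" and zero: "\<And>\<omega>. \<omega> \<in> freqs \<Longrightarrow> fcoef \<omega> g = 0"
  shows "g z = 0"
proof -
  obtain d1 d2 where d: "d1 \<bullet> \<gamma>1 = 2 * pi" "d1 \<bullet> \<gamma>2 = 0" "d2 \<bullet> \<gamma>1 = 0" "d2 \<bullet> \<gamma>2 = 2 * pi"
    by (rule dual_basis)
  have cg: "continuous_on UNIV g" and per: "\<And>z. g (z + \<gamma>1) = g z" "\<And>z. g (z + \<gamma>2) = g z"
    using g by (auto simp: torus_fun_def)
  have "line_mean \<gamma>1 (real_of_int k *\<^sub>R d1) g z = 0" for k :: int and z
  proof (rule line_mean_complete[where \<gamma>=\<gamma>2 and h="line_mean \<gamma>1 (real_of_int k *\<^sub>R d1) g"])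
    fix l :: int
    define \<omega> where "\<omega> = real_of_int k *\<^sub>R d1 + real_of_int l *\<^sub>R d2"
    have \<omega>: "\<omega> \<bullet> \<gamma>1 = 2 * pi * k" "\<omega> \<bullet> \<gamma>2 = 2 * pi * l"
      by (simp_all add: \<omega>_def inner_add_left d)
    then have "\<omega> \<in> freqs" unfolding mem_freqs_iff by blast
    then have "line_mean \<gamma>2 \<omega> (line_mean \<gamma>1 \<omega> g) z = 0"
      by (simp add: line_mean_line_mean g zero)
    \<comment> \<open>Adding a multiple of \<open>d2\<close> to the frequency leaves its inner
      product with \<open>\<gamma>1\<close> unchanged.\<close>
    moreover have "line_mean \<gamma>1 \<omega> g = line_mean \<gamma>1 (real_of_int k *\<^sub>R d1) g"
      unfolding line_mean_def wave_scaleR by (simp add: \<omega> d mult_ac)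
    ultimately show "\<exists>\<omega>. \<omega> \<bullet> \<gamma>2 = 2 * pi * l \<and> line_mean \<gamma>2 \<omega> (line_mean \<gamma>1 (real_of_int k *\<^sub>R d1) g) z = 0"
      using \<omega>(2) by metis
  qed (auto intro!: continuous_line_mean line_mean_translate cg per)
  then show ?thesis
    by (intro line_mean_complete[where \<gamma>=\<gamma>1 and h=g] cg per exI[of _ "real_of_int n *\<^sub>R d1" for n]) (simp add: d)
qed

text \<open>The difference between \<open>g\<close> and the finite sum has all coefficients zero, so
  it vanishes by completeness.\<close>

lemma fourier_expansion:
  assumes g: "torus_fun g" and S: "finite S" "S \<subseteq> freqs"
    and zero: "\<And>\<omega>. \<omega> \<in> freqs - S \<Longrightarrow> fcoef \<omega> g = 0"
  shows "g z = (\<Sum>\<omega>\<in>S. fcoef \<omega> g * wave \<omega> z)"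
proof -
  define h where "h z = (\<Sum>\<omega>\<in>S. fcoef \<omega> g * wave \<omega> z)" for z
  have tw: "torus_fun (\<lambda>z. c * wave \<omega> z)" if "\<omega> \<in> S" for \<omega> c
    using that S(2) by (intro torus_fun_mult torus_fun_const torus_fun_wave) auto
  then have h: "torus_fun h" unfolding h_def by (rule torus_fun_sum)
  have "fcoef \<omega> h = fcoef \<omega> g" if "\<omega> \<in> freqs" for \<omega>
  proof -
    have "fcoef \<omega> h = (\<Sum>\<nu>\<in>S. fcoef \<nu> g * (if \<nu> = \<omega> then 1 else 0))"
      unfolding h_def using S(2) that
      by (subst fcoef_sum[OF tw]) (auto simp: fcoef_cmult fcoef_wave intro!: sum.cong)
    also have "\<dots> = (if \<omega> \<in> S then fcoef \<omega> g else 0)" using S(1) by (simp add: if_distrib cong: if_cong)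
    also have "\<dots> = fcoef \<omega> g" using zero that by auto
    finally show ?thesis .
  qed
  then have *: "fcoef \<omega> (\<lambda>z. g z + (- 1) * h z) = 0" if "\<omega> \<in> freqs" for \<omega>
    using that by (simp only: fcoef_add[OF g torus_fun_mult[OF torus_fun_const h]] fcoef_cmult) simp
  have "torus_fun (\<lambda>z. g z + (- 1) * h z)"
    by (intro torus_fun_add torus_fun_mult torus_fun_const g h)
  from fcoef_complete[OF this *] have "g z + (- 1) * h z = 0" .
  then show ?thesis by (simp add: h_def)
qed

text \<open>Only opposite frequencies multiply to a constant. This expresses the vanishing periods
  of a surface as quadratic equations between coefficients.\<close>

lemma fcoef_0_product:
  assumes S: "finite S" "S \<subseteq> freqs" "\<And>\<omega>. \<omega> \<in> S \<Longrightarrow> - \<omega> \<in> S"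
    and g: "\<And>z. g z = (\<Sum>\<omega>\<in>S. a \<omega> * wave \<omega> z)" and h: "\<And>z. h z = (\<Sum>\<omega>\<in>S. b \<omega> * wave \<omega> z)"
  shows "fcoef 0 (\<lambda>z. g z * h z) = (\<Sum>\<omega>\<in>S. a \<omega> * b (- \<omega>))"
proof -
  have eq: "g z * h z = (\<Sum>\<omega>\<in>S. \<Sum>\<nu>\<in>S. (a \<omega> * b \<nu>) * wave (\<omega> + \<nu>) z)" for z
    unfolding g h sum_product wave_add_freq by (simp add: mult_ac)
  have tw: "torus_fun (\<lambda>z. c * wave (\<omega> + \<nu>) z)" if "\<omega> \<in> S" "\<nu> \<in> S" for \<omega> \<nu> c
    using that S(2) by (intro torus_fun_mult torus_fun_const torus_fun_wave freqs_closed) auto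
  have "fcoef 0 (\<lambda>z. g z * h z) = (\<Sum>\<omega>\<in>S. \<Sum>\<nu>\<in>S. (a \<omega> * b \<nu>) * fcoef 0 (wave (\<omega> + \<nu>)))"
    unfolding eq by (subst fcoef_sum) (auto intro!: torus_fun_sum tw sum.cong simp: fcoef_sum tw fcoef_cmult)
  also have "\<dots> = (\<Sum>\<omega>\<in>S. \<Sum>\<nu>\<in>S. if \<nu> = - \<omega> then a \<omega> * b (- \<omega>) else 0)"
    using S(2) by (intro sum.cong refl) (auto simp: fcoef_wave freqs_closed zero_freq subset_iff add_eq_0_iff)
  also have "\<dots> = (\<Sum>\<omega>\<in>S. a \<omega> * b (- \<omega>))"
    using S by (intro sum.cong refl) simp
  finally show ?thesis .
qed

end

subsection \<open>The spinor of a Dirac torus\<close>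

definition horizontal :: "real^3 \<Rightarrow> complex" where
  "horizontal x = Complex (x $ 1) (x $ 2)"

lemma bounded_linear_horizontal: "bounded_linear horizontal"
proof -
  have "horizontal = (\<lambda>x. of_real (x $ 1) + \<i> * of_real (x $ 2))"
    by (simp add: fun_eq_iff horizontal_def complex_eq_iff)
  moreover have "bounded_linear (\<lambda>x :: real^3. complex_of_real (x $ 1) + \<i> * of_real (x $ 2))"
    by (intro bounded_linear_add bounded_linear_const_mult bounded_linear_compose[OF bounded_linear_of_real] bounded_linear_vec_nth)
  ultimately show ?thesis by simp
qed

lemmas horizontal_linear = linear_add[OF bounded_linear.linear[OF bounded_linear_horizontal]]
  linear_scale[OF bounded_linear.linear[OF bounded_linear_horizontal]]

lemma vec3_horizontal: "vec3 (horizontal x) (x $ 3) = x"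
  by (simp add: vec_eq_iff forall_3 horizontal_def)

lemma horizontal_vec3 [simp]: "horizontal (vec3 c t) = c"
  by (simp add: horizontal_def)

lemma continuous_square_const:
  fixes s :: "complex \<Rightarrow> real"
  assumes "continuous_on UNIV s" "\<And>z. (s z)\<^sup>2 = c"
  shows "s z = s w"
proof -
  have "\<bar>s z\<bar> = sqrt c" for z by (metis assms(2) real_sqrt_abs)
  then have "s ` UNIV \<subseteq> {sqrt c, - sqrt c}" by (auto simp: abs_if split: if_splits) (metis minus_minus)
  then have "finite (s ` UNIV)" by (rule finite_subset) simp
  then have "s constant_on UNIV"
    by (intro continuous_finite_range_constant assms(1) connected_UNIV)
  then show ?thesis by (auto simp: constant_on_def)
qed

text \<open>A vector orthogonal to \<open>x\<close> and \<open>y\<close> has zero cross product with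
  \<open>n\<close>; expanding \<open>cross3 n (cross3 u n)\<close> by Lagrange's formula solves for
  it.\<close>

lemma orthogonal_frame_component:
  fixes u x y n :: "real^3"
  assumes "u \<bullet> x = 0" "u \<bullet> y = 0" "cross3 x y = m *\<^sub>R n" "m \<noteq> 0" "n \<bullet> n = m\<^sup>2"
  shows "u = ((u \<bullet> n) / m\<^sup>2) *\<^sub>R n"
proof -
  have "cross3 u (m *\<^sub>R n) = 0"
    unfolding assms(3)[symmetric] Lagrange using assms(1,2) by simp
  then have "cross3 u n = 0" using assms(4) by (simp add: cross_mult_right)
  then have "0 = cross3 n (cross3 u n)" by simp
  also have "\<dots> = m\<^sup>2 *\<^sub>R u - (u \<bullet> n) *\<^sub>R n"
    unfolding Lagrange by (simp add: assms(5) inner_commute)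
  finally have "m\<^sup>2 *\<^sub>R u = (u \<bullet> n) *\<^sub>R n" by simp
  then have "(1 / m\<^sup>2) *\<^sub>R (m\<^sup>2 *\<^sub>R u) = (1 / m\<^sup>2) *\<^sub>R ((u \<bullet> n) *\<^sub>R n)" by simp
  then show ?thesis using assms(4) by simp
qed

text \<open>Differentiating the two conformality relations gives tangential components that cancel
  in pairs once the mixed derivatives of \<open>f\<close> are identified.\<close>

lemma conformal_laplace_tangential:
  assumes f: "smooth f" and conf: "\<And>z. \<exists>\<rho>>0. \<forall>v w. first_ff f z v w = \<rho> * (v \<bullet> w)"
  shows "laplace f z \<bullet> dir_deriv 1 f z = 0" "laplace f z \<bullet> dir_deriv \<i> f z = 0"
proof -
  let ?X = "dir_deriv 1 f" and ?Y = "dir_deriv \<i> f"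
  have eq: "?X z \<bullet> ?X z = ?Y z \<bullet> ?Y z" "?X z \<bullet> ?Y z = 0" for z
    using conf[of z] by (auto simp: first_ff_def)
  have d: "(dir_deriv w f has_derivative (\<lambda>v. dir_deriv v (dir_deriv w f) z)) (at z)" for w z
    by (intro smooth_has_derivative smooth_dir_deriv f)
  have comm: "dir_deriv \<i> ?X z = dir_deriv 1 ?Y z" by (rule dir_deriv_commute[OF f])
  have "((\<lambda>z. ?X z \<bullet> ?X z - ?Y z \<bullet> ?Y z) has_derivative
      (\<lambda>v. (?X z \<bullet> dir_deriv v ?X z + dir_deriv v ?X z \<bullet> ?X z) - (?Y z \<bullet> dir_deriv v ?Y z + dir_deriv v ?Y z \<bullet> ?Y z))) (at z)"
    by (intro derivative_intros d)
  moreover have "((\<lambda>z. ?X z \<bullet> ?X z - ?Y z \<bullet> ?Y z) has_derivative (\<lambda>v. 0)) (at z)" by (simp add: eq)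
  ultimately have 1: "(\<lambda>v. (?X z \<bullet> dir_deriv v ?X z + dir_deriv v ?X z \<bullet> ?X z) - (?Y z \<bullet> dir_deriv v ?Y z + dir_deriv v ?Y z \<bullet> ?Y z)) = (\<lambda>v. 0)"
    by (rule has_derivative_unique)
  have "((\<lambda>z. ?X z \<bullet> ?Y z) has_derivative (\<lambda>v. ?X z \<bullet> dir_deriv v ?Y z + dir_deriv v ?X z \<bullet> ?Y z)) (at z)"
    by (intro derivative_intros d)
  moreover have "((\<lambda>z. ?X z \<bullet> ?Y z) has_derivative (\<lambda>v. 0)) (at z)" by (simp add: eq)
  ultimately have 2: "(\<lambda>v. ?X z \<bullet> dir_deriv v ?Y z + dir_deriv v ?X z \<bullet> ?Y z) = (\<lambda>v. 0)"
    by (rule has_derivative_unique)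
  show "laplace f z \<bullet> ?X z = 0" "laplace f z \<bullet> ?Y z = 0"
    using fun_cong[OF 1, of 1] fun_cong[OF 1, of \<i>] fun_cong[OF 2, of 1] fun_cong[OF 2, of \<i>]
    by (simp_all add: laplace_def comm inner_add_left inner_add_right inner_commute)
qed

text \<open>The Weierstrass representation in reverse. Squares and product of the spinor components
  are first derivatives of \<open>f\<close>, so second derivatives of \<open>f\<close> become first
  derivatives of the spinor, and the equation for the mean curvature becomes linear.\<close>

lemma dirac_torus_spinor:
  assumes ind: "independent {a, b}" "a \<noteq> b" and dirac: "dirac_torus (int_span a b) f"
  obtains p q :: "complex \<Rightarrow> complex" and p' q' :: "complex \<Rightarrow> complex \<Rightarrow> complex" and \<kappa> :: real where
    "\<And>z v. dir_deriv v f z = vec3 ((p z)\<^sup>2 * v - (q z)\<^sup>2 * cnj v) (2 * Re (p z * cnj (q z) * v))"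
    "continuous_on UNIV p" "continuous_on UNIV q"
    "\<And>z. (p has_derivative p' z) (at z)" "\<And>z. (q has_derivative q' z) (at z)"
    "\<And>v. continuous_on UNIV (\<lambda>z. p' z v)" "\<And>v. continuous_on UNIV (\<lambda>z. q' z v)"
    "\<And>z. p' z 1 + \<i> * p' z \<i> = - 2 * complex_of_real \<kappa> * q z" "\<And>z. q' z 1 - \<i> * q' z \<i> = 2 * complex_of_real \<kappa> * p z"
    "\<And>z. p z \<noteq> 0 \<or> q z \<noteq> 0" "\<kappa> \<noteq> 0"
proof -
  have f: "smooth f" and per: "\<And>z \<gamma>. \<gamma> \<in> int_span a b \<Longrightarrow> f (z + \<gamma>) = f z"
    and conf: "\<And>z. \<exists>\<rho>>0. \<forall>v w. first_ff f z v w = \<rho> * (v \<bullet> w)"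
    and flat: "flat_metric (\<lambda>z v w. (mean_curvature f z)\<^sup>2 * first_ff f z v w)"
    using dirac by (auto simp: dirac_torus_def conformal_immersion_def)
  define X where "X = dir_deriv 1 f"
  define Y where "Y = dir_deriv \<i> f"
  \<comment> \<open>With \<open>F\<close> the horizontal part and \<open>t\<close> the height,
    \<open>A\<close>, \<open>- B\<close> and \<open>C\<close> are the derivatives by
    \<open>z\<close> of \<open>F\<close>, \<open>cnj F\<close> and \<open>t\<close>. Conformality
    then reads \<open>C\<^sup>2 = A * B\<close>.\<close>
  define A where "A z = (horizontal (X z) - \<i> * horizontal (Y z)) / 2" for z
  define B where "B z = - (cnj (horizontal (X z)) - \<i> * cnj (horizontal (Y z))) / 2" for z
  define C where "C z = (of_real (X z $ 3) - \<i> * of_real (Y z $ 3)) / 2" for z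
  define A' where "A' z v = (horizontal (dir_deriv v X z) - \<i> * horizontal (dir_deriv v Y z)) / 2" for z v
  define B' where "B' z v = - (cnj (horizontal (dir_deriv v X z)) - \<i> * cnj (horizontal (dir_deriv v Y z))) / 2" for z v
  define C' where "C' z v = (complex_of_real (dir_deriv v X z $ 3) - \<i> * of_real (dir_deriv v Y z $ 3)) / 2" for z v
  have sXY: "smooth X" "smooth Y" using f by (simp_all add: X_def Y_def smooth_dir_deriv)
  have dXY: "(X has_derivative (\<lambda>v. dir_deriv v X z)) (at z)" "(Y has_derivative (\<lambda>v. dir_deriv v Y z)) (at z)" for z
    using sXY by (simp_all add: smooth_has_derivative)
  have cXY: "continuous_on UNIV X" "continuous_on UNIV Y"
    "continuous_on UNIV (dir_deriv v X)" "continuous_on UNIV (dir_deriv v Y)" for v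
    using sXY by (simp_all add: smooth_continuous smooth_dir_deriv)
  note horiz_intros = bounded_linear.continuous_on[OF bounded_linear_horizontal]
     bounded_linear.has_derivative[OF bounded_linear_horizontal]
     bounded_linear.has_derivative[OF bounded_linear_vec_nth]
     bounded_linear.continuous_on[OF bounded_linear_vec_nth]
  have cABC: "continuous_on UNIV A" "continuous_on UNIV B" "continuous_on UNIV C"
    unfolding A_def B_def C_def by (intro continuous_intros horiz_intros cXY; simp)+
  have cABC': "continuous_on UNIV (\<lambda>z. A' z v)" "continuous_on UNIV (\<lambda>z. B' z v)" "continuous_on UNIV (\<lambda>z. C' z v)" for v
    unfolding A'_def B'_def C'_def by (intro continuous_intros horiz_intros cXY; simp)+
  have dA: "(A has_derivative A' z) (at z)" for z
    unfolding A_def A'_def divide_inverse by (intro derivative_intros horiz_intros dXY)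
  have dB: "(B has_derivative B' z) (at z)" for z
    unfolding B_def B'_def divide_inverse by (intro derivative_intros horiz_intros dXY)
  have dC: "(C has_derivative C' z) (at z)" for z
    unfolding C_def C'_def divide_inverse by (intro derivative_intros horiz_intros dXY)
  have eqXY: "X z \<bullet> X z = Y z \<bullet> Y z" "X z \<bullet> Y z = 0" "X z \<bullet> X z > 0" for z
  proof -
    obtain \<rho> where \<rho>: "\<rho> > 0" "\<And>v w. dir_deriv v f z \<bullet> dir_deriv w f z = \<rho> * (v \<bullet> w)"
      using conf[of z] by (auto simp: first_ff_def)
    then show "X z \<bullet> X z = Y z \<bullet> Y z" "X z \<bullet> Y z = 0" "X z \<bullet> X z > 0"
      by (simp_all only: X_def Y_def \<rho>) (simp_all add: inner_complex_def \<rho>(1))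
  qed
  have CAB: "(C z)\<^sup>2 = A z * B z" for z
    using eqXY(1,2)[of z]
    by (simp add: A_def B_def C_def horizontal_def complex_eq_iff inner_vec_def sum_3 power2_eq_square)
       (simp add: algebra_simps)
  have nzAB: "A z \<noteq> 0 \<or> B z \<noteq> 0" for z
  proof (rule ccontr)
    assume "\<not> ?thesis"
    then have AB: "A z = 0" "B z = 0" "C z = 0" using CAB[of z] by auto
    then have "X z $ 1 = 0" "X z $ 2 = 0" "X z $ 3 = 0"
      by (auto simp: A_def B_def C_def horizontal_def complex_eq_iff)
    then show False using eqXY(3)[of z] by (simp add: inner_vec_def sum_3)
  qed
  obtain p h where ph: "continuous_on UNIV p" "continuous_on UNIV h"
    "\<And>z. (p z)\<^sup>2 = A z" "\<And>z. (h z)\<^sup>2 = B z" "\<And>z. p z * h z = C z"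
    using isotropic_lift[OF cABC CAB nzAB] by metis
  have nz: "p z \<noteq> 0 \<or> h z \<noteq> 0" for z using nzAB[of z] ph(3,4)[of z] by auto
  obtain p' where p': "\<And>z. (p has_derivative p' z) (at z)" "\<And>v. continuous_on UNIV (\<lambda>z. p' z v)"
    using isotropic_lift_derivative[OF ph nz dA dB dC cABC'] by metis
  have "h z * p z = C z" "h z \<noteq> 0 \<or> p z \<noteq> 0" for z using ph(5)[of z] nz[of z] by (auto simp: mult.commute)
  then obtain h' where h': "\<And>z. (h has_derivative h' z) (at z)" "\<And>v. continuous_on UNIV (\<lambda>z. h' z v)"
    using isotropic_lift_derivative[OF ph(2,1,4,3) _ _ dB dA dC cABC'(2,1,3)] by metis
  \<comment> \<open>The derivative of the horizontal part by \<open>cnj z\<close> is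
    \<open>- cnj B\<close>, so its root requires the conjugate of \<open>h\<close>.\<close>
  define q where "q z = cnj (h z)" for z
  define m where "m z = (norm (p z))\<^sup>2 + (norm (q z))\<^sup>2" for z
  define n where "n z = vec3 (- 2 * p z * q z) ((norm (p z))\<^sup>2 - (norm (q z))\<^sup>2)" for z
  have q2: "(q z)\<^sup>2 = cnj (B z)" for z by (simp add: q_def flip: ph(4))
  have X: "X z = vec3 ((p z)\<^sup>2 - (q z)\<^sup>2) (2 * Re (p z * cnj (q z)))" for z
  proof -
    have "(p z)\<^sup>2 - (q z)\<^sup>2 = horizontal (X z)"
      unfolding ph(3) q2 by (simp add: A_def B_def field_simps)
    moreover have "2 * Re (p z * cnj (q z)) = X z $ 3"
      unfolding q_def complex_cnj_cnj ph(5) by (simp add: C_def)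
    ultimately show ?thesis by (simp add: vec3_horizontal)
  qed
  have Y: "Y z = vec3 (\<i> * ((p z)\<^sup>2 + (q z)\<^sup>2)) (- 2 * Im (p z * cnj (q z)))" for z
  proof -
    have "\<i> * ((p z)\<^sup>2 + (q z)\<^sup>2) = horizontal (Y z)"
      unfolding ph(3) q2 by (simp add: A_def B_def field_simps)
    moreover have "- 2 * Im (p z * cnj (q z)) = Y z $ 3"
      unfolding q_def complex_cnj_cnj ph(5) by (simp add: C_def)
    ultimately show ?thesis by (simp add: vec3_horizontal)
  qed
  note frame = spinor_frame[of "p z" "q z" for z, folded X Y m_def n_def]
  have m_pos: "m z > 0" for z
    using nz[of z] by (auto simp: m_def q_def add_pos_nonneg add_nonneg_pos)
  have nn: "n z \<bullet> n z = (m z)\<^sup>2" for z by (metis frame(5) power2_norm_eq_inner)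
  have ff: "first_ff f z v w = (m z)\<^sup>2 * (v \<bullet> w)" for z v w
  proof -
    obtain \<rho> where "\<And>v w. first_ff f z v w = \<rho> * (v \<bullet> w)" using conf[of z] by blast
    moreover from this[of 1 1] have "\<rho> = (m z)\<^sup>2" using frame(1)[of z] by (simp add: first_ff_def X_def)
    ultimately show ?thesis by simp
  qed
  have normal: "unit_normal f z = (1 / m z) *\<^sub>R n z" for z
    using m_pos[of z] unfolding unit_normal_def X_def[symmetric] Y_def[symmetric]
    by (simp add: frame sgn_scaleR) (simp add: sgn_div_norm frame divide_inverse)
  \<comment> \<open>The Laplacian of a conformal map is normal; its coefficient works out as
    \<open>2 * H * m\<close>.\<close>
  define \<sigma> where "\<sigma> z = (laplace f z \<bullet> n z) / (m z)\<^sup>2" for z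
  have lap: "laplace f z = \<sigma> z *\<^sub>R n z" for z
    unfolding \<sigma>_def
    by (rule orthogonal_frame_component[OF _ _ frame(4) _ nn])
       (use conformal_laplace_tangential[OF f conf] m_pos[of z] in \<open>auto simp: X_def Y_def\<close>)
  have H: "(mean_curvature f z)\<^sup>2 * (m z)\<^sup>2 = (\<sigma> z)\<^sup>2 / 4" for z
    using mean_curvature_conformal[of f z "(m z)\<^sup>2", OF ff] m_pos[of z]
    by (simp add: normal lap nn) (simp add: power2_eq_square field_simps)
  have "(\<lambda>z v w. (mean_curvature f z)\<^sup>2 * first_ff f z v w) = (\<lambda>z v w. ((\<sigma> z)\<^sup>2 / 4) * (v \<bullet> w))"
    unfolding H[symmetric] ff by (simp add: mult.assoc)
  with flat have flat': "flat_metric (\<lambda>z v w. ((\<sigma> z)\<^sup>2 / 4) * (v \<bullet> w))" by simp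
  have per_dd: "dir_deriv v g (z + \<gamma>) = dir_deriv v g z" 
    if "smooth g" "\<And>z. g (z + \<gamma>) = g z" for g :: "complex \<Rightarrow> real^3" and v z \<gamma>
  proof -
    have "((\<lambda>w. g (w + \<gamma>)) has_derivative (\<lambda>v. dir_deriv v g (z + \<gamma>))) (at z)"
      by (rule has_derivative_compose[OF _ smooth_has_derivative[OF that(1)]]) (auto intro!: derivative_eq_intros)
    then show ?thesis using dir_deriv_eq that(2) by fastforce
  qed
  have per_mc: "(mean_curvature f (z + \<gamma>))\<^sup>2 * (m (z + \<gamma>))\<^sup>2 = (mean_curvature f z)\<^sup>2 * (m z)\<^sup>2"
    if "\<gamma> \<in> int_span a b" for z \<gamma>
  proof -
    have d1: "dir_deriv v f (z + \<gamma>) = dir_deriv v f z" for v z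
      using per_dd[OF f per[OF that]] .
    have "dir_deriv v (dir_deriv w f) (z + \<gamma>) = dir_deriv v (dir_deriv w f) z" for v w
      using per_dd[OF smooth_dir_deriv[OF f] d1] .
    then have "mean_curvature f (z + \<gamma>) = mean_curvature f z"
      unfolding mean_curvature_def coeff_matrix_def first_ff_def second_ff_def unit_normal_def d1 by simp
    moreover have "(m (z + \<gamma>))\<^sup>2 = (m z)\<^sup>2"
      using frame(1) d1[of 1 z] unfolding X_def by metis
    ultimately show ?thesis by simp
  qed
  obtain c where c: "c > 0" "\<And>z. (\<sigma> z)\<^sup>2 / 4 = c"
    by (rule flat_conformal_metric_const[OF ind flat']) (use per_mc H in auto)
  have "continuous_on UNIV \<sigma>"
  proof -
    have "continuous_on UNIV (laplace f)"
      unfolding laplace_def by (intro continuous_intros smooth_continuous smooth_dir_deriv f)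
    moreover have "continuous_on UNIV m" "continuous_on UNIV q"
      unfolding m_def q_def by (intro continuous_intros ph)+
    moreover have "n z = (1 / m z) *\<^sub>R cross3 (X z) (Y z)" for z using m_pos[of z] by (simp add: frame)
    then have "n = (\<lambda>z. (1 / m z) *\<^sub>R cross3 (X z) (Y z))" by blast
    moreover have "continuous_on UNIV (\<lambda>z. (1 / m z) *\<^sub>R cross3 (X z) (Y z))"
      using m_pos by (intro continuous_intros continuous_on_cross cXY \<open>continuous_on UNIV m\<close>) (simp add: less_imp_neq[symmetric])
    ultimately show ?thesis
      unfolding \<sigma>_def using m_pos by (intro continuous_intros) (auto simp: less_imp_neq[symmetric])
  qed
  \<comment> \<open>Flatness controls only the square; continuity rules out a change of
    sign.\<close>
  then have \<sigma>_const: "\<sigma> z = \<sigma> 0" for z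
    by (rule continuous_square_const[where c="4 * c"]) (use c(2) in \<open>simp add: field_simps\<close>)
  define \<kappa> where "\<kappa> = \<sigma> 0 / 4"
  have "\<kappa> \<noteq> 0" using c(1) c(2)[of 0] by (auto simp: \<kappa>_def)
  have lap': "horizontal (laplace f z) = - 8 * \<kappa> * p z * q z" "laplace f z $ 3 = 4 * \<kappa> * ((norm (p z))\<^sup>2 - (norm (q z))\<^sup>2)" for z
    unfolding lap \<sigma>_const[of z] n_def vec3_scaleR horizontal_vec3 vec3_nth
    by (simp_all add: \<kappa>_def scaleR_conv_of_real)
  have comm: "dir_deriv 1 Y z = dir_deriv \<i> X z" for z
    unfolding X_def Y_def by (rule dir_deriv_commute[OF f])
  have lapXY: "laplace f z = dir_deriv 1 X z + dir_deriv \<i> Y z" for z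
    by (simp add: laplace_def X_def Y_def)
  \<comment> \<open>The operator \<open>\<partial>\<^sub>x + \<i> \<partial>\<^sub>y\<close> undoes
    the derivative by \<open>z\<close> up to half a Laplacian, as the mixed derivatives cancel by
    \<open>comm\<close>. The same holds for \<open>B\<close> and \<open>C\<close>.\<close>
  have barA: "A' z 1 + \<i> * A' z \<i> = - 4 * \<kappa> * p z * q z" for z
  proof -
    have "A' z 1 + \<i> * A' z \<i> = horizontal (laplace f z) / 2"
      unfolding A'_def comm lapXY horizontal_linear by (simp add: field_simps)
    then show ?thesis by (simp add: lap')
  qed
  have barB: "B' z 1 + \<i> * B' z \<i> = 4 * \<kappa> * cnj (p z) * h z" for z
  proof -
    have "B' z 1 + \<i> * B' z \<i> = - cnj (horizontal (laplace f z)) / 2"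
      unfolding B'_def comm lapXY horizontal_linear by (simp add: field_simps)
    then show ?thesis by (simp add: lap' q_def)
  qed
  have barC: "C' z 1 + \<i> * C' z \<i> = 2 * \<kappa> * (p z * cnj (p z) - h z * cnj (h z))" for z
  proof -
    have "C' z 1 + \<i> * C' z \<i> = of_real (laplace f z $ 3) / 2"
      unfolding C'_def comm lapXY by (simp add: field_simps)
    then show ?thesis by (simp add: lap' q_def flip: complex_norm_square)
  qed
  have prod: "2 * p z * p' z v = A' z v" "2 * h z * h' z v = B' z v" "p z * h' z v + p' z v * h z = C' z v" for z v
  proof -
    have "((\<lambda>w. (p w)\<^sup>2) has_derivative (\<lambda>v. 2 * p z * p' z v)) (at z)" "((\<lambda>w. (h w)\<^sup>2) has_derivative (\<lambda>v. 2 * h z * h' z v)) (at z)"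
      by (auto intro!: derivative_eq_intros p' h')
    then have "(\<lambda>v. 2 * p z * p' z v) = A' z" "(\<lambda>v. 2 * h z * h' z v) = B' z"
      unfolding ph(3,4) using dA dB has_derivative_unique by blast+
    moreover have "((\<lambda>w. p w * h w) has_derivative (\<lambda>v. p z * h' z v + p' z v * h z)) (at z)"
      by (rule has_derivative_mult[OF p'(1) h'(1)])
    then have "(\<lambda>v. p z * h' z v + p' z v * h z) = C' z"
      unfolding ph(5) using dC has_derivative_unique by blast
    ultimately show "2 * p z * p' z v = A' z v" "2 * h z * h' z v = B' z v" "p z * h' z v + p' z v * h z = C' z v"
      by (auto dest: fun_cong[where x=v])
  qed
  have dirac_ph: "p' z 1 + \<i> * p' z \<i> = - 2 * \<kappa> * cnj (h z)" "h' z 1 + \<i> * h' z \<i> = 2 * \<kappa> * cnj (p z)" for z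
  proof -
    define P where "P = p' z 1 + \<i> * p' z \<i>"
    define Q where "Q = h' z 1 + \<i> * h' z \<i>"
    have e1: "2 * p z * P = - 4 * \<kappa> * p z * cnj (h z)"
      using barA[of z] unfolding prod[symmetric] by (simp add: P_def q_def algebra_simps)
    have e2: "2 * h z * Q = 4 * \<kappa> * cnj (p z) * h z"
      using barB[of z] unfolding prod[symmetric] by (simp add: Q_def algebra_simps)
    have e3: "p z * Q + P * h z = 2 * \<kappa> * (p z * cnj (p z) - h z * cnj (h z))"
      using barC[of z] unfolding prod[symmetric] by (simp add: P_def Q_def algebra_simps)
    \<comment> \<open>At a zero of \<open>p\<close> the equation \<open>e1\<close> is void, and
      \<open>e3\<close> determines \<open>P\<close> instead; where \<open>p\<close> is nonzero,
      \<open>e3\<close> determines \<open>Q\<close> in the same way.\<close>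
    have "P = - 2 * \<kappa> * cnj (h z) \<and> Q = 2 * \<kappa> * cnj (p z)"
    proof (cases "p z = 0")
      case False
      have "2 * p z * P = 2 * p z * (- 2 * \<kappa> * cnj (h z))" using e1 by (simp add: mult_ac)
      with False have P: "P = - 2 * \<kappa> * cnj (h z)" by (metis mult_cancel_left mult_eq_0_iff zero_neq_numeral)
      have "p z * Q = p z * (2 * \<kappa> * cnj (p z))" using e3 unfolding P by (simp add: algebra_simps)
      with False P show ?thesis by (metis mult_cancel_left)
    next
      case True
      then have False: "h z \<noteq> 0" using nz by blast
      have "2 * h z * Q = 2 * h z * (2 * \<kappa> * cnj (p z))" using e2 by (simp add: mult_ac)
      with False have Q: "Q = 2 * \<kappa> * cnj (p z)" by (metis mult_cancel_left mult_eq_0_iff zero_neq_numeral)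
      have "h z * P = h z * (- 2 * \<kappa> * cnj (h z))" using e3 unfolding Q by (simp add: algebra_simps eq_neg_iff_add_eq_0)
      with False Q show ?thesis by (metis mult_cancel_left)
    qed
    then show "p' z 1 + \<i> * p' z \<i> = - 2 * \<kappa> * cnj (h z)" "h' z 1 + \<i> * h' z \<i> = 2 * \<kappa> * cnj (p z)"
      by (simp_all add: P_def Q_def)
  qed
  show thesis
  proof (rule that[of p q p' "\<lambda>z v. cnj (h' z v)" \<kappa>])
    show "dir_deriv v f z = vec3 ((p z)\<^sup>2 * v - (q z)\<^sup>2 * cnj v) (2 * Re (p z * cnj (q z) * v))" for z v
      unfolding dir_deriv_cartesian[OF smooth_has_derivative[OF f], of v] X_def[symmetric] Y_def[symmetric] X Y vec3_scaleR vec3_add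
      by (rule arg_cong2[where f=vec3]) (simp_all add: complex_eq_iff algebra_simps)
    show "continuous_on UNIV q" "continuous_on UNIV (\<lambda>z. cnj (h' z v))" for v
      unfolding q_def by (intro continuous_intros ph h')+
    show "(q has_derivative (\<lambda>v. cnj (h' z v))) (at z)" for z
      unfolding q_def by (intro derivative_intros h')
    show "p' z 1 + \<i> * p' z \<i> = - 2 * complex_of_real \<kappa> * q z" for z by (simp add: dirac_ph q_def)
    show "cnj (h' z 1) - \<i> * cnj (h' z \<i>) = 2 * complex_of_real \<kappa> * p z" for z
      using arg_cong[OF dirac_ph(2)[of z], of cnj] by simp
    show "p z \<noteq> 0 \<or> q z \<noteq> 0" for z using nz[of z] by (simp add: q_def)
  qed (use ph p' \<open>\<kappa> \<noteq> 0\<close> in auto)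
qed

text \<open>The spinor is determined up to a sign, which cannot jump.\<close>

lemma spinor_double_period:
  fixes p q :: "complex \<Rightarrow> complex"
  assumes cont: "continuous_on UNIV p" "continuous_on UNIV q" and nz: "\<And>z. p z \<noteq> 0 \<or> q z \<noteq> 0"
    and per: "\<And>z. (p (z + \<gamma>))\<^sup>2 = (p z)\<^sup>2" "\<And>z. (q (z + \<gamma>))\<^sup>2 = (q z)\<^sup>2"
      "\<And>z. p (z + \<gamma>) * cnj (q (z + \<gamma>)) = p z * cnj (q z)"
  shows "p (z + 2 * \<gamma>) = p z" "q (z + 2 * \<gamma>) = q z"
proof -
  \<comment> \<open>The sign relating the two spinors, written as a quotient of Hermitian products:
    this is continuous even where one component vanishes.\<close>
  define s where "s z = (p (z + \<gamma>) * cnj (p z) + q (z + \<gamma>) * cnj (q z)) / (p z * cnj (p z) + q z * cnj (q z))" for z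
  have den: "p z * cnj (p z) + q z * cnj (q z) \<noteq> 0" for z
  proof -
    have "(norm (p z))\<^sup>2 + (norm (q z))\<^sup>2 > 0"
      using nz[of z] by (auto simp: add_pos_nonneg add_nonneg_pos)
    moreover have "p z * cnj (p z) + q z * cnj (q z) = of_real ((norm (p z))\<^sup>2 + (norm (q z))\<^sup>2)"
      unfolding of_real_add complex_norm_square ..
    ultimately show ?thesis by (metis less_irrefl of_real_eq_0_iff)
  qed
  have s: "s z \<in> {1, - 1} \<and> p (z + \<gamma>) = s z * p z \<and> q (z + \<gamma>) = s z * q z" for z
  proof -
    have "\<exists>e\<in>{1, - 1}. p (z + \<gamma>) = e * p z \<and> q (z + \<gamma>) = e * q z"
    proof (cases "p z = 0")
      case True
      then have "q z \<noteq> 0" "p (z + \<gamma>) = 0" using nz[of z] per(1)[of z] by auto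
      then show ?thesis using per(2)[of z] True by (auto simp: power2_eq_iff)
    next
      case False
      obtain e where e: "e \<in> {1, - 1}" "p (z + \<gamma>) = e * p z"
      proof -
        have "p (z + \<gamma>) = p z \<or> p (z + \<gamma>) = - p z" using per(1)[of z] by (simp add: power2_eq_iff)
        then show thesis using that[of 1] that[of "- 1"] by auto
      qed
      have "p z * (e * cnj (q (z + \<gamma>))) = p z * cnj (q z)" using per(3)[of z] e(2) by (simp add: mult_ac)
      then have "e * cnj (q (z + \<gamma>)) = cnj (q z)" using False by (metis mult_cancel_left)
      then have "cnj (e * cnj (q (z + \<gamma>))) = q z" by simp
      then have "q (z + \<gamma>) = e * q z" using e(1) by (auto simp: minus_equation_iff)
      with e show ?thesis by blast
    qed
    then obtain e where e: "e \<in> {1, - 1}" "p (z + \<gamma>) = e * p z" "q (z + \<gamma>) = e * q z" by blast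
    have "s z = e * (p z * cnj (p z) + q z * cnj (q z)) / (p z * cnj (p z) + q z * cnj (q z))"
      unfolding s_def e(2,3) by (simp add: algebra_simps)
    then have "s z = e" using den[of z] by simp
    with e show ?thesis by simp
  qed
  have shift: "continuous_on UNIV (\<lambda>z. g (z + \<gamma>))" if "continuous_on UNIV g" for g :: "complex \<Rightarrow> complex"
    by (rule continuous_on_compose2[OF that]) (auto intro!: continuous_intros)
  have "continuous_on UNIV s"
    unfolding s_def using den by (intro continuous_intros cont shift[OF cont(1)] shift[OF cont(2)]) auto
  moreover have "s ` UNIV \<subseteq> {1, - 1}" using s by blast
  then have "finite (s ` UNIV)" by (rule finite_subset) simp
  ultimately have "s constant_on UNIV"
    by (intro continuous_finite_range_constant connected_UNIV)
  then obtain e where e: "\<And>z. s z = e" by (auto simp: constant_on_def)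
  have "e * e = 1" using s[of 0] e by auto
  have twice: "p ((z + \<gamma>) + \<gamma>) = e * e * p z" "q ((z + \<gamma>) + \<gamma>) = e * e * q z"
    using s[of "z + \<gamma>"] s[of z] unfolding e by (simp_all add: mult.assoc)
  have "z + 2 * \<gamma> = (z + \<gamma>) + \<gamma>" by simp
  then show "p (z + 2 * \<gamma>) = p z" "q (z + 2 * \<gamma>) = q z"
    by (simp_all only: twice \<open>e * e = 1\<close> mult_1)
qed

subsection \<open>Frequencies and periods\<close>

lemma scaled_eq_norm_imp:
  fixes \<omega> \<nu> :: complex
  assumes "r *\<^sub>R \<omega> = s *\<^sub>R \<nu>" "norm \<omega> = norm \<nu>" "\<nu> \<noteq> 0" "r \<noteq> 0"
  shows "\<omega> = \<nu> \<or> \<omega> = - \<nu>"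
proof -
  have "\<bar>r\<bar> * norm \<nu> = \<bar>s\<bar> * norm \<nu>" using arg_cong[OF assms(1), of norm] assms(2) by simp
  then have "\<bar>r\<bar> = \<bar>s\<bar>" using assms(3) by simp
  then have "s = r \<or> s = - r" by (auto simp: abs_if split: if_splits)
  then have "r *\<^sub>R \<omega> = r *\<^sub>R \<nu> \<or> r *\<^sub>R \<omega> = r *\<^sub>R (- \<nu>)" using assms(1) by auto
  then show ?thesis using assms(4) by (metis scaleR_left_imp_eq)
qed

context torus
begin

text \<open>By Cramer's rule the three frequencies satisfy an integral linear relation; taking norms
  shows that the cosine of the angle between \<open>\<omega>\<close> and \<open>\<nu>\<close> is rational.\<close>

lemma three_frequencies_rational:
  assumes mem: "\<omega> \<in> freqs" "\<nu> \<in> freqs" "\<mu> \<in> freqs"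
    and norms: "norm \<omega> = R" "norm \<nu> = R" "norm \<mu> = R" and R: "R > 0"
    and distinct: "\<nu> \<noteq> \<omega>" "\<nu> \<noteq> - \<omega>" "\<mu> \<noteq> \<omega>" "\<mu> \<noteq> - \<omega>" "\<mu> \<noteq> \<nu>" "\<mu> \<noteq> - \<nu>"
  shows "\<exists>b\<in>\<rat>. (norm (\<omega> + \<nu>))\<^sup>2 = b * (norm (\<omega> - \<nu>))\<^sup>2"
proof -
  obtain k l :: int where kl: "\<omega> \<bullet> \<gamma>1 = 2 * pi * k" "\<omega> \<bullet> \<gamma>2 = 2 * pi * l"
    using mem(1) unfolding mem_freqs_iff by blast
  obtain k' l' :: int where kl': "\<nu> \<bullet> \<gamma>1 = 2 * pi * k'" "\<nu> \<bullet> \<gamma>2 = 2 * pi * l'"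
    using mem(2) unfolding mem_freqs_iff by blast
  obtain k'' l'' :: int where kl'': "\<mu> \<bullet> \<gamma>1 = 2 * pi * k''" "\<mu> \<bullet> \<gamma>2 = 2 * pi * l''"
    using mem(3) unfolding mem_freqs_iff by blast
  \<comment> \<open>The three minors of the integer coordinates of the frequencies; they are the
    coefficients in Cramer's rule \<open>rel\<close>.\<close>
  define n where "n = real_of_int (k * l' - k' * l)"
  define x where "x = real_of_int (k'' * l' - k' * l'')"
  define y where "y = real_of_int (k * l'' - k'' * l)"
  have nz: "\<omega> \<noteq> 0" "\<nu> \<noteq> 0" "\<mu> \<noteq> 0" using norms R by auto
  have rel: "n *\<^sub>R \<mu> = x *\<^sub>R \<omega> + y *\<^sub>R \<nu>"
    by (rule inner_eq_imp_eq) (simp_all add: inner_add_left kl kl' kl'' n_def x_def y_def algebra_simps)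
  \<comment> \<open>A vanishing minor would make \<open>\<omega>\<close> and \<open>\<nu>\<close>
    parallel, and parallel vectors of equal length agree up to sign.\<close>
  have "n \<noteq> 0"
  proof
    assume n: "n = 0"
    have "k * l' = k' * l" using n by (simp add: n_def flip: of_int_mult)
    then have kl0: "real_of_int k * l' = real_of_int k' * l" by (metis of_int_mult)
    have "real_of_int k' *\<^sub>R \<omega> = real_of_int k *\<^sub>R \<nu>" "real_of_int l' *\<^sub>R \<omega> = real_of_int l *\<^sub>R \<nu>"
      by (rule inner_eq_imp_eq; use kl0 in \<open>simp add: kl kl' algebra_simps\<close>)+
    moreover have "k' \<noteq> 0 \<or> l' \<noteq> 0"
      using inner_eq_imp_eq[of \<nu> 0] nz kl' by auto
    ultimately show False using scaled_eq_norm_imp[of _ \<omega> _ \<nu>] norms nz distinct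
      by (metis minus_equation_iff of_int_eq_0_iff)
  qed
  \<comment> \<open>If \<open>x\<close> or \<open>y\<close> were zero, \<open>\<mu>\<close> would be
    parallel to one of the others. Both are divisors in the formula for the cosine.\<close>
  have x0: "x \<noteq> 0" using rel scaled_eq_norm_imp[of n \<mu> y \<nu>] \<open>n \<noteq> 0\<close> norms nz distinct by auto
  have y0: "y \<noteq> 0" using rel scaled_eq_norm_imp[of n \<mu> x \<omega>] \<open>n \<noteq> 0\<close> norms nz distinct by auto
  define c where "c = \<omega> \<bullet> \<nu>"
  have sq: "\<omega> \<bullet> \<omega> = R\<^sup>2" "\<nu> \<bullet> \<nu> = R\<^sup>2" "\<mu> \<bullet> \<mu> = R\<^sup>2"
    using norms by (simp_all flip: power2_norm_eq_inner)
  have "(n *\<^sub>R \<mu>) \<bullet> (n *\<^sub>R \<mu>) = (x *\<^sub>R \<omega> + y *\<^sub>R \<nu>) \<bullet> (x *\<^sub>R \<omega> + y *\<^sub>R \<nu>)" by (simp only: rel)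
  then have "n\<^sup>2 * R\<^sup>2 = (x\<^sup>2 + y\<^sup>2) * R\<^sup>2 + 2 * x * y * c"
    by (simp add: inner_add sq c_def inner_commute[of \<nu> \<omega>] power2_eq_square algebra_simps)
  then have cos: "c / R\<^sup>2 = (n\<^sup>2 - x\<^sup>2 - y\<^sup>2) / (2 * x * y)"
    using x0 y0 R by (simp add: field_simps)
  define t where "t = c / R\<^sup>2"
  have "n \<in> \<rat>" "x \<in> \<rat>" "y \<in> \<rat>" by (simp_all add: n_def x_def y_def)
  then have "t \<in> \<rat>" unfolding t_def cos by simp
  have c: "c = t * R\<^sup>2" using R by (simp add: t_def)
  have "(norm (\<omega> + \<nu>))\<^sup>2 = 2 * R\<^sup>2 * (1 + t)" "(norm (\<omega> - \<nu>))\<^sup>2 = 2 * R\<^sup>2 * (1 - t)"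
    unfolding power2_norm_eq_inner
    by (simp_all add: inner_add inner_diff sq inner_commute[of \<nu> \<omega>] c[unfolded c_def] algebra_simps)
  moreover from this(2) have "1 - t \<noteq> 0" using distinct(1) by auto
  ultimately have "(norm (\<omega> + \<nu>))\<^sup>2 = (1 + t) / (1 - t) * (norm (\<omega> - \<nu>))\<^sup>2" by simp
  then show ?thesis using \<open>t \<in> \<rat>\<close> by (intro bexI[of _ "(1 + t) / (1 - t)"]) auto
qed

end

text \<open>The hypotheses express that the mean values of \<open>q\<^sup>2\<close>, \<open>p\<^sup>2\<close> and \<open>p * cnj q\<close> vanish.\<close>

lemma closing_conditions_four_frequencies:
  fixes b :: "complex \<Rightarrow> complex"
  assumes norms: "norm \<omega> = R" "norm \<nu> = R" and R: "R > 0"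
    and S: "S = {\<omega>, - \<omega>} \<or> S = {\<omega>, - \<omega>, \<nu>, - \<nu>} \<and> \<nu> \<noteq> \<omega> \<and> \<nu> \<noteq> - \<omega>"
    and cond: "(\<Sum>\<omega>\<in>S. b \<omega> * b (- \<omega>)) = 0" "(\<Sum>\<omega>\<in>S. (cnj \<omega>)\<^sup>2 * b \<omega> * b (- \<omega>)) = 0"
      "(\<Sum>\<omega>\<in>S. cnj \<omega> * of_real ((norm (b \<omega>))\<^sup>2)) = 0"
    and "\<xi> \<in> S"
  shows "b \<xi> = 0"
proof -
  have nz: "\<omega> \<noteq> 0" "\<nu> \<noteq> 0" using norms R by auto
  have neg: "\<omega> \<noteq> - \<omega>" "\<nu> \<noteq> - \<nu>" using nz by auto
  \<comment> \<open>The product kills one coefficient of an antipodal pair and the equal norms kill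
    the other.\<close>
  have pair: "b \<omega> = 0 \<and> b (- \<omega>) = 0"
    if "b \<omega> * b (- \<omega>) = 0" "(norm (b \<omega>))\<^sup>2 = (norm (b (- \<omega>)))\<^sup>2" for \<omega>
    using that by auto
  from S show ?thesis
  proof
    assume S: "S = {\<omega>, - \<omega>}"
    have "b \<omega> * b (- \<omega>) = 0" using cond(1) neg by (simp add: S mult.commute)
    moreover have "cnj \<omega> * of_real ((norm (b \<omega>))\<^sup>2 - (norm (b (- \<omega>)))\<^sup>2) = 0"
      using cond(3) neg by (simp add: S algebra_simps)
    then have "(norm (b \<omega>))\<^sup>2 - (norm (b (- \<omega>)))\<^sup>2 = 0" using nz by (simp del: of_real_diff of_real_power)
    ultimately have "b \<omega> = 0 \<and> b (- \<omega>) = 0" by (intro pair) simp_all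
    then show ?thesis using \<open>\<xi> \<in> S\<close> unfolding S by blast
  next
    assume "S = {\<omega>, - \<omega>, \<nu>, - \<nu>} \<and> \<nu> \<noteq> \<omega> \<and> \<nu> \<noteq> - \<omega>"
    then have S: "S = {\<omega>, - \<omega>, \<nu>, - \<nu>}" and d: "\<nu> \<noteq> \<omega>" "\<nu> \<noteq> - \<omega>" by blast+
    have d': "\<omega> \<noteq> \<nu>" "\<omega> \<noteq> - \<nu>" "- \<omega> \<noteq> \<nu>" "- \<omega> \<noteq> - \<nu>"
      using d by (metis minus_minus)+
    have sum4: "(\<Sum>x\<in>S. g x) = g \<omega> + g (- \<omega>) + g \<nu> + g (- \<nu>)" for g :: "complex \<Rightarrow> complex"
      unfolding S using neg d' by (simp add: add.assoc)
    define u where "u = b \<omega> * b (- \<omega>)"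
    define w where "w = b \<nu> * b (- \<nu>)"
    have "u + w = 0"
    proof -
      have "2 * (u + w) = 0" using cond(1) unfolding sum4 by (simp add: u_def w_def algebra_simps)
      then show ?thesis by (metis mult_eq_0_iff zero_neq_numeral)
    qed
    moreover have "(cnj \<omega>)\<^sup>2 * u + (cnj \<nu>)\<^sup>2 * w = 0"
    proof -
      have "2 * ((cnj \<omega>)\<^sup>2 * u + (cnj \<nu>)\<^sup>2 * w) = 0" using cond(2) unfolding sum4 by (simp add: u_def w_def algebra_simps)
      then show ?thesis by (metis mult_eq_0_iff zero_neq_numeral)
    qed
    \<comment> \<open>Two linear equations for \<open>u\<close> and \<open>w\<close>, whose
      determinant is nonzero because \<open>\<omega>\<close> and \<open>\<nu>\<close> differ by more
      than a sign.\<close>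
    ultimately have "((cnj \<omega>)\<^sup>2 - (cnj \<nu>)\<^sup>2) * u = 0" by (simp add: algebra_simps eq_neg_iff_add_eq_0[symmetric])
    moreover have "(cnj \<omega>)\<^sup>2 - (cnj \<nu>)\<^sup>2 \<noteq> 0"
      using d' by (simp add: power2_eq_iff flip: complex_cnj_minus)
    ultimately have "u = 0" by simp
    with \<open>u + w = 0\<close> have "w = 0" by simp
    define x where "x = (norm (b \<omega>))\<^sup>2 - (norm (b (- \<omega>)))\<^sup>2"
    define y where "y = (norm (b \<nu>))\<^sup>2 - (norm (b (- \<nu>)))\<^sup>2"
    have "cnj \<omega> * x + cnj \<nu> * y = 0"
      using cond(3) unfolding sum4 by (simp add: x_def y_def algebra_simps)
    then have "cnj (cnj \<omega> * x + cnj \<nu> * y) = 0" by simp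
    \<comment> \<open>A real linear relation between two vectors of equal length that are not equal
      up to sign, so both coefficients vanish.\<close>
    then have xy: "x *\<^sub>R \<omega> = (- y) *\<^sub>R \<nu>"
      by (simp add: scaleR_conv_of_real mult.commute add_eq_0_iff2)
    have "x = 0" using scaled_eq_norm_imp[OF xy] norms nz d' by auto
    with xy nz have "y = 0" by simp
    have "b \<omega> = 0 \<and> b (- \<omega>) = 0" using \<open>u = 0\<close> \<open>x = 0\<close> unfolding u_def x_def by (intro pair) linarith+
    moreover have "b \<nu> = 0 \<and> b (- \<nu>) = 0" using \<open>w = 0\<close> \<open>y = 0\<close> unfolding w_def y_def by (intro pair) linarith+
    ultimately show ?thesis using \<open>\<xi> \<in> S\<close> unfolding S by blast
  qed
qed

section \<open>Fourier coefficients of the spinor and necessity of the rectangle\<close>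

lemma has_derivative_periodic:
  assumes "\<And>z. (g has_derivative g' z) (at z)" "\<And>z. g (z + \<gamma>) = g z"
  shows "g' (z + \<gamma>) = g' z"
proof -
  have "((\<lambda>w. g (w + \<gamma>)) has_derivative g' (z + \<gamma>)) (at z)"
    by (rule has_derivative_compose[where f="\<lambda>w. w + \<gamma>" and g=g, OF _ assms(1)]) (auto intro!: derivative_eq_intros)
  then show ?thesis using has_derivative_unique[OF _ assms(1)] unfolding assms(2) by blast
qed

lemma has_vector_derivative_along_line:
  assumes "\<And>z. (g has_derivative g' z) (at z)"
  shows "((\<lambda>t. g (z + t *\<^sub>R v)) has_vector_derivative g' (z + t *\<^sub>R v) v) (at t)"
proof -
  have "((\<lambda>t. g (z + t *\<^sub>R v)) has_derivative (\<lambda>s. g' (z + t *\<^sub>R v) (s *\<^sub>R v))) (at t)"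
    by (rule has_derivative_compose[where f="\<lambda>t. z + t *\<^sub>R v" and g=g, OF _ assms]) (auto intro!: derivative_eq_intros)
  then show ?thesis
    using linear_scale[OF has_derivative_linear[OF assms]] by (simp add: has_vector_derivative_def)
qed

text \<open>On coefficients the operators
  \<open>\<partial>\<^sub>x + \<i> \<partial>\<^sub>y\<close> and
  \<open>\<partial>\<^sub>x - \<i> \<partial>\<^sub>y\<close> become multiplication by
  \<open>\<i> * \<omega>\<close> and \<open>\<i> * cnj \<omega>\<close>.\<close>

lemma (in torus) fcoef_dirac:
  assumes tf: "torus_fun p" "torus_fun q" "\<And>v. torus_fun (\<lambda>z. p' z v)" "\<And>v. torus_fun (\<lambda>z. q' z v)"
    and der: "\<And>z. (p has_derivative p' z) (at z)" "\<And>z. (q has_derivative q' z) (at z)"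
    and dirac: "\<And>z. p' z 1 + \<i> * p' z \<i> = - 2 * complex_of_real \<kappa> * q z" "\<And>z. q' z 1 - \<i> * q' z \<i> = 2 * complex_of_real \<kappa> * p z"
    and \<omega>: "\<omega> \<in> freqs"
  shows "\<i> * \<omega> * fcoef \<omega> p = - 2 * complex_of_real \<kappa> * fcoef \<omega> q"
    "\<i> * cnj \<omega> * fcoef \<omega> q = 2 * complex_of_real \<kappa> * fcoef \<omega> p"
proof -
  have dp: "fcoef \<omega> (\<lambda>z. p' z v) = \<i> * of_real (\<omega> \<bullet> v) * fcoef \<omega> p"
    and dq: "fcoef \<omega> (\<lambda>z. q' z v) = \<i> * of_real (\<omega> \<bullet> v) * fcoef \<omega> q" for v
    using has_vector_derivative_along_line[OF der(1)] has_vector_derivative_along_line[OF der(2)]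
    by (auto intro!: fcoef_directional_derivative tf \<omega>)
  have "fcoef \<omega> (\<lambda>z. p' z 1 + \<i> * p' z \<i>) = \<i> * (of_real (\<omega> \<bullet> 1) + \<i> * of_real (\<omega> \<bullet> \<i>)) * fcoef \<omega> p"
    by (subst fcoef_add[OF tf(3) torus_fun_mult[OF torus_fun_const tf(3)]]) (simp add: fcoef_cmult dp algebra_simps)
  also have "of_real (\<omega> \<bullet> 1) + \<i> * of_real (\<omega> \<bullet> \<i>) = \<omega>" by (simp add: complex_eq_iff)
  finally show "\<i> * \<omega> * fcoef \<omega> p = - 2 * complex_of_real \<kappa> * fcoef \<omega> q"
    unfolding dirac fcoef_cmult by (rule sym)
  have "fcoef \<omega> (\<lambda>z. q' z 1 + (- \<i>) * q' z \<i>) = \<i> * (of_real (\<omega> \<bullet> 1) - \<i> * of_real (\<omega> \<bullet> \<i>)) * fcoef \<omega> q"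
    by (subst fcoef_add[OF tf(4) torus_fun_mult[OF torus_fun_const tf(4)]]) (simp only: fcoef_cmult dq, simp add: algebra_simps)
  also have "of_real (\<omega> \<bullet> 1) - \<i> * of_real (\<omega> \<bullet> \<i>) = cnj \<omega>" by (simp add: complex_eq_iff)
  also have "(\<lambda>z. q' z 1 + (- \<i>) * q' z \<i>) = (\<lambda>z. 2 * complex_of_real \<kappa> * p z)"
    using dirac(2) by simp
  finally show "\<i> * cnj \<omega> * fcoef \<omega> q = 2 * complex_of_real \<kappa> * fcoef \<omega> p"
    unfolding fcoef_cmult by (rule sym)
qed

lemma independent_double:
  fixes a b :: complex
  assumes "independent {a, b}"
  shows "independent {2 * a, 2 * b}"
proof -
  have "independent ((\<lambda>z. 2 *\<^sub>R z) ` {a, b})"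
    by (rule linear_independent_injective_image[OF _ assms]) (auto simp: inj_on_def intro: linear_scale_self)
  then show ?thesis by (simp add: scaleR_conv_of_real)
qed

text \<open>The case distinction counts antipodal pairs on the circle of frequencies. With at most
  two pairs the spinor would vanish at 0, which an immersion forbids; only with three pairs is the
  absence of a rectangle contradicted.\<close>

lemma rational_rectangle_if_dirac_torus:
  assumes ind: "independent {a, b}" "a \<noteq> b" and dirac: "dirac_torus (int_span a b) f"
  shows "\<exists>\<omega>1 \<omega>2. \<exists>r::real. spans_rectangular_sublattice (dual_lattice (int_span a b)) \<omega>1 \<omega>2 \<and>
            r \<in> \<rat> \<and> (norm \<omega>1)\<^sup>2 = r * (norm \<omega>2)\<^sup>2"
proof (rule ccontr)
  assume no_rectangle: "\<not> ?thesis"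
  have f: "smooth f" and per: "\<And>z \<gamma>. \<gamma> \<in> int_span a b \<Longrightarrow> f (z + \<gamma>) = f z"
    using dirac by (auto simp: dirac_torus_def conformal_immersion_def)
  obtain p q p' q' \<kappa> where
    df: "\<And>z v. dir_deriv v f z = vec3 ((p z)\<^sup>2 * v - (q z)\<^sup>2 * cnj v) (2 * Re (p z * cnj (q z) * v))" and
    cont: "continuous_on UNIV p" "continuous_on UNIV q" and
    der: "\<And>z. (p has_derivative p' z) (at z)" "\<And>z. (q has_derivative q' z) (at z)" and
    cont': "\<And>v. continuous_on UNIV (\<lambda>z. p' z v)" "\<And>v. continuous_on UNIV (\<lambda>z. q' z v)" and
    dirac_eq: "\<And>z. p' z 1 + \<i> * p' z \<i> = - 2 * complex_of_real \<kappa> * q z" "\<And>z. q' z 1 - \<i> * q' z \<i> = 2 * complex_of_real \<kappa> * p z" and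
    nz: "\<And>z. p z \<noteq> 0 \<or> q z \<noteq> 0" and \<kappa>: "\<kappa> \<noteq> 0"
    by (rule dirac_torus_spinor[OF ind dirac], rule that)
  \<comment> \<open>A translation by the original lattice may change the sign of the spinor, so
    frequencies are taken for the doubled one.\<close>
  interpret torus "2 * a" "2 * b"
    by unfold_locales (use ind independent_double in auto)
  define R where "R = 2 * \<bar>\<kappa>\<bar>"
  have R: "R > 0" using \<kappa> by (simp add: R_def)
  define circle where "circle = {\<omega> \<in> freqs. norm \<omega> = R}"
  \<comment> \<open>The quadratic expressions in the spinor are linear in the derivative of
    \<open>f\<close>: they inherit its periods, and their mean values vanish.\<close>
  have horiz: "(p z)\<^sup>2 = (horizontal (dir_deriv 1 f z) - \<i> * horizontal (dir_deriv \<i> f z)) / 2"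
    "(q z)\<^sup>2 = - (horizontal (dir_deriv 1 f z) + \<i> * horizontal (dir_deriv \<i> f z)) / 2"
    "p z * cnj (q z) = (of_real (dir_deriv 1 f z $ 3) - \<i> * of_real (dir_deriv \<i> f z $ 3)) / 2" for z
    unfolding df by (simp_all add: complex_eq_iff algebra_simps)
  have double_period: "p (z + 2 * \<gamma>) = p z" "q (z + 2 * \<gamma>) = q z" if "\<gamma> \<in> int_span a b" for \<gamma> z
  proof -
    have shift: "dir_deriv v f (z + \<gamma>) = dir_deriv v f z" for v z
      using has_derivative_periodic[OF smooth_has_derivative[OF f] per[OF that]] by metis
    have "(p (z + \<gamma>))\<^sup>2 = (p z)\<^sup>2" "(q (z + \<gamma>))\<^sup>2 = (q z)\<^sup>2"
      "p (z + \<gamma>) * cnj (q (z + \<gamma>)) = p z * cnj (q z)" for z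
      unfolding horiz shift by (rule refl)+
    from spinor_double_period[OF cont nz this] show "p (z + 2 * \<gamma>) = p z" "q (z + 2 * \<gamma>) = q z" .
  qed
  have pq_per: "p (z + 2 * a) = p z" "p (z + 2 * b) = p z" "q (z + 2 * a) = q z" "q (z + 2 * b) = q z" for z
    by (intro double_period generator_in_int_span)+
  have tf: "torus_fun p" "torus_fun q" "torus_fun (\<lambda>z. p' z v)" "torus_fun (\<lambda>z. q' z v)" for v
    unfolding torus_fun_def using cont cont' pq_per
      has_derivative_periodic[OF der(1)] has_derivative_periodic[OF der(2)] by auto
  note coef = fcoef_dirac[OF tf(1,2,3,4) der dirac_eq]
  have coef_p: "fcoef \<omega> p = \<i> * cnj \<omega> / (2 * complex_of_real \<kappa>) * fcoef \<omega> q" if "\<omega> \<in> freqs" for \<omega>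
    using coef(2)[OF that] \<kappa> by (simp add: field_simps)
  \<comment> \<open>Eliminating the coefficient of \<open>p\<close> from the two equations leaves
    the factor \<open>(norm \<omega>)\<^sup>2 - 4 * \<kappa>\<^sup>2\<close>.\<close>
  have coef_q0: "fcoef \<omega> q = 0" if "\<omega> \<in> freqs" "\<omega> \<notin> circle" for \<omega>
  proof -
    have "\<i> * \<omega> * (\<i> * cnj \<omega> / (2 * complex_of_real \<kappa>) * fcoef \<omega> q) = - 2 * complex_of_real \<kappa> * fcoef \<omega> q"
      using coef(1)[OF that(1)] unfolding coef_p[OF that(1)] .
    then have "(\<omega> * cnj \<omega> - 4 * (complex_of_real \<kappa>)\<^sup>2) * fcoef \<omega> q = 0"
      using \<kappa> by (simp add: field_simps power2_eq_square)
    moreover have "\<omega> * cnj \<omega> - 4 * (complex_of_real \<kappa>)\<^sup>2 = of_real ((norm \<omega>)\<^sup>2 - R\<^sup>2)"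
      by (simp add: complex_norm_square R_def power_mult_distrib flip: of_real_power)
    moreover have "(norm \<omega>)\<^sup>2 \<noteq> R\<^sup>2"
      using that R norm_ge_zero[of \<omega>] by (auto simp: circle_def power2_eq_iff simp del: norm_ge_zero)
    ultimately show ?thesis by (simp del: of_real_diff of_real_power)
  qed
  have circle_neg: "- \<omega> \<in> circle" if "\<omega> \<in> circle" for \<omega>
    using that freqs_closed(2) by (auto simp: circle_def)
  \<comment> \<open>A derivative of a periodic function has mean zero, the case of frequency 0 in
    the derivative rule.\<close>
  have mean_f: "fcoef 0 (\<lambda>z. horizontal (dir_deriv v f z)) = 0" "fcoef 0 (\<lambda>z. complex_of_real (dir_deriv v f z $ 3)) = 0"
    and tf_f: "torus_fun (\<lambda>z. horizontal (dir_deriv v f z))" "torus_fun (\<lambda>z. complex_of_real (dir_deriv v f z $ 3))" for v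
  proof -
    have p2: "f (z + 2 * a) = f z" "f (z + 2 * b) = f z" for z
      using per[OF generator_in_int_span(1)[of a b], of "z + a"] per[OF generator_in_int_span(1)[of a b], of z]
        per[OF generator_in_int_span(2)[of b a], of "z + b"] per[OF generator_in_int_span(2)[of b a], of z]
      by (simp_all add: algebra_simps)
    have dp2: "dir_deriv v f (z + 2 * a) = dir_deriv v f z" "dir_deriv v f (z + 2 * b) = dir_deriv v f z" for z
      using has_derivative_periodic[OF smooth_has_derivative[OF f]] p2 by metis+
    have c: "continuous_on UNIV f" "continuous_on UNIV (dir_deriv v f)"
      using f by (auto intro: smooth_continuous smooth_dir_deriv)
    show t1: "torus_fun (\<lambda>z. horizontal (dir_deriv v f z))" "torus_fun (\<lambda>z. complex_of_real (dir_deriv v f z $ 3))"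
      unfolding torus_fun_def dp2 by (auto intro!: continuous_intros c bounded_linear.continuous_on[OF bounded_linear_horizontal])
    have t0: "torus_fun (\<lambda>z. horizontal (f z))" "torus_fun (\<lambda>z. complex_of_real (f z $ 3))"
      unfolding torus_fun_def p2 by (auto intro!: continuous_intros c bounded_linear.continuous_on[OF bounded_linear_horizontal])
    have d: "((\<lambda>z. horizontal (f z)) has_derivative (\<lambda>v. horizontal (dir_deriv v f z))) (at z)"
      "((\<lambda>z. complex_of_real (f z $ 3)) has_derivative (\<lambda>v. complex_of_real (dir_deriv v f z $ 3))) (at z)" for z
      by (intro bounded_linear.has_derivative[OF bounded_linear_horizontal] has_derivative_of_real
          bounded_linear.has_derivative[OF bounded_linear_vec_nth] smooth_has_derivative f)+
    show "fcoef 0 (\<lambda>z. horizontal (dir_deriv v f z)) = 0" "fcoef 0 (\<lambda>z. complex_of_real (dir_deriv v f z $ 3)) = 0"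
      using fcoef_directional_derivative[OF t0(1) t1(1) zero_freq has_vector_derivative_along_line[OF d(1)]]
        fcoef_directional_derivative[OF t0(2) t1(2) zero_freq has_vector_derivative_along_line[OF d(2)]] by simp_all
  qed
  have closing: "fcoef 0 (\<lambda>z. p z * p z) = 0" "fcoef 0 (\<lambda>z. q z * q z) = 0" "fcoef 0 (\<lambda>z. p z * cnj (q z)) = 0"
  proof -
    have comb: "fcoef 0 (\<lambda>z. c * g z + d * h z) = 0"
      if "torus_fun g" "torus_fun h" "fcoef 0 g = 0" "fcoef 0 h = 0" for c d g h
      using that by (subst fcoef_add) (auto intro: torus_fun_mult torus_fun_const simp: fcoef_cmult)
    have "p z * p z = (1 / 2) * horizontal (dir_deriv 1 f z) + (- \<i> / 2) * horizontal (dir_deriv \<i> f z)"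
      "q z * q z = (- 1 / 2) * horizontal (dir_deriv 1 f z) + (- \<i> / 2) * horizontal (dir_deriv \<i> f z)"
      "p z * cnj (q z) = (1 / 2) * of_real (dir_deriv 1 f z $ 3) + (- \<i> / 2) * of_real (dir_deriv \<i> f z $ 3)" for z
      unfolding power2_eq_square[symmetric] horiz by (simp_all add: field_simps)
    then show "fcoef 0 (\<lambda>z. p z * p z) = 0" "fcoef 0 (\<lambda>z. q z * q z) = 0" "fcoef 0 (\<lambda>z. p z * cnj (q z)) = 0"
      by (simp_all only: comb tf_f mean_f)
  qed
  \<comment> \<open>Phrased to cover no pair, one pair and two pairs at once: for the empty circle
    the conditions on \<open>\<omega>\<close> and \<open>\<nu>\<close> are void, and a single pair
    is treated with \<open>\<nu> = \<omega>\<close>.\<close>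
  have no_S: False
    if S: "finite S" "circle = S" "\<omega> \<in> circle \<Longrightarrow> \<nu> \<in> circle \<Longrightarrow> S = {\<omega>, - \<omega>} \<or> S = {\<omega>, - \<omega>, \<nu>, - \<nu>} \<and> \<nu> \<noteq> \<omega> \<and> \<nu> \<noteq> - \<omega>"
      "S \<noteq> {} \<Longrightarrow> \<omega> \<in> circle \<and> \<nu> \<in> circle"
    for S \<omega> \<nu>
  proof -
    have sub: "S \<subseteq> freqs" using S(2) by (auto simp: circle_def)
    have neg: "\<And>\<omega>. \<omega> \<in> S \<Longrightarrow> - \<omega> \<in> S" using circle_neg S(2) by blast
    define b where "b \<omega> = fcoef \<omega> q" for \<omega>
    have q: "q z = (\<Sum>\<omega>\<in>S. b \<omega> * wave \<omega> z)" for z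
      unfolding b_def using coef_q0 S(2) by (intro fourier_expansion tf S(1) sub) auto
    have p: "p z = (\<Sum>\<omega>\<in>S. (\<i> * cnj \<omega> / (2 * complex_of_real \<kappa>) * b \<omega>) * wave \<omega> z)" for z
    proof -
      have "p z = (\<Sum>\<omega>\<in>S. fcoef \<omega> p * wave \<omega> z)"
        using coef_q0 S(2) by (intro fourier_expansion tf S(1) sub) (auto simp: coef_p)
      also have "\<dots> = (\<Sum>\<omega>\<in>S. (\<i> * cnj \<omega> / (2 * complex_of_real \<kappa>) * b \<omega>) * wave \<omega> z)"
        using sub by (intro sum.cong refl) (auto simp: coef_p b_def)
      finally show ?thesis .
    qed
    \<comment> \<open>Conjugation reverses frequencies, so the sum is reindexed by negation.\<close>
    have cq: "cnj (q z) = (\<Sum>\<omega>\<in>S. cnj (b (- \<omega>)) * wave \<omega> z)" for z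
      unfolding q cnj_sum complex_cnj_mult cnj_wave
      by (rule sum.reindex_bij_witness[where i=uminus and j=uminus]) (auto simp: neg)
    have "(\<Sum>\<omega>\<in>S. b \<omega> * b (- \<omega>)) = 0"
      using fcoef_0_product[OF S(1) sub neg q q] closing by simp
    moreover have "(\<Sum>\<omega>\<in>S. (cnj \<omega>)\<^sup>2 * b \<omega> * b (- \<omega>)) = 0"
    proof -
      have "(\<Sum>\<omega>\<in>S. (\<i> * cnj \<omega> / (2 * complex_of_real \<kappa>) * b \<omega>) * (\<i> * cnj (- \<omega>) / (2 * complex_of_real \<kappa>) * b (- \<omega>))) = 0"
        using fcoef_0_product[OF S(1) sub neg p p] closing by simp
      also have "(\<Sum>\<omega>\<in>S. (\<i> * cnj \<omega> / (2 * complex_of_real \<kappa>) * b \<omega>) * (\<i> * cnj (- \<omega>) / (2 * complex_of_real \<kappa>) * b (- \<omega>)))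
          = 1 / (4 * (complex_of_real \<kappa>)\<^sup>2) * (\<Sum>\<omega>\<in>S. (cnj \<omega>)\<^sup>2 * b \<omega> * b (- \<omega>))"
        unfolding sum_distrib_left by (intro sum.cong refl) (simp add: power2_eq_square field_simps)
      finally show ?thesis using \<kappa> by simp
    qed
    moreover have "(\<Sum>\<omega>\<in>S. cnj \<omega> * of_real ((norm (b \<omega>))\<^sup>2)) = 0"
    proof -
      have "(\<Sum>\<omega>\<in>S. (\<i> * cnj \<omega> / (2 * complex_of_real \<kappa>) * b \<omega>) * cnj (b (- (- \<omega>)))) = 0"
        using fcoef_0_product[OF S(1) sub neg p cq] closing by simp
      also have "(\<Sum>\<omega>\<in>S. (\<i> * cnj \<omega> / (2 * complex_of_real \<kappa>) * b \<omega>) * cnj (b (- (- \<omega>))))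
          = \<i> / (2 * complex_of_real \<kappa>) * (\<Sum>\<omega>\<in>S. cnj \<omega> * of_real ((norm (b \<omega>))\<^sup>2))"
        unfolding sum_distrib_left complex_norm_square by (intro sum.cong refl) simp
      finally show ?thesis using \<kappa> by simp
    qed
    ultimately have b0: "b \<xi> = 0" if "\<xi> \<in> S" for \<xi>
    proof -
      have "\<omega> \<in> circle" "\<nu> \<in> circle" using S(4) that by blast+
      then show ?thesis
        using closing_conditions_four_frequencies[OF _ _ R S(3)] that
          \<open>(\<Sum>\<omega>\<in>S. b \<omega> * b (- \<omega>)) = 0\<close> \<open>(\<Sum>\<omega>\<in>S. (cnj \<omega>)\<^sup>2 * b \<omega> * b (- \<omega>)) = 0\<close>
          \<open>(\<Sum>\<omega>\<in>S. cnj \<omega> * of_real ((norm (b \<omega>))\<^sup>2)) = 0\<close>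
        by (simp add: circle_def)
    qed
    have "p 0 = 0" "q 0 = 0" unfolding p q using b0 by simp_all
    then show False using nz[of 0] by simp
  qed
  show False
  proof (cases "circle = {}")
    case True
    show False by (rule no_S[of "{}"]) (use True in auto)
  next
    case False
    then obtain \<omega> where \<omega>: "\<omega> \<in> circle" by blast
    show False
    proof (cases "circle = {\<omega>, - \<omega>}")
      case True
      show False by (rule no_S[of "{\<omega>, - \<omega>}" \<omega> \<omega>]) (use True \<omega> in auto)
    next
      case False
      then obtain \<nu> where \<nu>: "\<nu> \<in> circle" "\<nu> \<noteq> \<omega>" "\<nu> \<noteq> - \<omega>" using \<omega> circle_neg by blast
      show False
      proof (cases "circle = {\<omega>, - \<omega>, \<nu>, - \<nu>}")
        case True
        show False by (rule no_S[of "{\<omega>, - \<omega>, \<nu>, - \<nu>}" \<omega> \<nu>]) (use True \<omega> \<nu> in auto)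
      next
        case False
        then obtain \<mu> where \<mu>: "\<mu> \<in> circle" "\<mu> \<noteq> \<omega>" "\<mu> \<noteq> - \<omega>" "\<mu> \<noteq> \<nu>" "\<mu> \<noteq> - \<nu>"
          using \<omega> \<nu> circle_neg by blast
        obtain r where r: "r \<in> \<rat>" "(norm (\<omega> + \<nu>))\<^sup>2 = r * (norm (\<omega> - \<nu>))\<^sup>2"
          using three_frequencies_rational[of \<omega> \<nu> \<mu> R] \<omega> \<nu> \<mu> R by (auto simp: circle_def)
        \<comment> \<open>\<open>freqs\<close> belongs to the doubled lattice, and moving the factor
          2 across the inner product turns its elements into vectors dual to the original
          one.\<close>
        have dual: "2 * \<xi> \<in> dual_lattice (int_span a b)" if "\<xi> \<in> freqs" for \<xi>
        proof -
          have "\<exists>k::int. (2 * \<xi>) \<bullet> \<gamma> = 2 * pi * k" if \<gamma>: "\<gamma> \<in> int_span a b" for \<gamma>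
          proof -
            obtain m n :: int where "\<gamma> = of_int m * a + of_int n * b" using \<gamma> unfolding int_span_def by blast
            then have "2 * \<gamma> = of_int m * (2 * a) + of_int n * (2 * b)" by (simp add: algebra_simps)
            then have "2 * \<gamma> \<in> int_span (2 * a) (2 * b)" by (metis int_span_memI)
            then obtain k :: int where "\<xi> \<bullet> (2 * \<gamma>) = 2 * pi * k"
              using \<open>\<xi> \<in> freqs\<close> unfolding freqs_def dual_lattice_def by blast
            then show ?thesis by (intro exI[of _ k]) (simp add: inner_complex_def algebra_simps)
          qed
          then show ?thesis unfolding dual_lattice_def by blast
        qed
        have of_int_freqs: "of_int k * \<xi> \<in> freqs" if "\<xi> \<in> freqs" for k :: int and \<xi>
        proof (induction k rule: int_induct[where k=0])
          case base
          then show ?case by (simp add: zero_freq)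
        next
          case (step1 i)
          then show ?case using freqs_closed(1)[OF _ that, of "of_int i * \<xi>"] by (simp add: algebra_simps)
        next
          case (step2 i)
          then show ?case using freqs_closed(1)[OF _ freqs_closed(2)[OF that that], of "of_int i * \<xi>"] by (simp add: algebra_simps)
        qed
        have mem: "\<omega> \<in> freqs" "\<nu> \<in> freqs" and nm: "norm \<omega> = R" "norm \<nu> = R" using \<omega> \<nu> by (auto simp: circle_def)
        \<comment> \<open>The diagonals of the rhombus on \<open>\<omega>\<close> and
          \<open>\<nu>\<close>, doubled to land in the dual lattice.\<close>
        have "spans_rectangular_sublattice (dual_lattice (int_span a b)) (2 * (\<omega> + \<nu>)) (2 * (\<omega> - \<nu>))"
          unfolding spans_rectangular_sublattice_def
        proof (intro conjI subsetI)
          show "2 * (\<omega> + \<nu>) \<noteq> 0" using \<nu>(3) by (simp add: add_eq_0_iff)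
          show "2 * (\<omega> - \<nu>) \<noteq> 0" using \<nu>(2) by simp
          have "(\<omega> + \<nu>) \<bullet> (\<omega> - \<nu>) = (norm \<omega>)\<^sup>2 - (norm \<nu>)\<^sup>2"
            by (simp add: power2_norm_eq_inner inner_add inner_diff inner_commute)
          then have "(\<omega> + \<nu>) \<bullet> (\<omega> - \<nu>) = 0" using nm by simp
          moreover have double: "(2 * x) \<bullet> (2 * y) = 4 * (x \<bullet> y)" for x y :: complex by (simp add: inner_complex_def)
          ultimately show "(2 * (\<omega> + \<nu>)) \<bullet> (2 * (\<omega> - \<nu>)) = 0" by (simp only: double mult_zero_right)
          fix x assume "x \<in> int_span (2 * (\<omega> + \<nu>)) (2 * (\<omega> - \<nu>))"
          then obtain m n :: int where "x = of_int m * (2 * (\<omega> + \<nu>)) + of_int n * (2 * (\<omega> - \<nu>))"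
            unfolding int_span_def by blast
          then have "x = 2 * (of_int (m + n) * \<omega> + of_int (m - n) * \<nu>)" by (simp add: algebra_simps)
          then show "x \<in> dual_lattice (int_span a b)"
            using dual[OF freqs_closed(1)[OF of_int_freqs[OF mem(1)] of_int_freqs[OF mem(2)]]] by blast
        qed
        moreover have "(norm (2 * (\<omega> + \<nu>)))\<^sup>2 = r * (norm (2 * (\<omega> - \<nu>)))\<^sup>2"
        proof -
          have "(norm (2 * x))\<^sup>2 = 4 * (norm x)\<^sup>2" for x :: complex
            by (simp add: norm_mult power_mult_distrib)
          then show ?thesis by (simp only: r(2) mult.left_commute)
        qed
        ultimately show False using no_rectangle r(1) by blast
      qed
    qed
  qed
qed

theorem theorem3:
  fixes \<Gamma> :: "complex set"
  assumes "complex_lattice \<Gamma>"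
  shows "(\<exists>f. dirac_torus \<Gamma> f) \<longleftrightarrow>
         (\<exists>\<omega>1 \<omega>2 :: complex. \<exists>b :: real.
            spans_rectangular_sublattice (dual_lattice \<Gamma>) \<omega>1 \<omega>2 \<and>
            b \<in> \<rat> \<and> (norm \<omega>1)\<^sup>2 = b * (norm \<omega>2)\<^sup>2)"
proof -
  obtain a b where "a \<noteq> b" "independent {a, b}" "\<Gamma> = int_span a b"
    using assms unfolding complex_lattice_def by blast
  then show ?thesis
    using rational_rectangle_if_dirac_torus dirac_torus_if_rational_rectangle by blast
qed

end
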